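(* Let $d\ge 2$. Suppose that there exist constants $r\in(0,\infty)$ and $a,b>0$ such that for all $t\ge 0$, $$\mathbb{P}(\tau_e\ge t)\le a e^{-bt^{r}},$$ and that $\mathbb{P}(\tau_e=0)<p_c(d)$. Then there exists a positive constant $C$ such that $$\lim_{N\to\infty}\mathbb{P}\left(\sup_{\gamma\in\mathbb{O}_N}\mathcal{M}(\gamma)\le C\,\mathrm{f}_{d,r}(N)\right)=1.$$
   Context: First-passage percolation on $\mathbb{Z}^d$: $\mathrm{E}^d$ is the set of non-oriented nearest-neighbour edges $\langle v,w\rangle$, $v,w\in\mathbb{Z}^d$, $|v-w|_1=1$. The weights $\tau=\{\tau_e\}_{e\in \mathrm{E}^d}$ are i.i.d. non-negative random variables. A path $\gamma$ from $v$ to $w$ is a finite sequence $(x_0,\dots,x_l)$ of vertices with $x_0=v$, $x_l=w$ and consecutive vertices adjacent; it is also regarded as a sequence of edges. $\mathrm{T}(\gamma)=\sum_{e\in\gamma}\tau_e$, $\mathrm{T}(v,w)=\inf_{\gamma:v\to w}\mathrm{T}(\gamma)$, and $\mathbb{O}(v,w)$ is the set of paths $\gamma:v\to w$ with $\mathrm{T}(\gamma)=\mathrm{T}(v,w)$ (optimal paths). $\mathbb{O}_N=\mathbb{O}(0,N\mathbf{e}_1)$, where $\mathbf{e}_1$ is the first unit coordinate vector. $\mathcal{M}(\gamma)=\sup_{e\in\gamma}\tau_e$. $p_c(d)$ is the critical probability of (bond) percolation on $\mathbb{Z}^d$. The function $\mathrm{f}_{d,r}(N)$ ($d\ge2$,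 $r\ge 0$) is: $(\log N)(\log\log N)^{-1}$ if $r=0$; $(\log N)^{\frac1{1+r}}$ if $0<r<d-1$; $(\log N)^{\frac1d}(\log\log N)^{\frac{d-2}{d}}$ if $r=d-1$; $(\log N)^{\frac1d}$ if $d-1<r<d$; $(\log N)^{\frac1d}(\log\log N)^{-\frac1d}$ if $r=d$; $(\log N)^{\frac1r}$ if $r>d$. *)

theory Defs
  imports "HOL-Probability.Probability"
begin

text \<open>The lattice of dimension d is the set of integer-valued functions supported on the
  coordinates below d; coordinate 0 plays the role of the first coordinate.\<close>

type_synonym vertex = "nat \<Rightarrow> int"
type_synonym edge = "vertex set"

definition lattice :: "nat \<Rightarrow> vertex set" where
  "lattice d = {x. \<forall>i\<ge>d. x i = 0}"

definition adjacent :: "nat \<Rightarrow> vertex \<Rightarrow> vertex \<Rightarrow> bool" where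
  "adjacent d v w \<longleftrightarrow> v \<in> lattice d \<and> w \<in> lattice d \<and> (\<Sum>i<d. \<bar>v i - w i\<bar>) = 1"

definition edges :: "nat \<Rightarrow> edge set" where
  "edges d = {{v, w} | v w. adjacent d v w}"

definition origin :: vertex where
  "origin = (\<lambda>_. 0)"

definition e1 :: vertex where
  "e1 = (\<lambda>i. if i = 0 then 1 else 0)"

text \<open>Paths are nonempty vertex lists; they need not be self-avoiding, and a path of length zero
  is allowed.\<close>

definition paths :: "nat \<Rightarrow> vertex \<Rightarrow> vertex \<Rightarrow> vertex list set" where
  "paths d v w = {xs. xs \<noteq> [] \<and> hd xs = v \<and> last xs = w \<and> set xs \<subseteq> lattice d \<and>
     successively (adjacent d) xs}"

definition path_edges :: "vertex list \<Rightarrow> edge list" where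
  "path_edges xs = map2 (\<lambda>x y. {x, y}) xs (tl xs)"

text \<open>An edge traversed several times contributes its weight each time.\<close>

definition path_time :: "(edge \<Rightarrow> real) \<Rightarrow> vertex list \<Rightarrow> real" where
  "path_time t xs = sum_list (map t (path_edges xs))"

definition passage_time :: "nat \<Rightarrow> (edge \<Rightarrow> real) \<Rightarrow> vertex \<Rightarrow> vertex \<Rightarrow> real" where
  "passage_time d t v w = (INF xs\<in>paths d v w. path_time t xs)"

definition optimal_paths :: "nat \<Rightarrow> (edge \<Rightarrow> real) \<Rightarrow> vertex \<Rightarrow> vertex \<Rightarrow> vertex list set" where
  "optimal_paths d t v w = {xs \<in> paths d v w. path_time t xs = passage_time d t v w}"

text \<open>Suprema are taken in the extended reals, since the set of optimal paths may be empty or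
  infinite (and \<^const>\<open>Sup\<close> on the reals is unspecified on empty or unbounded sets).\<close>

definition max_weight :: "(edge \<Rightarrow> real) \<Rightarrow> vertex list \<Rightarrow> ereal" where
  "max_weight t xs = (SUP e\<in>set (path_edges xs). ereal (t e))"

definition open_cluster :: "nat \<Rightarrow> (edge \<Rightarrow> bool) \<Rightarrow> vertex set" where
  "open_cluster d \<eta> = {v. \<exists>xs\<in>paths d origin v. \<forall>e\<in>set (path_edges xs). \<eta> e}"

definition bernoulli_percolation :: "nat \<Rightarrow> real \<Rightarrow> (edge \<Rightarrow> bool) measure" where
  "bernoulli_percolation d p = (\<Pi>\<^sub>M e\<in>edges d. measure_pmf (bernoulli_pmf p))"

definition percolation_probability :: "nat \<Rightarrow> real \<Rightarrow> real" where
  "percolation_probability d p =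
     measure (bernoulli_percolation d p)
       {\<eta> \<in> space (bernoulli_percolation d p). infinite (open_cluster d \<eta>)}"

definition critical_probability :: "nat \<Rightarrow> real" where
  "critical_probability d = Sup {p \<in> {0..1}. percolation_probability d p = 0}"

text \<open>Only large \<open>N\<close> matters: for \<open>N \<le> 2\<close> the (iterated) logarithm need not be positive.\<close>

definition f_rate :: "nat \<Rightarrow> real \<Rightarrow> nat \<Rightarrow> real" where
  "f_rate d r N =
    (let L = ln (real N); LL = ln (ln (real N)) in
     if r = 0 then L * inverse LL
     else if r < real d - 1 then L powr (1 / (1 + r))
     else if r = real d - 1 then L powr (1 / real d) * LL powr ((real d - 2) / real d)
     else if r < real d then L powr (1 / real d)
     else if r = real d then L powr (1 / real d) * LL powr (- 1 / real d)
     else L powr (1 / r))"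

end

theory Submission
  imports Defs "HOL-Real_Asymp.Real_Asymp"
begin

text \<open>
  Why the bound holds. Suppose that an optimal path from the origin to \<open>N e\<^sub>1\<close> uses an edge
  \<open>{x, y}\<close> of weight at least \<open>m\<close>. Every vertex \<open>u\<close> that the path visits before this edge and every
  vertex \<open>v\<close> that it visits afterwards are then at passage time at least \<open>m\<close> from each other, since
  replacing the stretch between them cannot save time
  (\<open>heavy_edge_on_optimal_path\<close>). Unless \<open>x\<close> is close to an endpoint, the path crosses each sphere of
  the supremum norm around \<open>x\<close> of radius \<open>j = 1, ..., J\<close> both before and after the edge, where \<open>J\<close> is
  a small multiple of \<open>m\<close>. So on each of these \<open>J\<close> disjoint spheres there are two points at passage
  time at least \<open>m\<close>. Call such a vertex \<open>x\<close> bad. As the spheres are disjoint, the costs of these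
  \<open>J\<close> requirements add up.

  The cost of one sphere. If two points of a sphere are joined by a family of paths and \<open>w e\<close> is the
  average number of times that a path of the family uses \<open>e\<close>, then the passage time between the
  points is at most the sum of the \<open>w e * \<tau> e\<close>. A Chernoff bound for this linear functional
  gives, for \<open>r > 1\<close>, a probability \<open>exp (- c m\<^sup>r / Z ^ (r - 1))\<close> where \<open>Z\<close> is the sum of
  the powers \<open>w e\<close> to the conjugate exponent \<open>r / (r - 1)\<close>; for \<open>r \<le> 1\<close> it gives
  \<open>exp (- c m\<^sup>r)\<close> already for a single path, once the weights are truncated at \<open>m\<close>. To make \<open>Z\<close>
  small, the paths pass through random points, uniform in boxes of side \<open>2 ^ i\<close> for
  increasing \<open>i\<close>, and move parallel to the axes in between
  (\<open>multiscale_transport\<close>); then \<open>Z\<close> is a geometric sum over the scales, and the position of \<open>r\<close>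
  relative to \<open>d - 1\<close> decides whether it converges, is logarithmic, or is dominated by
  the largest scale. Summing over the spheres yields the cost of a bad vertex (\<open>bad_vertex_decay\<close>).
  Its inverse function is exactly the rate \<open>f_rate\<close>, up to constants, so that the constant \<open>C\<close> can be
  chosen such that a bad vertex has probability at most a large negative power of \<open>N\<close>.
  If \<open>r > d\<close> the rate is the size of the largest weight in a box of polynomial size.

  Only polynomially many vertices matter. It remains to see that optimal paths stay in a box of
  polynomial size (\<open>optimal_paths_confined\<close>). As \<open>P(\<tau> = 0)\<close> is below the critical probability, so is
  \<open>P(\<tau> \<le> \<epsilon>)\<close> for some \<open>\<epsilon> > 0\<close>, and the clusters of edges of weight at most \<open>\<epsilon>\<close> have
  exponentially decaying radius. Hence a path that goes very far meets many edges of weight more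
  than \<open>\<epsilon>\<close> and is slower than the straight path. Exponential decay below the critical probability,
  which is defined through the percolation probability, is proved by the argument of
  Duminil-Copin and Tassion: either the expected number of open exits from some finite set is below
  one, which gives exponential decay by exploring clusters (\<open>theta_exponential_decay\<close>), or a
  differential inequality forces percolation at every larger parameter (\<open>theta_lower_bound\<close>).
\<close>

section \<open>Finite Bernoulli percolation as a polynomial\<close>

definition bern_weight :: "real \<Rightarrow> 'e set \<Rightarrow> 'e set \<Rightarrow> real" where
  "bern_weight p E \<omega> = p ^ card \<omega> * (1 - p) ^ card (E - \<omega>)"

text \<open>Finite percolation is treated as a polynomial in \<open>p\<close>, since it has to be differentiated in \<open>p\<close>;
  an event is a predicate on the set of open edges.\<close>

definition bern_prob :: "real \<Rightarrow> 'e set \<Rightarrow> ('e set \<Rightarrow> bool) \<Rightarrow> real" where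
  "bern_prob p E A = (\<Sum>\<omega>\<in>Pow E. bern_weight p E \<omega> * of_bool (A \<omega>))"

lemma bern_weight_nonneg: "0 \<le> p \<Longrightarrow> p \<le> 1 \<Longrightarrow> 0 \<le> bern_weight p E \<omega>"
  by (simp add: bern_weight_def)

lemma bern_weight_Un:
  assumes "finite E1" "finite E2" "E1 \<inter> E2 = {}" "\<omega>1 \<subseteq> E1" "\<omega>2 \<subseteq> E2"
  shows "bern_weight p (E1 \<union> E2) (\<omega>1 \<union> \<omega>2) = bern_weight p E1 \<omega>1 * bern_weight p E2 \<omega>2"
proof -
  have f: "finite \<omega>1" "finite \<omega>2" using assms by (simp_all add: finite_subset)
  have 1: "card (\<omega>1 \<union> \<omega>2) = card \<omega>1 + card \<omega>2"
    by (rule card_Un_disjoint) (use assms f in auto)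
  have "E1 \<union> E2 - (\<omega>1 \<union> \<omega>2) = (E1 - \<omega>1) \<union> (E2 - \<omega>2)" using assms by blast
  then have 2: "card (E1 \<union> E2 - (\<omega>1 \<union> \<omega>2)) = card (E1 - \<omega>1) + card (E2 - \<omega>2)"
    by simp (rule card_Un_disjoint, use assms in auto)
  show ?thesis unfolding bern_weight_def 1 2 by (simp add: power_add)
qed

lemma bern_prob_nonneg: "0 \<le> p \<Longrightarrow> p \<le> 1 \<Longrightarrow> 0 \<le> bern_prob p E A"
  by (simp add: bern_prob_def bern_weight_nonneg sum_nonneg)

lemma bern_prob_True:
  assumes "finite E"
  shows "bern_prob p E (\<lambda>_. True) = 1"
proof -
  have "(\<Prod>e\<in>E. p + (1 - p)) = (\<Sum>\<omega>\<in>Pow E. (\<Prod>e\<in>\<omega>. p) * (\<Prod>e\<in>E - \<omega>. 1 - p))"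
    by (rule prod_add) (rule assms)
  then show ?thesis by (simp add: bern_prob_def bern_weight_def)
qed

lemma bern_prob_mono:
  assumes "0 \<le> p" "p \<le> 1" "\<And>\<omega>. \<omega> \<subseteq> E \<Longrightarrow> A \<omega> \<Longrightarrow> B \<omega>"
  shows "bern_prob p E A \<le> bern_prob p E B"
  unfolding bern_prob_def
  by (intro sum_mono mult_left_mono) (use assms in \<open>auto simp: bern_weight_nonneg of_bool_def\<close>)

lemma bern_prob_cong:
  assumes "\<And>\<omega>. \<omega> \<subseteq> E \<Longrightarrow> A \<omega> = B \<omega>"
  shows "bern_prob p E A = bern_prob p E B"
  unfolding bern_prob_def by (intro sum.cong) (use assms in auto)

lemma bern_prob_le_1:
  assumes "finite E" "0 \<le> p" "p \<le> 1"
  shows "bern_prob p E A \<le> 1"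
  using bern_prob_mono[of p E A "\<lambda>_. True"] bern_prob_True[of E p] assms by simp

lemma bern_prob_union_bound:
  assumes "0 \<le> p" "p \<le> 1" "finite I" "\<And>\<omega>. \<omega> \<subseteq> E \<Longrightarrow> A \<omega> \<Longrightarrow> \<exists>i\<in>I. B i \<omega>"
  shows "bern_prob p E A \<le> (\<Sum>i\<in>I. bern_prob p E (B i))"
proof -
  have "bern_prob p E A \<le> (\<Sum>\<omega>\<in>Pow E. \<Sum>i\<in>I. bern_weight p E \<omega> * of_bool (B i \<omega>))"
    unfolding bern_prob_def
  proof (rule sum_mono)
    fix \<omega> assume w: "\<omega> \<in> Pow E"
    have "of_bool (A \<omega>) \<le> (\<Sum>i\<in>I. of_bool (B i \<omega>) :: real)"
    proof (cases "A \<omega>")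
      case True
      then obtain i where "i \<in> I" "B i \<omega>" using assms(4) w by blast
      then have "(1::real) \<le> (\<Sum>i\<in>{i}. of_bool (B i \<omega>))" by simp
      also have "\<dots> \<le> (\<Sum>i\<in>I. of_bool (B i \<omega>))"
        by (rule sum_mono2) (use assms(3) \<open>i \<in> I\<close> in auto)
      finally show ?thesis using True by simp
    qed (simp add: sum_nonneg)
    then show "bern_weight p E \<omega> * of_bool (A \<omega>) \<le> (\<Sum>i\<in>I. bern_weight p E \<omega> * of_bool (B i \<omega>))"
      unfolding sum_distrib_left[symmetric] by (rule mult_left_mono[OF _ bern_weight_nonneg[OF assms(1,2)]])
  qed
  also have "\<dots> = (\<Sum>i\<in>I. bern_prob p E (B i))"
    unfolding bern_prob_def by (rule sum.swap)
  finally show ?thesis .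
qed

lemma bern_prob_partition:
  assumes "finite I" "finite E" "\<And>\<omega>. \<omega> \<subseteq> E \<Longrightarrow> A \<omega> \<Longrightarrow> f \<omega> \<in> I"
  shows "bern_prob p E A = (\<Sum>i\<in>I. bern_prob p E (\<lambda>\<omega>. f \<omega> = i \<and> A \<omega>))"
proof -
  have "(\<Sum>i\<in>I. bern_prob p E (\<lambda>\<omega>. f \<omega> = i \<and> A \<omega>))
      = (\<Sum>\<omega>\<in>Pow E. \<Sum>i\<in>I. bern_weight p E \<omega> * of_bool (f \<omega> = i \<and> A \<omega>))"
    unfolding bern_prob_def by (rule sum.swap)
  also have "\<dots> = bern_prob p E A" unfolding bern_prob_def
  proof (rule sum.cong[OF refl])
    fix \<omega> assume w: "\<omega> \<in> Pow E"
    have "(\<Sum>i\<in>I. of_bool (f \<omega> = i \<and> A \<omega>) :: real) = of_bool (A \<omega>)"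
    proof (cases "A \<omega>")
      case True
      then have "f \<omega> \<in> I" using assms w by blast
      have "(\<Sum>i\<in>I. of_bool (f \<omega> = i \<and> A \<omega>) :: real) = (\<Sum>i\<in>I. if f \<omega> = i then 1 else 0)"
        using True by (intro sum.cong) auto
      then show ?thesis using assms(1) \<open>f \<omega> \<in> I\<close> True by simp
    qed simp
    then show "(\<Sum>i\<in>I. bern_weight p E \<omega> * of_bool (f \<omega> = i \<and> A \<omega>)) = bern_weight p E \<omega> * of_bool (A \<omega>)"
      by (simp only: sum_distrib_left[symmetric])
  qed
  finally show ?thesis ..
qed

lemma bern_prob_compl:
  assumes "finite E"
  shows "bern_prob p E (\<lambda>\<omega>. \<not> A \<omega>) = 1 - bern_prob p E A"
proof -
  have "bern_prob p E A + bern_prob p E (\<lambda>\<omega>. \<not> A \<omega>) = bern_prob p E (\<lambda>_. True)"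
    unfolding bern_prob_def sum.distrib[symmetric]
    by (intro sum.cong) auto
  then show ?thesis using bern_prob_True[OF assms, of p] by simp
qed

lemma sum_Pow_Un:
  assumes "finite E1" "finite E2" "E1 \<inter> E2 = {}"
  shows "(\<Sum>\<omega>\<in>Pow (E1 \<union> E2). f \<omega>) = (\<Sum>\<omega>1\<in>Pow E1. \<Sum>\<omega>2\<in>Pow E2. f (\<omega>1 \<union> \<omega>2))"
proof -
  have "(\<Sum>\<omega>\<in>Pow (E1 \<union> E2). f \<omega>) = (\<Sum>x\<in>Pow E1 \<times> Pow E2. f (fst x \<union> snd x))"
  proof (rule sum.reindex_bij_witness[of _ "\<lambda>x. fst x \<union> snd x" "\<lambda>\<omega>. (\<omega> \<inter> E1, \<omega> \<inter> E2)"])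
    fix x assume "x \<in> Pow E1 \<times> Pow E2"
    then have "(fst x \<union> snd x) \<inter> E1 = fst x" "(fst x \<union> snd x) \<inter> E2 = snd x"
      using assms(3) by fastforce+
    then show "((fst x \<union> snd x) \<inter> E1, (fst x \<union> snd x) \<inter> E2) = x" by simp
  next
    fix \<omega> assume "\<omega> \<in> Pow (E1 \<union> E2)"
    then have "\<omega> \<inter> E1 \<union> \<omega> \<inter> E2 = \<omega>" by blast
    then show "fst (\<omega> \<inter> E1, \<omega> \<inter> E2) \<union> snd (\<omega> \<inter> E1, \<omega> \<inter> E2) = \<omega>"
      "f (fst (\<omega> \<inter> E1, \<omega> \<inter> E2) \<union> snd (\<omega> \<inter> E1, \<omega> \<inter> E2)) = f \<omega>" by simp_all
  qed auto
  also have "\<dots> = (\<Sum>\<omega>1\<in>Pow E1. \<Sum>\<omega>2\<in>Pow E2. f (\<omega>1 \<union> \<omega>2))"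
    by (simp add: sum.cartesian_product case_prod_unfold)
  finally show ?thesis .
qed

lemma bern_prob_indep:
  assumes "finite E1" "finite E2" "E1 \<inter> E2 = {}"
  shows "bern_prob p (E1 \<union> E2) (\<lambda>\<omega>. A (\<omega> \<inter> E1) \<and> B (\<omega> \<inter> E2)) = bern_prob p E1 A * bern_prob p E2 B"
proof -
  have "bern_prob p (E1 \<union> E2) (\<lambda>\<omega>. A (\<omega> \<inter> E1) \<and> B (\<omega> \<inter> E2))
     = (\<Sum>\<omega>1\<in>Pow E1. \<Sum>\<omega>2\<in>Pow E2. (bern_weight p E1 \<omega>1 * of_bool (A \<omega>1)) * (bern_weight p E2 \<omega>2 * of_bool (B \<omega>2)))"
    unfolding bern_prob_def sum_Pow_Un[OF assms]
  proof (intro sum.cong refl)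
    fix \<omega>1 \<omega>2 assume w: "\<omega>1 \<in> Pow E1" "\<omega>2 \<in> Pow E2"
    have "(\<omega>1 \<union> \<omega>2) \<inter> E1 = \<omega>1" "(\<omega>1 \<union> \<omega>2) \<inter> E2 = \<omega>2" using w assms by blast+
    then show "bern_weight p (E1 \<union> E2) (\<omega>1 \<union> \<omega>2) *
        of_bool (A ((\<omega>1 \<union> \<omega>2) \<inter> E1) \<and> B ((\<omega>1 \<union> \<omega>2) \<inter> E2))
       = (bern_weight p E1 \<omega>1 * of_bool (A \<omega>1)) * (bern_weight p E2 \<omega>2 * of_bool (B \<omega>2))"
      using bern_weight_Un[OF assms] w by auto
  qed
  then show ?thesis by (simp add: bern_prob_def sum_product)
qed

lemma bern_prob_restrict:
  assumes "finite E" "E1 \<subseteq> E"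
  shows "bern_prob p E (\<lambda>\<omega>. A (\<omega> \<inter> E1)) = bern_prob p E1 A"
proof -
  have "E = E1 \<union> (E - E1)" using assms by blast
  then have "bern_prob p E (\<lambda>\<omega>. A (\<omega> \<inter> E1)) = bern_prob p (E1 \<union> (E - E1)) (\<lambda>\<omega>. A (\<omega> \<inter> E1) \<and> True)"
    by simp
  also have "\<dots> = bern_prob p E1 A * bern_prob p (E - E1) (\<lambda>_. True)"
    by (rule bern_prob_indep) (use assms in \<open>auto simp: finite_subset\<close>)
  finally show ?thesis using assms by (simp add: bern_prob_True)
qed

lemma bern_prob_indep_sub:
  assumes "finite E" "E1 \<subseteq> E" "E2 \<subseteq> E" "E1 \<inter> E2 = {}"
  shows "bern_prob p E (\<lambda>\<omega>. A (\<omega> \<inter> E1) \<and> B (\<omega> \<inter> E2)) = bern_prob p E (\<lambda>\<omega>. A (\<omega> \<inter> E1)) * bern_prob p E (\<lambda>\<omega>. B (\<omega> \<inter> E2))"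
proof -
  have f: "finite E1" "finite E2" using assms by (simp_all add: finite_subset)
  have "bern_prob p E (\<lambda>\<omega>. A (\<omega> \<inter> E1) \<and> B (\<omega> \<inter> E2))
      = bern_prob p E (\<lambda>\<omega>. (\<lambda>\<omega>. A (\<omega> \<inter> E1) \<and> B (\<omega> \<inter> E2)) (\<omega> \<inter> (E1 \<union> E2)))"
    by (rule bern_prob_cong) (simp add: Int_assoc Int_absorb1 Int_absorb2)
  also have "\<dots> = bern_prob p (E1 \<union> E2) (\<lambda>\<omega>. A (\<omega> \<inter> E1) \<and> B (\<omega> \<inter> E2))"
    by (rule bern_prob_restrict) (use assms in auto)
  also have "\<dots> = bern_prob p E1 A * bern_prob p E2 B"
    by (rule bern_prob_indep) (use assms f in auto)
  finally show ?thesis using assms by (simp add: bern_prob_restrict)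
qed

lemma bern_prob_image:
  assumes "finite E" "inj_on f E"
  shows "bern_prob p (f ` E) A = bern_prob p E (\<lambda>\<omega>. A (f ` \<omega>))"
  unfolding bern_prob_def
proof -
  have bij: "bij_betw ((`) f) (Pow E) (Pow (f ` E))"
    using assms(2) by (simp add: bij_betw_Pow inj_on_imp_bij_betw)
  have "(\<Sum>\<omega>\<in>Pow (f ` E). bern_weight p (f ` E) \<omega> * of_bool (A \<omega>))
     = (\<Sum>\<omega>\<in>Pow E. bern_weight p (f ` E) (f ` \<omega>) * of_bool (A (f ` \<omega>)))"
    by (rule sum.reindex_bij_betw[OF bij, symmetric])
  also have "\<dots> = (\<Sum>\<omega>\<in>Pow E. bern_weight p E \<omega> * of_bool (A (f ` \<omega>)))"
  proof (intro sum.cong refl)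
    fix \<omega> assume "\<omega> \<in> Pow E"
    then have "card (f ` \<omega>) = card \<omega>" "card (f ` E - f ` \<omega>) = card (E - \<omega>)"
      using assms(2) by (auto simp: card_image inj_on_subset inj_on_image_set_diff[symmetric])
    then show "bern_weight p (f ` E) (f ` \<omega>) * of_bool (A (f ` \<omega>)) = bern_weight p E \<omega> * of_bool (A (f ` \<omega>))"
      by (simp add: bern_weight_def)
  qed
  finally show "(\<Sum>\<omega>\<in>Pow (f ` E). bern_weight p (f ` E) \<omega> * of_bool (A \<omega>))
     = (\<Sum>\<omega>\<in>Pow E. bern_weight p E \<omega> * of_bool (A (f ` \<omega>)))" .
qed

lemma bern_prob_single:
  assumes "finite E" "e \<in> E"
  shows "bern_prob p E (\<lambda>\<omega>. e \<in> \<omega>) = p"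
proof -
  have "bern_prob p E (\<lambda>\<omega>. e \<in> \<omega>) = bern_prob p E (\<lambda>\<omega>. e \<in> (\<omega> \<inter> {e}))" by simp
  also have "\<dots> = bern_prob p {e} (\<lambda>\<omega>. e \<in> \<omega>)" by (rule bern_prob_restrict) (use assms in auto)
  also have "\<dots> = p" by (simp add: bern_prob_def bern_weight_def Pow_insert)
  finally show ?thesis .
qed

lemma bern_prob_continuous: "continuous_on UNIV (\<lambda>p. bern_prob p E A)"
  unfolding bern_prob_def bern_weight_def by (intro continuous_intros)

text \<open>Russo's formula in terms of closed pivotal edges. Differentiating the weight of a
  configuration produces one term for each open and one for each closed edge, and opening a closed
  edge pairs the two kinds of terms.\<close>

lemma russo_formula:
  fixes A :: "'e set \<Rightarrow> bool"
  assumes fin: "finite E" and p: "0 < p" "p < 1"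
    and mono: "\<And>\<omega> e. \<omega> \<subseteq> E \<Longrightarrow> e \<in> E \<Longrightarrow> A \<omega> \<Longrightarrow> A (insert e \<omega>)"
  shows "((\<lambda>p. bern_prob p E A) has_real_derivative
     (\<Sum>\<omega>\<in>Pow E. bern_weight p E \<omega> * of_bool (\<not> A \<omega>) * card {e \<in> E - \<omega>. A (insert e \<omega>)}) / (1 - p)) (at p)"
proof -
  \<comment> \<open>the logarithmic derivative of the weight, one term per edge\<close>
  define D where "D \<omega> = (\<Sum>e\<in>E. if e \<in> \<omega> then bern_weight p E \<omega> / p else - bern_weight p E \<omega> / (1 - p))" for \<omega>
  have der: "((\<lambda>p. bern_weight p E \<omega>) has_real_derivative D \<omega>) (at p)" if w: "\<omega> \<subseteq> E" for \<omega>
  proof -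
    have fw: "finite \<omega>" using w fin by (simp add: finite_subset)
    have "D \<omega> = (\<Sum>e\<in>\<omega>. bern_weight p E \<omega> / p) + (\<Sum>e\<in>E - \<omega>. - bern_weight p E \<omega> / (1 - p))"
      unfolding D_def sum.subset_diff[OF w fin] by (simp add: add.commute)
    then have D: "D \<omega> = card \<omega> * (bern_weight p E \<omega> / p) - card (E - \<omega>) * (bern_weight p E \<omega> / (1 - p))"
      by simp
    have pw: "real n * x ^ (n - Suc 0) = real n * (x ^ n / x)" if "x \<noteq> 0" for n and x :: real
      using that by (cases n) auto
    show ?thesis unfolding D unfolding bern_weight_def
      by (rule derivative_eq_intros refl | simp)+
        (use p in \<open>simp add: pw; simp add: field_simps\<close>)
  qed
  have "((\<lambda>p. bern_prob p E A) has_real_derivative (\<Sum>\<omega>\<in>Pow E. D \<omega> * of_bool (A \<omega>))) (at p)"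
    unfolding bern_prob_def
    by (intro DERIV_sum DERIV_cmult_right der) auto
  moreover have "(\<Sum>\<omega>\<in>Pow E. D \<omega> * of_bool (A \<omega>))
    = (\<Sum>\<omega>\<in>Pow E. bern_weight p E \<omega> * of_bool (\<not> A \<omega>) * card {e \<in> E - \<omega>. A (insert e \<omega>)}) / (1 - p)"
  proof -
    have "(\<Sum>\<omega>\<in>Pow E. D \<omega> * of_bool (A \<omega>))
      = (\<Sum>e\<in>E. \<Sum>\<omega>\<in>Pow E. (if e \<in> \<omega> then bern_weight p E \<omega> / p else - bern_weight p E \<omega> / (1 - p)) * of_bool (A \<omega>))"
      unfolding D_def sum_distrib_right by (rule sum.swap)
    also have "\<dots> = (\<Sum>e\<in>E. \<Sum>\<omega>\<in>Pow E. bern_weight p E \<omega> * of_bool (\<not> A \<omega>) * of_bool (e \<notin> \<omega> \<and> A (insert e \<omega>)) / (1 - p))"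
    proof (rule sum.cong[OF refl])
      fix e assume e: "e \<in> E"
      define P0 where "P0 = Pow (E - {e})"
      \<comment> \<open>configurations are paired according to the state of the edge \<open>e\<close>\<close>
      have split: "(\<Sum>\<omega>\<in>Pow E. f \<omega>) = (\<Sum>\<omega>\<in>P0. f \<omega> + f (insert e \<omega>))" for f :: "'e set \<Rightarrow> real"
      proof -
        have E: "E = (E - {e}) \<union> {e}" using e by blast
        have "(\<Sum>\<omega>\<in>Pow E. f \<omega>) = (\<Sum>\<omega>\<in>P0. \<Sum>\<omega>2\<in>Pow {e}. f (\<omega> \<union> \<omega>2))"
          by (subst E, subst sum_Pow_Un) (use fin in \<open>auto simp: P0_def\<close>)
        also have "\<dots> = (\<Sum>\<omega>\<in>P0. f \<omega> + f (insert e \<omega>))"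
          by (intro sum.cong refl) (simp add: Pow_insert)
        finally show ?thesis .
      qed
      show "(\<Sum>\<omega>\<in>Pow E. (if e \<in> \<omega> then bern_weight p E \<omega> / p else - bern_weight p E \<omega> / (1 - p)) * of_bool (A \<omega>))
        = (\<Sum>\<omega>\<in>Pow E. bern_weight p E \<omega> * of_bool (\<not> A \<omega>) * of_bool (e \<notin> \<omega> \<and> A (insert e \<omega>)) / (1 - p))"
        unfolding split
      proof (intro sum.cong refl)
        fix \<omega> assume w: "\<omega> \<in> P0"
        have ne: "e \<notin> \<omega>" and wE: "\<omega> \<subseteq> E" using w by (auto simp: P0_def)
        have fw: "finite \<omega>" using wE fin by (simp add: finite_subset)
        have "E - \<omega> = insert e (E - insert e \<omega>)" using e ne by blast
        then have "card (E - \<omega>) = Suc (card (E - insert e \<omega>))" using fin by (metis Diff_iff card_insert_disjoint finite_Diff insertI1)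
        then have bw: "bern_weight p E (insert e \<omega>) / p = bern_weight p E \<omega> / (1 - p)"
          using p ne fw by (simp add: bern_weight_def)
        have "A \<omega> \<Longrightarrow> A (insert e \<omega>)" using mono wE e by blast
        then show "(if e \<in> \<omega> then bern_weight p E \<omega> / p else - bern_weight p E \<omega> / (1 - p)) * of_bool (A \<omega>) +
         (if e \<in> insert e \<omega> then bern_weight p E (insert e \<omega>) / p else - bern_weight p E (insert e \<omega>) / (1 - p)) * of_bool (A (insert e \<omega>))
         = bern_weight p E \<omega> * of_bool (\<not> A \<omega>) * of_bool (e \<notin> \<omega> \<and> A (insert e \<omega>)) / (1 - p) +
         bern_weight p E (insert e \<omega>) * of_bool (\<not> A (insert e \<omega>)) * of_bool (e \<notin> insert e \<omega> \<and> A (insert e (insert e \<omega>))) / (1 - p)"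
          using ne bw by auto
      qed
    qed
    also have "\<dots> = (\<Sum>\<omega>\<in>Pow E. \<Sum>e\<in>E. bern_weight p E \<omega> * of_bool (\<not> A \<omega>) * of_bool (e \<notin> \<omega> \<and> A (insert e \<omega>)) / (1 - p))"
      by (rule sum.swap)
    also have "\<dots> = (\<Sum>\<omega>\<in>Pow E. bern_weight p E \<omega> * of_bool (\<not> A \<omega>) * card {e \<in> E - \<omega>. A (insert e \<omega>)} / (1 - p))"
    proof (rule sum.cong[OF refl])
      fix \<omega>
      have "real (card {e \<in> E - \<omega>. A (insert e \<omega>)}) = (\<Sum>e\<in>E. of_bool (e \<notin> \<omega> \<and> A (insert e \<omega>)))"
      proof -
        have "{e \<in> E - \<omega>. A (insert e \<omega>)} = E \<inter> {e. e \<notin> \<omega> \<and> A (insert e \<omega>)}" by blast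
        then show ?thesis using fin by (simp add: sum_of_bool_eq)
      qed
      then show "(\<Sum>e\<in>E. bern_weight p E \<omega> * of_bool (\<not> A \<omega>) * of_bool (e \<notin> \<omega> \<and> A (insert e \<omega>)) / (1 - p)) =
         bern_weight p E \<omega> * of_bool (\<not> A \<omega>) * card {e \<in> E - \<omega>. A (insert e \<omega>)} / (1 - p)"
        by (simp add: sum_distrib_left sum_divide_distrib)
    qed
    finally show ?thesis by (simp add: sum_divide_distrib)
  qed
  ultimately show ?thesis by simp
qed

text \<open>Increasing events become more likely with \<open>p\<close>: all terms in Russo's formula are nonnegative.\<close>

lemma bern_prob_mono_p:
  assumes fin: "finite E" and p: "0 \<le> p" "p \<le> p'" "p' \<le> 1"
    and mono: "\<And>\<omega> e. \<omega> \<subseteq> E \<Longrightarrow> e \<in> E \<Longrightarrow> A \<omega> \<Longrightarrow> A (insert e \<omega>)"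
  shows "bern_prob p E A \<le> bern_prob p' E A"
proof (rule DERIV_nonneg_imp_increasing_open[of p p' "\<lambda>p. bern_prob p E A"])
  show "continuous_on {p..p'} (\<lambda>p. bern_prob p E A)"
    using bern_prob_continuous continuous_on_subset by blast
  fix x assume x: "p < x" "x < p'"
  then have x': "0 < x" "x < 1" using p by auto
  show "\<exists>y. ((\<lambda>p. bern_prob p E A) has_real_derivative y) (at x) \<and> 0 \<le> y"
    by (rule exI, rule conjI, rule russo_formula[OF fin x'], rule mono)
      (use x' in \<open>auto intro!: divide_nonneg_pos sum_nonneg mult_nonneg_nonneg bern_weight_nonneg\<close>)
qed (use p in auto)

section \<open>Boxes and open clusters\<close>

text \<open>Balls of the supremum norm.\<close>

definition lbox :: "nat \<Rightarrow> vertex \<Rightarrow> nat \<Rightarrow> vertex set" where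
  "lbox d x n = {y \<in> lattice d. \<forall>i<d. \<bar>y i - x i\<bar> \<le> int n}"

definition touching :: "nat \<Rightarrow> vertex set \<Rightarrow> edge set" where
  "touching d S = {e \<in> edges d. e \<inter> S \<noteq> {}}"

definition inner_edges :: "nat \<Rightarrow> vertex set \<Rightarrow> edge set" where
  "inner_edges d S = {e \<in> edges d. e \<subseteq> S}"

definition exit_steps :: "nat \<Rightarrow> vertex set \<Rightarrow> (vertex \<times> vertex) set" where
  "exit_steps d S = {(x, y). x \<in> S \<and> y \<notin> S \<and> adjacent d x y}"

definition open_step :: "edge set \<Rightarrow> (vertex \<times> vertex) set" where
  "open_step \<omega> = {(u, v). {u, v} \<in> \<omega>}"

definition exits :: "edge set \<Rightarrow> vertex set \<Rightarrow> vertex \<Rightarrow> bool" where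
  "exits \<omega> \<Lambda> v \<longleftrightarrow> (\<exists>z. z \<notin> \<Lambda> \<and> (v, z) \<in> (open_step \<omega>)\<^sup>*)"

lemma lbox_eq_PiE_dflt: "lbox d x n = PiE_dflt {..<d} 0 (\<lambda>i. {x i - int n..x i + int n})"
proof (rule set_eqI)
  fix y
  have "(y \<in> lattice d \<and> (\<forall>i<d. y i \<in> {x i - int n..x i + int n})) \<longleftrightarrow>
    (\<forall>i. (i < d \<longrightarrow> y i \<in> {x i - int n..x i + int n}) \<and> (\<not> i < d \<longrightarrow> y i = 0))"
    unfolding lattice_def by (simp add: not_less) blast
  moreover have "\<bar>y i - x i\<bar> \<le> int n \<longleftrightarrow> y i \<in> {x i - int n..x i + int n}" for i
    by (simp add: abs_diff_le_iff)
  ultimately show "y \<in> lbox d x n \<longleftrightarrow> y \<in> PiE_dflt {..<d} 0 (\<lambda>i. {x i - int n..x i + int n})"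
    by (simp only: lbox_def PiE_dflt_def mem_Collect_eq lessThan_iff)
qed

lemma finite_lbox [simp, intro]: "finite (lbox d x n)"
  unfolding lbox_eq_PiE_dflt by (rule finite_PiE_dflt) auto

lemma card_lbox: "card (lbox d x n) = (2 * n + 1) ^ d"
  unfolding lbox_eq_PiE_dflt by (subst card_PiE_dflt) (simp_all add: nat_add_distrib nat_mult_distrib)

lemma lbox_mono:
  assumes "m \<le> n" shows "lbox d x m \<subseteq> lbox d x n"
proof
  fix y assume "y \<in> lbox d x m"
  then have y: "y \<in> lattice d" "\<And>i. i < d \<Longrightarrow> \<bar>y i - x i\<bar> \<le> int m" by (auto simp: lbox_def)
  have "\<bar>y i - x i\<bar> \<le> int n" if "i < d" for i using y(2)[OF that] assms by linarith
  then show "y \<in> lbox d x n" using y(1) by (simp add: lbox_def)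
qed

lemma lbox_self: "x \<in> lattice d \<Longrightarrow> x \<in> lbox d x n"
  by (simp add: lbox_def)

lemma lbox_sub_lattice: "lbox d x n \<subseteq> lattice d"
  by (auto simp: lbox_def)

lemma lbox_trans:
  assumes "y \<in> lbox d x m" "z \<in> lbox d y n"
  shows "z \<in> lbox d x (m + n)"
proof -
  have "\<bar>z i - x i\<bar> \<le> int (m + n)" if "i < d" for i
  proof -
    have "\<bar>y i - x i\<bar> \<le> int m" "\<bar>z i - y i\<bar> \<le> int n" using assms that by (auto simp: lbox_def)
    then show ?thesis by linarith
  qed
  then show ?thesis using assms by (simp add: lbox_def)
qed

lemma lbox_sym: "x \<in> lattice d \<Longrightarrow> y \<in> lbox d x n \<Longrightarrow> x \<in> lbox d y n"
  unfolding lbox_def by (auto simp: abs_minus_commute)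

lemma adjacent_sym: "adjacent d v w \<Longrightarrow> adjacent d w v"
  by (auto simp: adjacent_def abs_minus_commute)

lemma adjacent_lbox:
  assumes "adjacent d u v"
  shows "v \<in> lbox d u 1"
proof -
  have "\<bar>v i - u i\<bar> \<le> 1" if "i < d" for i
  proof -
    have "\<bar>u i - v i\<bar> \<le> (\<Sum>i<d. \<bar>u i - v i\<bar>)"
      by (rule member_le_sum) (use that in auto)
    then show ?thesis using assms by (simp add: adjacent_def abs_minus_commute)
  qed
  then show ?thesis using assms by (simp add: lbox_def adjacent_def)
qed

lemma adjacent_lbox_Suc: "adjacent d u v \<Longrightarrow> u \<in> lbox d x n \<Longrightarrow> v \<in> lbox d x (Suc n)"
  using lbox_trans[of u d x n v 1] adjacent_lbox by simp

lemma edge_iff_adjacent: "{u, v} \<in> edges d \<longleftrightarrow> adjacent d u v"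
  by (auto simp: edges_def doubleton_eq_iff dest: adjacent_sym)

lemma edgeE:
  assumes "e \<in> edges d" obtains u v where "e = {u, v}" "adjacent d u v"
  using assms by (auto simp: edges_def)

lemma touching_subset_image:
  "touching d S \<subseteq> (\<lambda>(u, v). {u, v}) ` (SIGMA u:S. lbox d u 1)"
proof
  fix e assume e: "e \<in> touching d S"
  then have "e \<in> edges d" by (simp add: touching_def)
  then obtain u v where uv: "e = {u, v}" "adjacent d u v" by (rule edgeE)
  have "u \<in> S \<or> v \<in> S" using e uv by (auto simp: touching_def)
  then show "e \<in> (\<lambda>(u, v). {u, v}) ` (SIGMA u:S. lbox d u 1)"
  proof
    assume "u \<in> S"
    then have "(u, v) \<in> (SIGMA u:S. lbox d u 1)" using uv adjacent_lbox by simp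
    then show ?thesis using uv by (intro image_eqI[of _ _ "(u, v)"]) simp_all
  next
    assume "v \<in> S"
    then have "(v, u) \<in> (SIGMA u:S. lbox d u 1)" using uv adjacent_lbox adjacent_sym by simp
    then show ?thesis using uv by (intro image_eqI[of _ _ "(v, u)"]) auto
  qed
qed

lemma finite_touching [simp, intro]: "finite S \<Longrightarrow> finite (touching d S)"
  by (rule finite_subset[OF touching_subset_image]) auto

lemma card_touching:
  assumes "finite S" shows "card (touching d S) \<le> card S * 3 ^ d"
proof -
  have "card (touching d S) \<le> card (SIGMA u:S. lbox d u 1)"
    by (rule surj_card_le[OF _ touching_subset_image]) (use assms in auto)
  also have "\<dots> = card S * 3 ^ d" using assms by (simp add: card_lbox)
  finally show ?thesis .
qed

lemma inner_edges_subset_touching: "inner_edges d S \<subseteq> touching d S"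
proof
  fix e assume "e \<in> inner_edges d S"
  then show "e \<in> touching d S" by (auto simp: inner_edges_def touching_def edges_def)
qed

lemma touching_mono: "S \<subseteq> T \<Longrightarrow> touching d S \<subseteq> touching d T"
  by (auto simp: touching_def)

lemma touching_subset_edges: "touching d S \<subseteq> edges d"
  by (auto simp: touching_def)

lemma finite_inner_edges [simp, intro]: "finite S \<Longrightarrow> finite (inner_edges d S)"
  by (rule finite_subset[OF inner_edges_subset_touching]) auto

lemma finite_exit_steps [simp, intro]: "finite S \<Longrightarrow> finite (exit_steps d S)"
  by (rule finite_subset[of _ "SIGMA u:S. lbox d u 1"]) (auto simp: exit_steps_def dest: adjacent_lbox)

lemma open_step_mono: "\<omega> \<subseteq> \<omega>' \<Longrightarrow> (open_step \<omega>)\<^sup>* \<subseteq> (open_step \<omega>')\<^sup>*"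
  by (rule rtrancl_mono) (auto simp: open_step_def)

lemma exits_mono:
  assumes "\<omega> \<subseteq> \<omega>'" "exits \<omega> \<Lambda> v" shows "exits \<omega>' \<Lambda> v"
  using open_step_mono[OF assms(1)] assms(2) unfolding exits_def by auto

lemma exits_outside: "v \<notin> \<Lambda> \<Longrightarrow> exits \<omega> \<Lambda> v"
  unfolding exits_def by (intro exI[of _ v]) simp

lemma exits_reach:
  assumes "(u, v) \<in> (open_step \<omega>)\<^sup>*" "exits \<omega> \<Lambda> v" shows "exits \<omega> \<Lambda> u"
proof -
  obtain z where "z \<notin> \<Lambda>" "(v, z) \<in> (open_step \<omega>)\<^sup>*" using assms(2) by (auto simp: exits_def)
  then show ?thesis using rtrancl_trans[OF assms(1)] unfolding exits_def by auto
qed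

lemma exits_step: "{u, v} \<in> \<omega> \<Longrightarrow> exits \<omega> \<Lambda> v \<Longrightarrow> exits \<omega> \<Lambda> u"
  by (rule exits_reach[OF r_into_rtrancl]) (simp add: open_step_def)

section \<open>Sharpness of the percolation transition\<close>

text \<open>The number \<open>p * psi d p S\<close> is the quantity \<open>\<phi>\<^sub>p(S)\<close> of Duminil-Copin and Tassion, the expected number
  of open edges that lead out of \<open>S\<close> from a vertex connected to the origin inside \<open>S\<close>.\<close>

definition psi :: "nat \<Rightarrow> real \<Rightarrow> vertex set \<Rightarrow> real" where
  "psi d p S = (\<Sum>(x, y)\<in>exit_steps d S.
     bern_prob p (inner_edges d S) (\<lambda>\<omega>. (origin, x) \<in> (open_step \<omega>)\<^sup>*))"

definition theta :: "nat \<Rightarrow> real \<Rightarrow> vertex set \<Rightarrow> real" where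
  "theta d p \<Lambda> = bern_prob p (touching d \<Lambda>) (\<lambda>\<omega>. exits \<omega> \<Lambda> origin)"

definition confined :: "vertex set \<Rightarrow> edge set \<Rightarrow> vertex set" where
  "confined \<Lambda> \<omega> = {x \<in> \<Lambda>. \<not> exits \<omega> \<Lambda> x}"

lemma psi_nonneg: "0 \<le> p \<Longrightarrow> p \<le> 1 \<Longrightarrow> 0 \<le> psi d p S"
  unfolding psi_def by (intro sum_nonneg) (auto intro: bern_prob_nonneg)

text \<open>The set of confined vertices can be found by exploring from outside \<open>\<Lambda>\<close>, and that exploration
  never looks at an edge between two confined vertices. So the event that the confined set equals \<open>S\<close> is
  independent of the connections inside \<open>S\<close>.\<close>

lemma confined_determined_outside:
  assumes \<omega>: "\<omega> \<subseteq> touching d \<Lambda>" and S: "S \<subseteq> \<Lambda>"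
  shows "confined \<Lambda> (\<omega> \<inter> (touching d \<Lambda> - inner_edges d S)) = S \<longleftrightarrow> confined \<Lambda> \<omega> = S"
proof -
  define \<omega>' where "\<omega>' = \<omega> \<inter> (touching d \<Lambda> - inner_edges d S)"
  have sub: "\<omega>' \<subseteq> \<omega>" by (auto simp: \<omega>'_def)
  have keep: "e \<in> \<omega>'" if "e \<in> \<omega>" "\<not> e \<subseteq> S" for e
    using that \<omega> by (auto simp: \<omega>'_def inner_edges_def)
  have "confined \<Lambda> \<omega>' = S" if c: "confined \<Lambda> \<omega> = S"
  proof
    show "S \<subseteq> confined \<Lambda> \<omega>'" using c exits_mono[OF sub] by (auto simp: confined_def)
    show "confined \<Lambda> \<omega>' \<subseteq> S"
    proof (rule ccontr)
      assume "\<not> ?thesis"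
      then obtain x where x: "x \<in> \<Lambda>" "\<not> exits \<omega>' \<Lambda> x" "x \<notin> S" by (auto simp: confined_def)
      then have "exits \<omega> \<Lambda> x" using c by (auto simp: confined_def)
      then obtain z where z: "z \<notin> \<Lambda>" "(x, z) \<in> (open_step \<omega>)\<^sup>*" by (auto simp: exits_def)
      from z(2) have "exits \<omega>' \<Lambda> x"
      proof (induction rule: converse_rtrancl_induct)
        case base
        show ?case using z by (simp add: exits_outside)
      next
        case (step v v')
        have "exits \<omega> \<Lambda> v" using step(1,2) z(1) unfolding exits_def by (meson converse_rtrancl_into_rtrancl)
        then have "v \<notin> S" using c by (auto simp: confined_def)
        then have "{v, v'} \<in> \<omega>'" using step(1) by (intro keep) (auto simp: open_step_def)
        then show ?case using step.IH exits_step by blast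
      qed
      then show False using x by simp
    qed
  qed
  moreover have "confined \<Lambda> \<omega> = S" if c: "confined \<Lambda> \<omega>' = S"
  proof
    show "confined \<Lambda> \<omega> \<subseteq> S" using c exits_mono[OF sub] by (auto simp: confined_def)
    show "S \<subseteq> confined \<Lambda> \<omega>"
    proof
      fix x assume x: "x \<in> S"
      have "z \<in> S" if "(x, z) \<in> (open_step \<omega>)\<^sup>*" for z using that
      proof (induction rule: rtrancl_induct)
        case (step u v)
        show ?case
        proof (rule ccontr)
          assume v: "v \<notin> S"
          then have "{u, v} \<in> \<omega>'" using step(2) by (intro keep) (auto simp: open_step_def)
          moreover have "exits \<omega>' \<Lambda> v" using v c exits_outside by (auto simp: confined_def)
          ultimately have "exits \<omega>' \<Lambda> u" using exits_step by blast
          then show False using step.IH c by (auto simp: confined_def)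
        qed
      qed (rule x)
      then show "x \<in> confined \<Lambda> \<omega>" using x S by (auto simp: confined_def exits_def)
    qed
  qed
  ultimately show ?thesis unfolding \<omega>'_def by blast
qed

text \<open>An edge from the part of the confined set that is connected to the origin to a vertex that is not
  confined is closed, and opening it connects the origin to the outside.\<close>

lemma confined_pivotal:
  assumes \<omega>: "\<omega> \<subseteq> touching d \<Lambda>" and fin: "finite \<Lambda>"
    and S: "S = confined \<Lambda> \<omega>"
  shows "(\<Sum>(x, y)\<in>exit_steps d S. of_bool ((origin, x) \<in> (open_step (\<omega> \<inter> inner_edges d S))\<^sup>*))
     \<le> real (card {e \<in> touching d \<Lambda> - \<omega>. exits (insert e \<omega>) \<Lambda> origin})"
proof -
  define B where "B = {(x, y) \<in> exit_steps d S. (origin, x) \<in> (open_step (\<omega> \<inter> inner_edges d S))\<^sup>*}"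
  have SL: "S \<subseteq> \<Lambda>" using S by (auto simp: confined_def)
  have "(\<Sum>(x, y)\<in>exit_steps d S. of_bool ((origin, x) \<in> (open_step (\<omega> \<inter> inner_edges d S))\<^sup>*))
     = (\<Sum>z\<in>exit_steps d S. of_bool (z \<in> {z. (origin, fst z) \<in> (open_step (\<omega> \<inter> inner_edges d S))\<^sup>*}) :: real)"
    by (intro sum.cong) auto
  also have "\<dots> = real (card B)"
    using finite_subset[OF SL fin]
    by (simp add: sum_of_bool_eq B_def) (rule arg_cong[of _ _ card], auto)
  also have "card B = card ((\<lambda>(x, y). {x, y}) ` B)"
  proof (rule card_image[symmetric], rule inj_onI)
    fix p q assume pq: "p \<in> B" "q \<in> B" "(\<lambda>(x, y). {x, y}) p = (\<lambda>(x, y). {x, y}) q"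
    obtain a b a' b' where "p = (a, b)" "q = (a', b')" by (cases p, cases q)
    then show "p = q" using pq by (auto simp: B_def exit_steps_def doubleton_eq_iff)
  qed
  also have "\<dots> \<le> card {e \<in> touching d \<Lambda> - \<omega>. exits (insert e \<omega>) \<Lambda> origin}"
  proof (rule card_mono)
    show "finite {e \<in> touching d \<Lambda> - \<omega>. exits (insert e \<omega>) \<Lambda> origin}" using fin by auto
    show "(\<lambda>(x, y). {x, y}) ` B \<subseteq> {e \<in> touching d \<Lambda> - \<omega>. exits (insert e \<omega>) \<Lambda> origin}"
    proof
      fix e assume "e \<in> (\<lambda>(x, y). {x, y}) ` B"
      then obtain x y where e: "e = {x, y}" and xy: "x \<in> S" "y \<notin> S" "adjacent d x y"
        and con: "(origin, x) \<in> (open_step (\<omega> \<inter> inner_edges d S))\<^sup>*"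
        by (auto simp: B_def exit_steps_def)
      have ey: "exits \<omega> \<Lambda> y" using xy(2) S exits_outside by (auto simp: confined_def)
      have "e \<notin> \<omega>" using ey exits_step xy(1) S e by (auto simp: confined_def)
      moreover have "e \<in> touching d \<Lambda>" using xy SL e by (auto simp: touching_def edge_iff_adjacent)
      moreover have "exits (insert e \<omega>) \<Lambda> origin"
      proof (rule exits_reach)
        show "(origin, x) \<in> (open_step (insert e \<omega>))\<^sup>*"
          using con open_step_mono[of "\<omega> \<inter> inner_edges d S" "insert e \<omega>"] by auto
        show "exits (insert e \<omega>) \<Lambda> x"
          by (rule exits_step[of x y]) (use e exits_mono[OF subset_insertI ey] in auto)
      qed
      ultimately show "e \<in> {e \<in> touching d \<Lambda> - \<omega>. exits (insert e \<omega>) \<Lambda> origin}" by blast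
    qed
  qed
  finally show ?thesis by simp
qed

text \<open>Condition on the confined set \<open>S\<close>. By independence the expected number of pivotal edges is then at
  least \<open>psi d p S\<close>, which is at least one by assumption.\<close>

lemma pivotal_lower_bound:
  assumes fin: "finite \<Lambda>" and p: "0 \<le> p" "p \<le> 1" and o: "origin \<in> \<Lambda>"
    and psi: "\<And>S. S \<subseteq> \<Lambda> \<Longrightarrow> origin \<in> S \<Longrightarrow> 1 \<le> p * psi d p S"
  shows "1 - theta d p \<Lambda> \<le> (\<Sum>\<omega>\<in>Pow (touching d \<Lambda>). bern_weight p (touching d \<Lambda>) \<omega>
     * of_bool (\<not> exits \<omega> \<Lambda> origin) * card {e \<in> touching d \<Lambda> - \<omega>. exits (insert e \<omega>) \<Lambda> origin})"
proof -
  let ?E = "touching d \<Lambda>"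
  define I where "I = {S. S \<subseteq> \<Lambda> \<and> origin \<in> S}"
  define con where "con S x \<omega> \<longleftrightarrow> (origin, x) \<in> (open_step (\<omega> \<inter> inner_edges d S))\<^sup>*" for S x \<omega>
  have finE: "finite ?E" using fin by simp
  have finI: "finite I" using fin by (simp add: I_def)
  have conf_I: "confined \<Lambda> \<omega> \<in> I \<longleftrightarrow> \<not> exits \<omega> \<Lambda> origin" for \<omega>
    using o by (auto simp: I_def confined_def)
  have "1 - theta d p \<Lambda> = bern_prob p ?E (\<lambda>\<omega>. \<not> exits \<omega> \<Lambda> origin)"
    unfolding theta_def using finE by (simp add: bern_prob_compl)
  also have "\<dots> = (\<Sum>S\<in>I. bern_prob p ?E (\<lambda>\<omega>. confined \<Lambda> \<omega> = S \<and> \<not> exits \<omega> \<Lambda> origin))"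
    by (rule bern_prob_partition[OF finI finE]) (simp add: conf_I)
  also have "\<dots> = (\<Sum>S\<in>I. bern_prob p ?E (\<lambda>\<omega>. confined \<Lambda> \<omega> = S))"
    by (intro sum.cong refl bern_prob_cong) (use conf_I in blast)
  also have "\<dots> \<le> (\<Sum>S\<in>I. bern_prob p ?E (\<lambda>\<omega>. confined \<Lambda> \<omega> = S) * psi d p S)"
  proof (rule sum_mono)
    fix S assume "S \<in> I"
    then have "1 \<le> p * psi d p S" using psi by (simp add: I_def)
    also have "\<dots> \<le> psi d p S" using p psi_nonneg[OF p, of d S] by (simp add: mult_left_le_one_le)
    finally show "bern_prob p ?E (\<lambda>\<omega>. confined \<Lambda> \<omega> = S)
       \<le> bern_prob p ?E (\<lambda>\<omega>. confined \<Lambda> \<omega> = S) * psi d p S"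
      using mult_left_mono[OF _ bern_prob_nonneg[OF p], of 1] by fastforce
  qed
  also have "\<dots> = (\<Sum>S\<in>I. \<Sum>(x, y)\<in>exit_steps d S. bern_prob p ?E (\<lambda>\<omega>. confined \<Lambda> \<omega> = S \<and> con S x \<omega>))"
  proof (intro sum.cong refl)
    fix S assume "S \<in> I"
    then have S: "S \<subseteq> \<Lambda>" by (simp add: I_def)
    have sub: "inner_edges d S \<subseteq> ?E" using inner_edges_subset_touching touching_mono[OF S] by blast
    have ind: "bern_prob p ?E (\<lambda>\<omega>. confined \<Lambda> \<omega> = S \<and> con S x \<omega>)
       = bern_prob p ?E (\<lambda>\<omega>. confined \<Lambda> \<omega> = S) * bern_prob p (inner_edges d S) (\<lambda>\<omega>. (origin, x) \<in> (open_step \<omega>)\<^sup>*)" for x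
    proof -
      have "bern_prob p ?E (\<lambda>\<omega>. confined \<Lambda> \<omega> = S \<and> con S x \<omega>)
         = bern_prob p ?E (\<lambda>\<omega>. (\<lambda>\<omega>. confined \<Lambda> \<omega> = S) (\<omega> \<inter> (?E - inner_edges d S)) \<and>
             (\<lambda>\<omega>. (origin, x) \<in> (open_step \<omega>)\<^sup>*) (\<omega> \<inter> inner_edges d S))"
        by (rule bern_prob_cong) (simp add: confined_determined_outside[OF _ S] con_def)
      also have "\<dots> = bern_prob p ?E (\<lambda>\<omega>. confined \<Lambda> (\<omega> \<inter> (?E - inner_edges d S)) = S)
          * bern_prob p ?E (\<lambda>\<omega>. (origin, x) \<in> (open_step (\<omega> \<inter> inner_edges d S))\<^sup>*)"
        by (rule bern_prob_indep_sub) (use finE sub in auto)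
      also have "bern_prob p ?E (\<lambda>\<omega>. confined \<Lambda> (\<omega> \<inter> (?E - inner_edges d S)) = S) = bern_prob p ?E (\<lambda>\<omega>. confined \<Lambda> \<omega> = S)"
        by (rule bern_prob_cong) (simp add: confined_determined_outside[OF _ S])
      also have "bern_prob p ?E (\<lambda>\<omega>. (origin, x) \<in> (open_step (\<omega> \<inter> inner_edges d S))\<^sup>*)
         = bern_prob p (inner_edges d S) (\<lambda>\<omega>. (origin, x) \<in> (open_step \<omega>)\<^sup>*)"
        by (rule bern_prob_restrict[OF finE sub])
      finally show ?thesis .
    qed
    show "bern_prob p ?E (\<lambda>\<omega>. confined \<Lambda> \<omega> = S) * psi d p S
       = (\<Sum>(x, y)\<in>exit_steps d S. bern_prob p ?E (\<lambda>\<omega>. confined \<Lambda> \<omega> = S \<and> con S x \<omega>))"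
      unfolding ind psi_def by (simp add: sum_distrib_left case_prod_unfold)
  qed
  also have "\<dots> = (\<Sum>\<omega>\<in>Pow ?E. bern_weight p ?E \<omega> *
      (\<Sum>S\<in>I. \<Sum>(x, y)\<in>exit_steps d S. of_bool (confined \<Lambda> \<omega> = S \<and> con S x \<omega>)))"
  proof -
    have "(\<Sum>S\<in>I. \<Sum>(x, y)\<in>exit_steps d S. bern_prob p ?E (\<lambda>\<omega>. confined \<Lambda> \<omega> = S \<and> con S x \<omega>))
       = (\<Sum>S\<in>I. \<Sum>\<omega>\<in>Pow ?E. \<Sum>(x, y)\<in>exit_steps d S. bern_weight p ?E \<omega> * of_bool (confined \<Lambda> \<omega> = S \<and> con S x \<omega>))"
      unfolding bern_prob_def case_prod_unfold by (intro sum.cong refl sum.swap)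
    also have "\<dots> = (\<Sum>\<omega>\<in>Pow ?E. \<Sum>S\<in>I. \<Sum>(x, y)\<in>exit_steps d S. bern_weight p ?E \<omega> * of_bool (confined \<Lambda> \<omega> = S \<and> con S x \<omega>))"
      by (rule sum.swap)
    finally show ?thesis by (simp only: sum_distrib_left case_prod_unfold)
  qed
  also have "\<dots> \<le> (\<Sum>\<omega>\<in>Pow ?E. bern_weight p ?E \<omega>
     * (of_bool (\<not> exits \<omega> \<Lambda> origin) * card {e \<in> ?E - \<omega>. exits (insert e \<omega>) \<Lambda> origin}))"
  proof (rule sum_mono, rule mult_left_mono[OF _ bern_weight_nonneg[OF p]])
    fix \<omega> assume "\<omega> \<in> Pow ?E"
    then have w: "\<omega> \<subseteq> ?E" by simp
    have "(\<Sum>S\<in>I. \<Sum>(x, y)\<in>exit_steps d S. of_bool (confined \<Lambda> \<omega> = S \<and> con S x \<omega>) :: real)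
      = (\<Sum>S\<in>I. if confined \<Lambda> \<omega> = S then \<Sum>(x, y)\<in>exit_steps d S. of_bool (con S x \<omega>) else 0)"
      by (intro sum.cong refl) auto
    also have "\<dots> = (if confined \<Lambda> \<omega> \<in> I then \<Sum>(x, y)\<in>exit_steps d (confined \<Lambda> \<omega>). of_bool (con (confined \<Lambda> \<omega>) x \<omega>) else 0)"
      using finI by simp
    also have "\<dots> \<le> of_bool (\<not> exits \<omega> \<Lambda> origin) * card {e \<in> ?E - \<omega>. exits (insert e \<omega>) \<Lambda> origin}"
      using confined_pivotal[OF w fin refl] unfolding conf_I con_def by simp
    finally show "(\<Sum>S\<in>I. \<Sum>(x, y)\<in>exit_steps d S. of_bool (confined \<Lambda> \<omega> = S \<and> con S x \<omega>) :: real)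
       \<le> of_bool (\<not> exits \<omega> \<Lambda> origin) * card {e \<in> ?E - \<omega>. exits (insert e \<omega>) \<Lambda> origin}" .
  qed
  finally show ?thesis by (simp add: mult.assoc)
qed

text \<open>By Russo's formula the derivative of \<open>\<theta>\<close> is at least \<open>1 - \<theta>\<close>. This is integrated in the form that
  \<open>(\<theta> - 1) * exp p\<close> increases.\<close>

lemma theta_lower_bound:
  assumes fin: "finite \<Lambda>" and o: "origin \<in> \<Lambda>" and p: "0 \<le> p1" "p1 \<le> p2" "p2 \<le> 1"
    and psi: "\<And>p S. p1 < p \<Longrightarrow> p < p2 \<Longrightarrow> S \<subseteq> \<Lambda> \<Longrightarrow> origin \<in> S \<Longrightarrow> 1 \<le> p * psi d p S"
  shows "1 - exp (p1 - p2) \<le> theta d p2 \<Lambda>"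
proof -
  define g where "g p = (theta d p \<Lambda> - 1) * exp p" for p
  have "g p1 \<le> g p2"
  proof (rule DERIV_nonneg_imp_increasing_open[OF p(2)])
    show "continuous_on {p1..p2} g"
      unfolding g_def theta_def
      by (intro continuous_intros continuous_on_subset[OF bern_prob_continuous]) auto
    fix x assume x: "p1 < x" "x < p2"
    then have x': "0 < x" "x < 1" using p by auto
    define D where "D = (\<Sum>\<omega>\<in>Pow (touching d \<Lambda>). bern_weight x (touching d \<Lambda>) \<omega>
      * of_bool (\<not> exits \<omega> \<Lambda> origin) * card {e \<in> touching d \<Lambda> - \<omega>. exits (insert e \<omega>) \<Lambda> origin})"
    have "((\<lambda>p. theta d p \<Lambda>) has_real_derivative D / (1 - x)) (at x)"
      unfolding theta_def D_def
      by (rule russo_formula) (use x' fin exits_mono[OF subset_insertI] in auto)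
    then have "(g has_real_derivative (D / (1 - x) * exp x + exp x * (theta d x \<Lambda> - 1))) (at x)"
      unfolding g_def by (auto intro!: derivative_eq_intros)
    moreover have "1 - theta d x \<Lambda> \<le> D"
      unfolding D_def by (rule pivotal_lower_bound) (use fin o x' psi x in auto)
    moreover have "D \<le> D / (1 - x)"
    proof -
      have "0 \<le> D" unfolding D_def
        by (intro sum_nonneg mult_nonneg_nonneg bern_weight_nonneg) (use x' in auto)
      then show ?thesis using x' by (simp add: pos_le_divide_eq algebra_simps)
    qed
    ultimately have "(g has_real_derivative (D / (1 - x) * exp x + exp x * (theta d x \<Lambda> - 1))) (at x)"
      "0 \<le> (D / (1 - x) + (theta d x \<Lambda> - 1)) * exp x"
      by simp_all
    then show "\<exists>y. (g has_real_derivative y) (at x) \<and> 0 \<le> y"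
      by (intro exI[of _ "D / (1 - x) * exp x + exp x * (theta d x \<Lambda> - 1)"])
        (simp only: distrib_right mult.commute[of "exp x"] simp_thms)
  qed
  moreover have "theta d p1 \<Lambda> \<ge> 0" unfolding theta_def
    by (rule bern_prob_nonneg) (use p in auto)
  then have "- exp p1 \<le> g p1" unfolding g_def by (simp add: left_diff_distrib)
  ultimately have "- exp p1 \<le> (theta d p2 \<Lambda> - 1) * exp p2" by (simp add: g_def)
  then have "(- exp p1) / exp p2 \<le> theta d p2 \<Lambda> - 1" by (subst pos_divide_le_eq) auto
  then show ?thesis by (simp add: exp_diff)
qed

section \<open>Exponential decay of subcritical clusters\<close>

definition cluster_in :: "nat \<Rightarrow> vertex set \<Rightarrow> edge set \<Rightarrow> vertex set" where
  "cluster_in d S \<omega> = {x. (origin, x) \<in> (open_step (\<omega> \<inter> inner_edges d S))\<^sup>*}"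

definition translate :: "vertex \<Rightarrow> vertex \<Rightarrow> vertex" where
  "translate y v = (\<lambda>i. v i + y i)"

lemma translate_inverse [simp]: "translate (\<lambda>i. - y i) (translate y v) = v" "translate y (translate (\<lambda>i. - y i) v) = v"
  by (auto simp: translate_def)

lemma translate_lattice: "y \<in> lattice d \<Longrightarrow> v \<in> lattice d \<Longrightarrow> translate y v \<in> lattice d"
  by (auto simp: translate_def lattice_def)

lemma neg_lattice: "y \<in> lattice d \<Longrightarrow> (\<lambda>i. - y i) \<in> lattice d"
  by (auto simp: lattice_def)

lemma translate_adjacent: "y \<in> lattice d \<Longrightarrow> adjacent d u v \<Longrightarrow> adjacent d (translate y u) (translate y v)"
  by (auto simp: adjacent_def translate_lattice) (simp add: translate_def)

lemma translate_lbox: "y \<in> lattice d \<Longrightarrow> v \<in> lbox d x n \<Longrightarrow> translate y v \<in> lbox d (translate y x) n"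
  by (auto simp: lbox_def translate_lattice) (simp add: translate_def)

lemma translate_touching_lbox:
  assumes y: "y \<in> lattice d" and e: "e \<in> touching d (lbox d x n)"
  shows "translate y ` e \<in> touching d (lbox d (translate y x) n)"
proof -
  have "e \<in> edges d" using e by (simp add: touching_def)
  then obtain u v where uv: "e = {u, v}" "adjacent d u v" by (rule edgeE)
  have "translate y ` e \<in> edges d" using uv translate_adjacent[OF y uv(2)] by (auto simp: edge_iff_adjacent)
  moreover obtain w where "w \<in> e" "w \<in> lbox d x n" using e by (auto simp: touching_def)
  then have "translate y w \<in> translate y ` e \<inter> lbox d (translate y x) n" using translate_lbox[OF y] by simp
  ultimately show ?thesis unfolding touching_def by blast
qed

lemma translate_touching_lbox_eq:
  assumes y: "y \<in> lattice d"
  shows "touching d (lbox d y n) = (`) (translate y) ` touching d (lbox d origin n)"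
proof
  have o: "translate y origin = y" "translate (\<lambda>i. - y i) y = origin" by (auto simp: translate_def origin_def)
  show "(`) (translate y) ` touching d (lbox d origin n) \<subseteq> touching d (lbox d y n)"
    using translate_touching_lbox[OF y, of _ origin n] o by auto
  show "touching d (lbox d y n) \<subseteq> (`) (translate y) ` touching d (lbox d origin n)"
  proof
    fix e assume "e \<in> touching d (lbox d y n)"
    then have "translate (\<lambda>i. - y i) ` e \<in> touching d (lbox d origin n)"
      using translate_touching_lbox[OF neg_lattice[OF y], of e y n] o by simp
    moreover have "e = translate y ` (translate (\<lambda>i. - y i) ` e)" by (simp add: image_image)
    ultimately show "e \<in> (`) (translate y) ` touching d (lbox d origin n)" by (rule rev_image_eqI)
  qed
qed

lemma translate_exits:
  assumes "y \<in> lattice d" "exits \<omega> (lbox d x n) v"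
  shows "exits ((`) (translate y) ` \<omega>) (lbox d (translate y x) n) (translate y v)"
proof -
  obtain z where z: "z \<notin> lbox d x n" "(v, z) \<in> (open_step \<omega>)\<^sup>*" using assms(2) by (auto simp: exits_def)
  from z(2) have "(translate y v, translate y z) \<in> (open_step ((`) (translate y) ` \<omega>))\<^sup>*"
  proof (induction rule: rtrancl_induct)
    case (step u w)
    have "translate y ` {u, w} \<in> (`) (translate y) ` \<omega>"
      by (rule imageI) (use step(2) in \<open>simp add: open_step_def\<close>)
    then have "(translate y u, translate y w) \<in> open_step ((`) (translate y) ` \<omega>)" by (simp add: open_step_def)
    then show ?case using step.IH by (rule rtrancl_into_rtrancl[rotated])
  qed simp
  moreover have "translate y z \<notin> lbox d (translate y x) n"
  proof
    assume "translate y z \<in> lbox d (translate y x) n"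
    from translate_lbox[OF neg_lattice[OF assms(1)] this] show False using z(1) by simp
  qed
  ultimately show ?thesis unfolding exits_def by auto
qed

text \<open>Percolation is invariant under translations; on finite sums this is a bijection of edges.\<close>

lemma theta_translate:
  assumes y: "y \<in> lattice d"
  shows "bern_prob p (touching d (lbox d y n)) (\<lambda>\<omega>. exits \<omega> (lbox d y n) y) = theta d p (lbox d origin n)"
proof -
  have o: "translate y origin = y" "translate (\<lambda>i. - y i) y = origin" by (auto simp: translate_def origin_def)
  have "inj (translate y)" by (rule inj_on_inverseI[of _ "translate (\<lambda>i. - y i)"]) simp
  then have inj: "inj_on ((`) (translate y)) (touching d (lbox d origin n))"
    by (metis inj_image_eq_iff inj_onI)
  have "bern_prob p (touching d (lbox d y n)) (\<lambda>\<omega>. exits \<omega> (lbox d y n) y)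
     = bern_prob p (touching d (lbox d origin n)) (\<lambda>\<omega>. exits ((`) (translate y) ` \<omega>) (lbox d y n) y)"
    unfolding translate_touching_lbox_eq[OF y] by (rule bern_prob_image[OF _ inj]) auto
  also have "\<dots> = theta d p (lbox d origin n)" unfolding theta_def
  proof (rule bern_prob_cong)
    fix \<omega>
    have "(`) (translate (\<lambda>i. - y i)) ` (`) (translate y) ` \<omega> = \<omega>" by (simp add: image_image)
    then show "exits ((`) (translate y) ` \<omega>) (lbox d y n) y = exits \<omega> (lbox d origin n) origin"
      using translate_exits[OF y, of \<omega> origin n origin]
        translate_exits[OF neg_lattice[OF y], of "(`) (translate y) ` \<omega>" y n y] o by auto
  qed
  finally show ?thesis .
qed

text \<open>A path to the outside can be stopped at its first vertex outside, before it uses edges far away.\<close>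

lemma exits_restrict_touching:
  assumes "\<omega> \<subseteq> edges d"
  shows "exits (\<omega> \<inter> touching d \<Lambda>) \<Lambda> v \<longleftrightarrow> exits \<omega> \<Lambda> v"
proof
  assume "exits \<omega> \<Lambda> v"
  then obtain z where z: "z \<notin> \<Lambda>" "(v, z) \<in> (open_step \<omega>)\<^sup>*" by (auto simp: exits_def)
  from z(2) show "exits (\<omega> \<inter> touching d \<Lambda>) \<Lambda> v"
  proof (induction rule: converse_rtrancl_induct)
    case base
    show ?case using z(1) by (rule exits_outside)
  next
    case (step u w)
    show ?case
    proof (cases "u \<in> \<Lambda>")
      case True
      have "{u, w} \<in> \<omega>" using step(1) by (simp add: open_step_def)
      then have "{u, w} \<in> \<omega> \<inter> touching d \<Lambda>" using assms True by (auto simp: touching_def)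
      then show ?thesis using step.IH by (rule exits_step)
    qed (rule exits_outside)
  qed
qed (rule exits_mono[OF Int_lower1])

lemma cluster_in_subset:
  assumes "origin \<in> S" shows "cluster_in d S \<omega> \<subseteq> S"
proof
  fix x assume "x \<in> cluster_in d S \<omega>"
  then have "(origin, x) \<in> (open_step (\<omega> \<inter> inner_edges d S))\<^sup>*" by (simp add: cluster_in_def)
  then show "x \<in> S"
    by (induction rule: rtrancl_induct) (use assms in \<open>auto simp: open_step_def inner_edges_def\<close>)
qed

lemma cluster_in_mono: "\<omega> \<subseteq> \<omega>' \<Longrightarrow> cluster_in d S \<omega> \<subseteq> cluster_in d S \<omega>'"
  unfolding cluster_in_def
  using open_step_mono[of "\<omega> \<inter> inner_edges d S" "\<omega>' \<inter> inner_edges d S"] by auto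

lemma cluster_in_step: "u \<in> cluster_in d S \<omega> \<Longrightarrow> {u, v} \<in> \<omega> \<Longrightarrow> {u, v} \<in> inner_edges d S \<Longrightarrow> v \<in> cluster_in d S \<omega>"
  by (auto simp: cluster_in_def open_step_def intro: rtrancl_into_rtrancl)

text \<open>Whether the cluster equals \<open>C\<close> can be read off from the edges that touch \<open>C\<close>: an exploration of
  the cluster never looks at any other edge.\<close>

lemma cluster_in_determined:
  assumes \<omega>: "\<omega> \<subseteq> E"
    and E1: "E1 = {e \<in> E. e \<inter> C \<noteq> {} \<and> e \<in> inner_edges d S}"
  shows "cluster_in d S (\<omega> \<inter> E1) = C \<longleftrightarrow> cluster_in d S \<omega> = C"
proof
  assume c: "cluster_in d S \<omega> = C"
  have "x \<in> cluster_in d S (\<omega> \<inter> E1)" if "(origin, x) \<in> (open_step (\<omega> \<inter> inner_edges d S))\<^sup>*" for x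
    using that
  proof (induction rule: rtrancl_induct)
    case base
    show ?case by (simp add: cluster_in_def)
  next
    case (step u v)
    have "u \<in> C" using step(1) c by (auto simp: cluster_in_def)
    then have "{u, v} \<in> \<omega> \<inter> E1" "{u, v} \<in> inner_edges d S" using step(2) \<omega> by (auto simp: open_step_def E1)
    then show ?case by (rule cluster_in_step[OF step.IH])
  qed
  then have "C \<subseteq> cluster_in d S (\<omega> \<inter> E1)" using c by (auto simp: cluster_in_def)
  then show "cluster_in d S (\<omega> \<inter> E1) = C" using c cluster_in_mono[of "\<omega> \<inter> E1" \<omega> d S] by blast
next
  assume c: "cluster_in d S (\<omega> \<inter> E1) = C"
  have "x \<in> C" if "(origin, x) \<in> (open_step (\<omega> \<inter> inner_edges d S))\<^sup>*" for x
    using that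
  proof (induction rule: rtrancl_induct)
    case base
    show ?case using c by (auto simp: cluster_in_def)
  next
    case (step u v)
    then have "{u, v} \<in> \<omega> \<inter> E1" "{u, v} \<in> inner_edges d S" using \<omega> by (auto simp: open_step_def E1)
    then show ?case using step.IH cluster_in_step[of u d S "\<omega> \<inter> E1" v] c by simp
  qed
  then have "cluster_in d S \<omega> \<subseteq> C" by (auto simp: cluster_in_def)
  then show "cluster_in d S \<omega> = C" using c cluster_in_mono[of "\<omega> \<inter> E1" \<omega> d S] by blast
qed

text \<open>Cut a path at its last visit to the cluster: the next edge leaves \<open>S\<close>, for otherwise its endpoint
  would belong to the cluster, and from there on the path avoids all edges that touch the cluster.\<close>

lemma last_exit_from_cluster:
  assumes \<omega>: "\<omega> \<subseteq> edges d" and o: "origin \<in> S"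
    and r: "(origin, z) \<in> (open_step \<omega>)\<^sup>*" and z: "z \<notin> cluster_in d S \<omega>"
  shows "\<exists>x y. x \<in> cluster_in d S \<omega> \<and> (x, y) \<in> exit_steps d S \<and> {x, y} \<in> \<omega> \<and>
    (y, z) \<in> (open_step {e \<in> \<omega>. e \<inter> cluster_in d S \<omega> = {}})\<^sup>*"
  using r z
proof (induction rule: rtrancl_induct)
  case base
  then show ?case by (simp add: cluster_in_def)
next
  case (step w z)
  let ?C = "cluster_in d S \<omega>"
  have wz: "{w, z} \<in> \<omega>" using step(2) by (simp add: open_step_def)
  show ?case
  proof (cases "w \<in> ?C")
    case True
    have adj: "adjacent d w z" using wz \<omega> edge_iff_adjacent by blast
    have "z \<notin> S"
    proof
      assume "z \<in> S"
      then have "{w, z} \<in> inner_edges d S"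
        using True cluster_in_subset[OF o] wz \<omega> by (auto simp: inner_edges_def)
      then show False using cluster_in_step[OF True wz] step.prems by simp
    qed
    then have "(w, z) \<in> exit_steps d S" using adj True cluster_in_subset[OF o, of d \<omega>]
      by (auto simp: exit_steps_def)
    then show ?thesis using True wz by (intro exI[of _ w] exI[of _ z]) simp
  next
    case False
    then obtain x y where xy: "x \<in> ?C" "(x, y) \<in> exit_steps d S" "{x, y} \<in> \<omega>"
        "(y, w) \<in> (open_step {e \<in> \<omega>. e \<inter> ?C = {}})\<^sup>*" using step.IH by blast
    have "(w, z) \<in> open_step {e \<in> \<omega>. e \<inter> ?C = {}}" using wz False step.prems by (simp add: open_step_def)
    with xy(4) have "(y, z) \<in> (open_step {e \<in> \<omega>. e \<inter> ?C = {}})\<^sup>*" by (rule rtrancl_into_rtrancl)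
    then show ?thesis using xy by blast
  qed
qed

text \<open>One step of the exploration. A path that leaves a large box leaves the cluster of the origin
  inside \<open>S\<close> for a last time; given the cluster, the edge used and the rest of the path live on
  disjoint sets of unexplored edges.\<close>

lemma theta_decay_step:
  assumes p: "0 \<le> p" "p \<le> 1" and S: "S \<subseteq> lbox d origin L" and o: "origin \<in> S"
  shows "theta d p (lbox d origin (n + Suc L)) \<le> p * psi d p S * theta d p (lbox d origin n)"
proof -
  let ?\<Lambda> = "lbox d origin (n + Suc L)"
  let ?E = "touching d ?\<Lambda>"
  define con where "con C x y \<omega> \<longleftrightarrow> cluster_in d S \<omega> = C \<and> {x, y} \<in> \<omega> \<and>
     exits {e \<in> \<omega>. e \<inter> C = {}} (lbox d y n) y" for C x y \<omega>
  define I where "I = (SIGMA (x, y):exit_steps d S. {C \<in> Pow S. x \<in> C})"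
  have finE: "finite ?E" by simp
  have finS: "finite S" using S finite_lbox finite_subset by blast
  have EE: "?E \<subseteq> edges d" by (rule touching_subset_edges)
  have finI: "finite I" unfolding I_def using finS by auto
  have SL: "S \<subseteq> ?\<Lambda>" using S lbox_mono[of L "n + Suc L" d origin] by auto
  have inE: "inner_edges d S \<subseteq> ?E" using inner_edges_subset_touching touching_mono[OF SL] by blast
  have ybox: "lbox d y n \<subseteq> ?\<Lambda>" if "(x, y) \<in> exit_steps d S" for x y
  proof
    fix z assume z: "z \<in> lbox d y n"
    have "x \<in> lbox d origin L" "adjacent d x y" using that S by (auto simp: exit_steps_def)
    then have "y \<in> lbox d origin (Suc L)" using adjacent_lbox_Suc by blast
    from lbox_trans[OF this z] show "z \<in> ?\<Lambda>" by (simp add: add.commute)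
  qed
  have "theta d p ?\<Lambda> \<le> (\<Sum>((x, y), C)\<in>I. bern_prob p ?E (con C x y))"
    unfolding theta_def case_prod_unfold
  proof (rule bern_prob_union_bound[OF p finI])
    fix \<omega> assume w: "\<omega> \<subseteq> ?E" and ex: "exits \<omega> ?\<Lambda> origin"
    let ?C = "cluster_in d S \<omega>"
    obtain z where z: "z \<notin> ?\<Lambda>" "(origin, z) \<in> (open_step \<omega>)\<^sup>*" using ex by (auto simp: exits_def)
    have "z \<notin> ?C" using z(1) cluster_in_subset[OF o, of d \<omega>] SL by auto
    then obtain x y where xy: "x \<in> ?C" "(x, y) \<in> exit_steps d S" "{x, y} \<in> \<omega>"
      "(y, z) \<in> (open_step {e \<in> \<omega>. e \<inter> ?C = {}})\<^sup>*"
      using last_exit_from_cluster[OF subset_trans[OF w EE] o z(2)] by auto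
    have "z \<notin> lbox d y n" using ybox[OF xy(2)] z(1) by auto
    then have "con ?C x y \<omega>" using xy unfolding con_def exits_def by auto
    moreover have "((x, y), ?C) \<in> I" using xy cluster_in_subset[OF o, of d \<omega>] by (auto simp: I_def)
    ultimately show "\<exists>i\<in>I. con (snd i) (fst (fst i)) (snd (fst i)) \<omega>"
      by (intro bexI[of _ "((x, y), ?C)"]) simp_all
  qed
  also have "\<dots> \<le> (\<Sum>((x, y), C)\<in>I. bern_prob p ?E (\<lambda>\<omega>. cluster_in d S \<omega> = C) * (p * theta d p (lbox d origin n)))"
    unfolding case_prod_unfold
  proof (rule sum_mono)
    fix i assume "i \<in> I"
    then obtain x y C where i: "i = ((x, y), C)" and xy: "(x, y) \<in> exit_steps d S" and C: "C \<subseteq> S" "x \<in> C"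
      by (auto simp: I_def)
    \<comment> \<open>three disjoint sets of edges: \<open>E1\<close> determines the cluster, \<open>{x, y}\<close> leaves it, and the rest of the path uses \<open>E3\<close>\<close>
    define E1 where "E1 = {e \<in> ?E. e \<inter> C \<noteq> {} \<and> e \<in> inner_edges d S}"
    define E3 where "E3 = {e \<in> ?E. e \<inter> C = {}}"
    have adj: "adjacent d x y" "x \<in> S" "y \<notin> S" using xy by (auto simp: exit_steps_def)
    have eE: "{x, y} \<in> ?E" using adj SL by (auto simp: touching_def edge_iff_adjacent)
    have sub: "E1 \<subseteq> ?E" "E3 \<subseteq> ?E" "{{x, y}} \<union> E3 \<subseteq> ?E" "{{x, y}} \<subseteq> ?E" using eE by (auto simp: E1_def E3_def)
    have disj: "E1 \<inter> ({{x, y}} \<union> E3) = {}" "{{x, y}} \<inter> E3 = {}"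
      using adj C by (auto simp: E1_def E3_def inner_edges_def)
    have a3: "{e \<in> \<omega>. e \<inter> C = {}} = \<omega> \<inter> E3" if "\<omega> \<subseteq> ?E" for \<omega> using that by (auto simp: E3_def)
    have i3: "insert {x, y} E3 \<inter> E3 = E3" by blast
    have cl: "cluster_in d S (\<omega> \<inter> E1) = C \<longleftrightarrow> cluster_in d S \<omega> = C" if "\<omega> \<subseteq> ?E" for \<omega>
      by (rule cluster_in_determined[OF that E1_def])
    have "bern_prob p ?E (con C x y) = bern_prob p ?E (\<lambda>\<omega>. (\<lambda>\<omega>. cluster_in d S \<omega> = C) (\<omega> \<inter> E1) \<and>
        (\<lambda>\<omega>. {x, y} \<in> \<omega> \<and> exits (\<omega> \<inter> E3) (lbox d y n) y) (\<omega> \<inter> ({{x, y}} \<union> E3)))"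
      by (rule bern_prob_cong) (simp add: con_def cl a3 Int_assoc i3)
    also have "\<dots> = bern_prob p ?E (\<lambda>\<omega>. cluster_in d S (\<omega> \<inter> E1) = C) *
        bern_prob p ?E (\<lambda>\<omega>. (\<lambda>\<omega>. {x, y} \<in> \<omega> \<and> exits (\<omega> \<inter> E3) (lbox d y n) y) (\<omega> \<inter> ({{x, y}} \<union> E3)))"
      by (rule bern_prob_indep_sub[OF finE sub(1,3) disj(1)])
    also have "bern_prob p ?E (\<lambda>\<omega>. cluster_in d S (\<omega> \<inter> E1) = C) = bern_prob p ?E (\<lambda>\<omega>. cluster_in d S \<omega> = C)"
      by (rule bern_prob_cong) (simp add: cl)
    also have "bern_prob p ?E (\<lambda>\<omega>. (\<lambda>\<omega>. {x, y} \<in> \<omega> \<and> exits (\<omega> \<inter> E3) (lbox d y n) y) (\<omega> \<inter> ({{x, y}} \<union> E3)))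
       = bern_prob p ?E (\<lambda>\<omega>. (\<lambda>\<omega>. {x, y} \<in> \<omega>) (\<omega> \<inter> {{x, y}}) \<and> (\<lambda>\<omega>. exits \<omega> (lbox d y n) y) (\<omega> \<inter> E3))"
      by (rule bern_prob_cong) (simp add: Int_assoc i3)
    also have "\<dots> = bern_prob p ?E (\<lambda>\<omega>. (\<lambda>\<omega>. {x, y} \<in> \<omega>) (\<omega> \<inter> {{x, y}})) * bern_prob p ?E (\<lambda>\<omega>. exits (\<omega> \<inter> E3) (lbox d y n) y)"
      by (rule bern_prob_indep_sub[OF finE sub(4,2) disj(2)])
    also have "bern_prob p ?E (\<lambda>\<omega>. (\<lambda>\<omega>. {x, y} \<in> \<omega>) (\<omega> \<inter> {{x, y}})) = p"
      using bern_prob_single[OF finE eE] by simp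
    finally have eq: "bern_prob p ?E (con C x y) = bern_prob p ?E (\<lambda>\<omega>. cluster_in d S \<omega> = C) *
       (p * bern_prob p ?E (\<lambda>\<omega>. exits (\<omega> \<inter> E3) (lbox d y n) y))" .
    have "bern_prob p ?E (\<lambda>\<omega>. exits (\<omega> \<inter> E3) (lbox d y n) y) \<le> bern_prob p ?E (\<lambda>\<omega>. exits \<omega> (lbox d y n) y)"
      by (rule bern_prob_mono[OF p]) (rule exits_mono[OF Int_lower1])
    also have "\<dots> = bern_prob p ?E (\<lambda>\<omega>. exits (\<omega> \<inter> touching d (lbox d y n)) (lbox d y n) y)"
      by (rule bern_prob_cong) (use EE in \<open>simp add: exits_restrict_touching\<close>)
    also have "\<dots> = bern_prob p (touching d (lbox d y n)) (\<lambda>\<omega>. exits \<omega> (lbox d y n) y)"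
      by (rule bern_prob_restrict[OF finE touching_mono[OF ybox[OF xy]]])
    also have "\<dots> = theta d p (lbox d origin n)"
      by (rule theta_translate) (use adj in \<open>simp add: adjacent_def\<close>)
    finally have "bern_prob p ?E (con C x y) \<le> bern_prob p ?E (\<lambda>\<omega>. cluster_in d S \<omega> = C) * (p * theta d p (lbox d origin n))"
      unfolding eq by (intro mult_left_mono bern_prob_nonneg p)
    then show "bern_prob p ?E (con (snd i) (fst (fst i)) (snd (fst i)))
       \<le> bern_prob p ?E (\<lambda>\<omega>. cluster_in d S \<omega> = snd i) * (p * theta d p (lbox d origin n))"
      by (simp add: i)
  qed
  also have "\<dots> = (\<Sum>(x, y)\<in>exit_steps d S. \<Sum>C\<in>{C \<in> Pow S. x \<in> C}.
      bern_prob p ?E (\<lambda>\<omega>. cluster_in d S \<omega> = C)) * (p * theta d p (lbox d origin n))"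
    unfolding I_def case_prod_unfold sum_distrib_right
    by (subst sum.Sigma) (use finS in \<open>auto simp: case_prod_unfold\<close>)
  also have "(\<Sum>(x, y)\<in>exit_steps d S. \<Sum>C\<in>{C \<in> Pow S. x \<in> C}.
      bern_prob p ?E (\<lambda>\<omega>. cluster_in d S \<omega> = C)) = psi d p S"
    unfolding psi_def case_prod_unfold
  proof (intro sum.cong refl)
    fix i assume "i \<in> exit_steps d S"
    define x where "x = fst i"
    have "bern_prob p (inner_edges d S) (\<lambda>\<omega>. (origin, x) \<in> (open_step \<omega>)\<^sup>*)
       = bern_prob p ?E (\<lambda>\<omega>. (origin, x) \<in> (open_step (\<omega> \<inter> inner_edges d S))\<^sup>*)"
      by (rule bern_prob_restrict[OF finE inE, symmetric])
    also have "\<dots> = (\<Sum>C\<in>{C \<in> Pow S. x \<in> C}. bern_prob p ?E (\<lambda>\<omega>. cluster_in d S \<omega> = C \<and>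
        (origin, x) \<in> (open_step (\<omega> \<inter> inner_edges d S))\<^sup>*))"
    proof (rule bern_prob_partition)
      fix \<omega> assume "(origin, x) \<in> (open_step (\<omega> \<inter> inner_edges d S))\<^sup>*"
      then show "cluster_in d S \<omega> \<in> {C \<in> Pow S. x \<in> C}"
        using cluster_in_subset[OF o, of d \<omega>] by (auto simp: cluster_in_def)
    qed (use finS in auto)
    also have "\<dots> = (\<Sum>C\<in>{C \<in> Pow S. x \<in> C}. bern_prob p ?E (\<lambda>\<omega>. cluster_in d S \<omega> = C))"
      by (intro sum.cong refl bern_prob_cong) (auto simp: cluster_in_def)
    finally show "(\<Sum>C\<in>{C \<in> Pow S. fst i \<in> C}. bern_prob p ?E (\<lambda>\<omega>. cluster_in d S \<omega> = C)) =
       bern_prob p (inner_edges d S) (\<lambda>\<omega>. (origin, fst i) \<in> (open_step \<omega>)\<^sup>*)" by (simp add: x_def)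
  qed
  finally show ?thesis by (simp add: mult_ac)
qed

lemma theta_exponential_decay:
  assumes p: "0 \<le> p" "p \<le> 1" and S: "S \<subseteq> lbox d origin L" and o: "origin \<in> S"
  shows "theta d p (lbox d origin (k * Suc L)) \<le> (p * psi d p S) ^ k"
proof (induction k)
  case 0
  show ?case unfolding theta_def by (simp add: bern_prob_le_1 p)
next
  case (Suc k)
  have "theta d p (lbox d origin (k * Suc L + Suc L)) \<le> p * psi d p S * theta d p (lbox d origin (k * Suc L))"
    by (rule theta_decay_step[OF p S o])
  also have "\<dots> \<le> p * psi d p S * (p * psi d p S) ^ k"
    by (intro mult_left_mono Suc.IH) (use p psi_nonneg[OF p] in auto)
  finally show ?case by (simp add: algebra_simps)
qed

lemma psi_mono:
  assumes "0 \<le> p" "p \<le> p'" "p' \<le> 1" "finite S"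
  shows "psi d p S \<le> psi d p' S"
  unfolding psi_def case_prod_unfold
proof (intro sum_mono bern_prob_mono_p)
  fix i \<omega> e assume "(origin, fst i) \<in> (open_step \<omega>)\<^sup>*"
  then show "(origin, fst i) \<in> (open_step (insert e \<omega>))\<^sup>*"
    using open_step_mono[OF subset_insertI] by auto
qed (use assms in auto)

section \<open>Paths\<close>

lemma path_edges_Nil [simp]: "path_edges [] = []"
  and path_edges_singleton [simp]: "path_edges [x] = []"
  and path_edges_Cons_Cons [simp]: "path_edges (x # y # zs) = {x, y} # path_edges (y # zs)"
  by (simp_all add: path_edges_def)

lemma path_edges_append: "path_edges (xs @ y # zs) = path_edges (xs @ [y]) @ path_edges (y # zs)"
proof (induction xs)
  case (Cons x xs)
  then show ?case by (cases xs) auto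
qed simp

lemma path_time_append: "path_time t (xs @ y # zs) = path_time t (xs @ [y]) + path_time t (y # zs)"
  unfolding path_time_def path_edges_append[of xs y zs] by simp

lemma path_time_singleton [simp]: "path_time t [x] = 0"
  by (simp add: path_time_def)

lemma path_time_Cons_Cons [simp]: "path_time t (x # y # zs) = t {x, y} + path_time t (y # zs)"
  by (simp add: path_time_def)

lemma paths_singleton: "v \<in> lattice d \<Longrightarrow> [v] \<in> paths d v v"
  by (simp add: paths_def)

lemma paths_split:
  "xs @ y # zs \<in> paths d u w \<longleftrightarrow> xs @ [y] \<in> paths d u y \<and> y # zs \<in> paths d y w"
proof -
  have "successively (adjacent d) (xs @ y # zs) \<longleftrightarrow>
      successively (adjacent d) (xs @ [y]) \<and> successively (adjacent d) (y # zs)"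
    by (auto simp: successively_append_iff)
  moreover have "hd (xs @ y # zs) = hd (xs @ [y])" by (cases xs) auto
  ultimately show ?thesis unfolding paths_def by auto
qed

lemma paths_join:
  assumes "p \<in> paths d u v" "q \<in> paths d v w"
  shows "butlast p @ q \<in> paths d u w" "path_time t (butlast p @ q) = path_time t p + path_time t q"
proof -
  have p: "butlast p @ [v] = p" using assms(1) by (auto simp: paths_def)
  obtain zs where q: "q = v # zs" using assms(2) by (cases q) (auto simp: paths_def)
  show "butlast p @ q \<in> paths d u w" using paths_split[of "butlast p" v zs d u w] assms p q by simp
  show "path_time t (butlast p @ q) = path_time t p + path_time t q"
    using path_time_append[of t "butlast p" v zs] p q by simp
qed

lemma paths_edge: "adjacent d u v \<Longrightarrow> [u, v] \<in> paths d u v"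
  by (simp add: paths_def adjacent_def)

lemma path_edges_subset_edges:
  assumes "successively (adjacent d) xs" shows "set (path_edges xs) \<subseteq> edges d"
  using assms
proof (induction xs rule: induct_list012)
  case (3 x y zs)
  then show ?case by (simp add: edge_iff_adjacent)
qed auto

lemma paths_edges_subset: "xs \<in> paths d u v \<Longrightarrow> set (path_edges xs) \<subseteq> edges d"
  by (rule path_edges_subset_edges) (simp add: paths_def)

lemma path_imp_open_steps:
  assumes "xs \<in> paths d u v" "set (path_edges xs) \<subseteq> \<omega>"
  shows "(u, v) \<in> (open_step \<omega>)\<^sup>*"
proof -
  have "(hd xs, last xs) \<in> (open_step \<omega>)\<^sup>*" if "xs \<noteq> []" "set (path_edges xs) \<subseteq> \<omega>" for xs
    using that
  proof (induction xs rule: induct_list012)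
    case (3 x y zs)
    then have "(x, y) \<in> open_step \<omega>" "(y, last (y # zs)) \<in> (open_step \<omega>)\<^sup>*" by (auto simp: open_step_def)
    then show ?case by (simp add: converse_rtrancl_into_rtrancl)
  qed auto
  then show ?thesis using assms by (auto simp: paths_def)
qed

lemma open_steps_imp_path:
  assumes "(u, v) \<in> (open_step \<omega>)\<^sup>*" "\<omega> \<subseteq> edges d" "u \<in> lattice d"
  shows "\<exists>xs\<in>paths d u v. set (path_edges xs) \<subseteq> \<omega>"
  using assms(1)
proof (induction rule: rtrancl_induct)
  case base
  show ?case using paths_singleton[OF assms(3)] by (intro bexI[of _ "[u]"]) auto
next
  case (step v w)
  then obtain xs where xs: "xs \<in> paths d u v" "set (path_edges xs) \<subseteq> \<omega>" by blast
  have vw: "{v, w} \<in> \<omega>" using step(2) by (simp add: open_step_def)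
  then have adj: "adjacent d v w" using assms(2) edge_iff_adjacent by blast
  have bl: "butlast xs @ [v] = xs" using xs(1) by (auto simp: paths_def)
  have "butlast xs @ [v, w] \<in> paths d u w"
    using paths_split[of "butlast xs" v "[w]"] xs(1) bl paths_edge[OF adj] by simp
  moreover have "path_edges (butlast xs @ [v, w]) = path_edges xs @ [{v, w}]"
    using path_edges_append[of "butlast xs" v "[w]"] bl by simp
  ultimately show ?case using xs vw by (intro bexI[of _ "butlast xs @ [v, w]"]) auto
qed

section \<open>From Bernoulli sums to probability spaces\<close>

text \<open>The bridge from finite sums to probability spaces; it serves both the product space in the
  definition of the critical probability and the edges of small weight in first-passage
  percolation.\<close>

lemma (in prob_space) prob_bernoulli_configuration:
  fixes opn :: "'e \<Rightarrow> 'a \<Rightarrow> bool"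
  assumes ind: "indep_vars (\<lambda>_. count_space UNIV) opn E" and fin: "finite E"
    and p: "\<And>e. e \<in> E \<Longrightarrow> prob {x \<in> space M. opn e x} = p"
  shows "{x \<in> space M. A {e \<in> E. opn e x}} \<in> events"
    and "prob {x \<in> space M. A {e \<in> E. opn e x}} = bern_prob p E A"
proof -
  define B where "B \<omega> = {x \<in> space M. {e \<in> E. opn e x} = \<omega>}" for \<omega>
  have rv: "opn e \<in> M \<rightarrow>\<^sub>M count_space UNIV" if "e \<in> E" for e
    using ind that by (auto simp: indep_vars_def)
  have ev1: "{x \<in> space M. opn e x} \<in> events" if "e \<in> E" for e
    using measurable_sets[OF rv[OF that], of "{True}"] by (simp add: vimage_def Int_def conj_commute)
  have Beq: "B \<omega> = (\<Inter>e\<in>E. opn e -` {e \<in> \<omega>} \<inter> space M) \<inter> space M" if "\<omega> \<subseteq> E" for \<omega>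
    using that by (auto simp: B_def)
  have Bev: "B \<omega> \<in> events" if "\<omega> \<subseteq> E" for \<omega>
  proof (cases "E = {}")
    case True
    then show ?thesis using that by (simp add: B_def)
  next
    case False
    show ?thesis unfolding Beq[OF that]
      by (intro sets.Int sets.finite_INT fin False measurable_sets[OF rv]) auto
  qed
  have Bprob: "prob (B \<omega>) = bern_weight p E \<omega>" if w: "\<omega> \<subseteq> E" for \<omega>
  proof (cases "E = {}")
    case True
    then show ?thesis using w by (simp add: B_def bern_weight_def prob_space)
  next
    case False
    have "B \<omega> = (\<Inter>e\<in>E. opn e -` {e \<in> \<omega>} \<inter> space M)" using Beq[OF w] False by auto
    then have "prob (B \<omega>) = (\<Prod>e\<in>E. prob (opn e -` {e \<in> \<omega>} \<inter> space M))"
      using indep_varsD_finite[OF ind False fin, of "\<lambda>e. {e \<in> \<omega>}"] by simp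
    also have "\<dots> = (\<Prod>e\<in>E. if e \<in> \<omega> then p else 1 - p)"
    proof (intro prod.cong refl)
      fix e assume e: "e \<in> E"
      show "prob (opn e -` {e \<in> \<omega>} \<inter> space M) = (if e \<in> \<omega> then p else 1 - p)"
      proof (cases "e \<in> \<omega>")
        case True
        then have "opn e -` {e \<in> \<omega>} \<inter> space M = {x \<in> space M. opn e x}" by auto
        then show ?thesis using True p[OF e] by simp
      next
        case F: False
        then have "opn e -` {e \<in> \<omega>} \<inter> space M = space M - {x \<in> space M. opn e x}" by auto
        then show ?thesis using F p[OF e] prob_compl[OF ev1[OF e]] by simp
      qed
    qed
    also have "\<dots> = (\<Prod>e\<in>\<omega>. p) * (\<Prod>e\<in>E - \<omega>. 1 - p)"
      unfolding prod.If_cases[OF fin] using w by (simp add: Int_absorb1 Diff_eq Compl_eq)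
    finally show ?thesis by (simp add: bern_weight_def)
  qed
  have eq: "{x \<in> space M. A {e \<in> E. opn e x}} = (\<Union>\<omega>\<in>{\<omega> \<in> Pow E. A \<omega>}. B \<omega>)"
    by (auto simp: B_def)
  show "{x \<in> space M. A {e \<in> E. opn e x}} \<in> events"
    unfolding eq by (intro sets.finite_UN) (use fin Bev in auto)
  have "prob (\<Union>\<omega>\<in>{\<omega> \<in> Pow E. A \<omega>}. B \<omega>) = (\<Sum>\<omega>\<in>{\<omega> \<in> Pow E. A \<omega>}. prob (B \<omega>))"
    by (rule finite_measure_finite_Union) (use fin Bev in \<open>auto simp: disjoint_family_on_def B_def\<close>)
  also have "\<dots> = (\<Sum>\<omega>\<in>{\<omega> \<in> Pow E. A \<omega>}. bern_weight p E \<omega>)"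
    by (intro sum.cong) (auto simp: Bprob)
  also have "\<dots> = bern_prob p E A"
    unfolding bern_prob_def using fin by (simp add: sum.If_cases of_bool_def if_distrib Int_def cong: if_cong)
  finally show "prob {x \<in> space M. A {e \<in> E. opn e x}} = bern_prob p E A" using eq by simp
qed

lemma indep_vars_bernoulli_percolation:
  assumes "d \<ge> 1"
  shows "prob_space.indep_vars (bernoulli_percolation d p) (\<lambda>_. count_space UNIV) (\<lambda>e \<eta>. \<eta> e) (edges d)"
proof -
  define N where "N = (\<lambda>_::edge. measure_pmf (bernoulli_pmf p))"
  interpret product_prob_space N "edges d"
    by (simp add: N_def product_prob_space_def product_prob_space_axioms_def product_sigma_finite_def
        prob_space_measure_pmf prob_space_imp_sigma_finite)
  have B: "bernoulli_percolation d p = PiM (edges d) N" by (simp add: bernoulli_percolation_def N_def)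
  define B where "B = PiM (edges d) N"
  interpret B: prob_space B unfolding B_def by (rule prob_space_axioms)
  have "adjacent d origin e1"
  proof -
    have "(\<Sum>i<d. \<bar>origin i - e1 i\<bar>) = (\<Sum>i<d. if i = 0 then 1 else 0 :: int)"
      by (intro sum.cong) (auto simp: origin_def e1_def)
    also have "\<dots> = 1" using assms by simp
    finally show ?thesis using assms by (auto simp: adjacent_def lattice_def origin_def e1_def)
  qed
  then have ne: "edges d \<noteq> {}" by (auto simp: edges_def)
  have meas: "(\<lambda>\<eta>. \<eta> e) \<in> B \<rightarrow>\<^sub>M N e" if "e \<in> edges d" for e
    unfolding B_def by (rule measurable_component_singleton[OF that])
  have "distr B (PiM (edges d) N) (\<lambda>x. restrict x (edges d)) = distr B B (\<lambda>x. x)"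
    by (intro distr_cong) (auto simp: B_def space_PiM)
  also have "\<dots> = PiM (edges d) N" by (simp add: distr_id B_def)
  also have "\<dots> = PiM (edges d) (\<lambda>e. distr B (N e) (\<lambda>\<eta>. \<eta> e))"
    by (intro PiM_cong refl) (simp add: B_def PiM_component)
  finally have "B.indep_vars N (\<lambda>e \<eta>. \<eta> e) (edges d)"
    by (subst B.indep_vars_iff_distr_eq_PiM'[OF ne]) (use meas in auto)
  then have "B.indep_vars (\<lambda>_. count_space UNIV) (\<lambda>e \<eta>. (\<lambda>x. x) (\<eta> e)) (edges d)"
    by (rule B.indep_vars_compose2) (simp add: N_def)
  then show ?thesis unfolding B B_def by simp
qed

section \<open>Below the critical probability\<close>

lemma finite_subset_lbox:
  assumes "finite F" "F \<subseteq> lattice d"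
  shows "\<exists>n. F \<subseteq> lbox d x n"
  using assms
proof (induction F)
  case (insert y F)
  then obtain n where n: "F \<subseteq> lbox d x n" by auto
  \<comment> \<open>any bound on all coordinate differences will do\<close>
  define m where "m = nat (\<Sum>i<d. \<bar>y i - x i\<bar>)"
  have "\<bar>y i - x i\<bar> \<le> int m" if "i < d" for i
  proof -
    have "\<bar>y i - x i\<bar> \<le> (\<Sum>i<d. \<bar>y i - x i\<bar>)" by (rule member_le_sum) (use that in auto)
    then show ?thesis by (simp add: m_def)
  qed
  then have "y \<in> lbox d x m" using insert.prems by (simp add: lbox_def)
  then have "insert y F \<subseteq> lbox d x (max m n)"
    using n lbox_mono[of m "max m n" d x] lbox_mono[of n "max m n" d x] by auto
  then show ?case by blast
qed simp

lemma origin_lattice [simp]: "origin \<in> lattice d"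
  by (simp add: origin_def lattice_def)

text \<open>A cluster is infinite if and only if it leaves every box, because boxes are finite. Each of these
  conditions depends on finitely many edges, so the event is measurable.\<close>

lemma infinite_open_cluster_iff:
  "infinite (open_cluster d \<eta>) \<longleftrightarrow>
   (\<forall>n. exits {e \<in> touching d (lbox d origin n). \<eta> e} (lbox d origin n) origin)"
proof -
  define \<omega> where "\<omega> = {e \<in> edges d. \<eta> e}"
  have sub: "\<omega> \<subseteq> edges d" by (auto simp: \<omega>_def)
  have cl: "v \<in> open_cluster d \<eta> \<longleftrightarrow> (origin, v) \<in> (open_step \<omega>)\<^sup>*" for v
  proof
    assume "v \<in> open_cluster d \<eta>"
    then obtain xs where xs: "xs \<in> paths d origin v" "\<forall>e\<in>set (path_edges xs). \<eta> e"
      by (auto simp: open_cluster_def)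
    have "set (path_edges xs) \<subseteq> \<omega>" using xs paths_edges_subset[OF xs(1)] by (auto simp: \<omega>_def)
    then show "(origin, v) \<in> (open_step \<omega>)\<^sup>*" by (rule path_imp_open_steps[OF xs(1)])
  next
    assume "(origin, v) \<in> (open_step \<omega>)\<^sup>*"
    from open_steps_imp_path[OF this sub] show "v \<in> open_cluster d \<eta>"
      by (auto simp: open_cluster_def \<omega>_def)
  qed
  have restr: "{e \<in> touching d (lbox d origin n). \<eta> e} = \<omega> \<inter> touching d (lbox d origin n)" for n
    by (auto simp: \<omega>_def touching_def)
  have ex: "exits {e \<in> touching d (lbox d origin n). \<eta> e} (lbox d origin n) origin \<longleftrightarrow>
      \<not> open_cluster d \<eta> \<subseteq> lbox d origin n" for n
    unfolding restr exits_restrict_touching[OF sub] by (auto simp: exits_def cl[symmetric])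
  have lat: "open_cluster d \<eta> \<subseteq> lattice d"
  proof
    fix v assume "v \<in> open_cluster d \<eta>"
    then obtain xs where "xs \<in> paths d origin v" by (auto simp: open_cluster_def)
    then have "xs \<noteq> []" "set xs \<subseteq> lattice d" "last xs = v" by (auto simp: paths_def)
    then show "v \<in> lattice d" using last_in_set[of xs] by auto
  qed
  show ?thesis unfolding ex using finite_subset_lbox[OF _ lat, of origin] finite_subset[OF _ finite_lbox] by blast
qed

lemma percolation_probability_limit:
  assumes "d \<ge> 1" "0 \<le> p" "p \<le> 1"
  shows "(\<lambda>n. theta d p (lbox d origin n)) \<longlonglongrightarrow> percolation_probability d p"
proof -
  define B where "B = bernoulli_percolation d p"
  interpret prob_space B unfolding B_def bernoulli_percolation_def
    by (rule prob_space_PiM) (rule prob_space_measure_pmf)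
  have ind: "indep_vars (\<lambda>_. count_space UNIV) (\<lambda>e \<eta>. \<eta> e) (edges d)"
    unfolding B_def by (rule indep_vars_bernoulli_percolation[OF assms(1)])
  define A where "A n = {\<eta> \<in> space B. exits {e \<in> touching d (lbox d origin n). \<eta> e} (lbox d origin n) origin}" for n
  have single: "prob {\<eta> \<in> space B. \<eta> e} = p" if e: "e \<in> edges d" for e
  proof -
    interpret product_prob_space "\<lambda>_::edge. measure_pmf (bernoulli_pmf p)" "edges d"
      by (simp add: product_prob_space_def product_prob_space_axioms_def product_sigma_finite_def
        prob_space_measure_pmf prob_space_imp_sigma_finite)
    have "measure (distr B (measure_pmf (bernoulli_pmf p)) (\<lambda>\<eta>. \<eta> e)) {True} = p"
      unfolding B_def bernoulli_percolation_def PiM_component[OF e] using assms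
      by (simp add: measure_pmf_single)
    moreover have "measure (distr B (measure_pmf (bernoulli_pmf p)) (\<lambda>\<eta>. \<eta> e)) {True}
       = measure B ((\<lambda>\<eta>. \<eta> e) -` {True} \<inter> space B)"
      by (rule measure_distr) (use e in \<open>auto simp: B_def bernoulli_percolation_def\<close>)
    moreover have "(\<lambda>\<eta>. \<eta> e) -` {True} \<inter> space B = {\<eta> \<in> space B. \<eta> e}" by auto
    ultimately show ?thesis by simp
  qed
  have A: "A n \<in> events" "prob (A n) = theta d p (lbox d origin n)" for n
  proof -
    note * = prob_bernoulli_configuration[OF indep_vars_subset[OF ind touching_subset_edges], of "lbox d origin n" p
        "\<lambda>\<omega>. exits \<omega> (lbox d origin n) origin"]
    have pe: "\<And>e. e \<in> touching d (lbox d origin n) \<Longrightarrow> prob {\<eta> \<in> space B. \<eta> e} = p"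
      using single touching_subset_edges by blast
    show "A n \<in> events" unfolding A_def by (rule *(1)) (use pe in auto)
    show "prob (A n) = theta d p (lbox d origin n)" unfolding A_def theta_def by (rule *(2)) (use pe in auto)
  qed
  have "decseq A"
  proof (rule decseq_SucI, rule subsetI)
    fix n \<eta> assume "\<eta> \<in> A (Suc n)"
    then have s: "\<eta> \<in> space B" and e: "exits {e \<in> touching d (lbox d origin (Suc n)). \<eta> e} (lbox d origin (Suc n)) origin"
      by (auto simp: A_def)
    let ?\<omega> = "{e \<in> touching d (lbox d origin (Suc n)). \<eta> e}"
    have "exits ?\<omega> (lbox d origin n) origin"
      using e lbox_mono[of n "Suc n" d origin] by (auto simp: exits_def)
    then have "exits (?\<omega> \<inter> touching d (lbox d origin n)) (lbox d origin n) origin"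
      by (subst exits_restrict_touching) (auto simp: touching_def)
    moreover have "?\<omega> \<inter> touching d (lbox d origin n) \<subseteq> {e \<in> touching d (lbox d origin n). \<eta> e}" by auto
    ultimately show "\<eta> \<in> A n" using s exits_mono by (auto simp: A_def)
  qed
  then have "(\<lambda>n. prob (A n)) \<longlonglongrightarrow> prob (\<Inter>n. A n)"
    by (intro finite_Lim_measure_decseq) (use A in auto)
  moreover have "(\<Inter>n. A n) = {\<eta> \<in> space B. infinite (open_cluster d \<eta>)}"
    by (auto simp: A_def infinite_open_cluster_iff)
  ultimately show ?thesis by (simp add: A percolation_probability_def B_def[symmetric])
qed

text \<open>This makes the set in the definition of the critical probability nonempty, without which its
  supremum would carry no information.\<close>

lemma percolation_probability_0:
  assumes "d \<ge> 1" shows "percolation_probability d 0 = 0"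
proof -
  have "theta d 0 (lbox d origin n) = 0" for n
  proof -
    have "bern_weight 0 (touching d (lbox d origin n)) \<omega> * of_bool (exits \<omega> (lbox d origin n) origin) = 0"
      if "\<omega> \<subseteq> touching d (lbox d origin n)" for \<omega>
    proof (cases "\<omega> = {}")
      case True
      have "\<not> exits {} (lbox d origin n) origin"
        by (auto simp: exits_def open_step_def box_def lbox_self)
      then show ?thesis using True by simp
    next
      case False
      have "finite \<omega>" using that finite_subset[OF that] by simp
      then show ?thesis using False by (simp add: bern_weight_def power_0_left card_gt_0_iff)
    qed
    then show ?thesis unfolding theta_def bern_prob_def by (intro sum.neutral) auto
  qed
  then show ?thesis using percolation_probability_limit[OF assms, of 0] by (simp add: LIMSEQ_const_iff)
qed

text \<open>Otherwise the differential inequality holds on an interval above \<open>p0\<close> that ends at a parameter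
  where the percolation probability vanishes, and it bounds this probability away from zero.\<close>

lemma ex_subcritical_set:
  assumes "d \<ge> 1" "0 \<le> p0" "p0 < critical_probability d"
  shows "\<exists>p S L. p0 < p \<and> p \<le> 1 \<and> S \<subseteq> lbox d origin L \<and> origin \<in> S \<and> p * psi d p S < 1"
proof (rule ccontr)
  assume neg: "\<not> ?thesis"
  define Z where "Z = {p \<in> {0..1}. percolation_probability d p = 0}"
  have "0 \<in> Z" using percolation_probability_0[OF assms(1)] by (simp add: Z_def)
  moreover have "bdd_above Z" by (rule bdd_aboveI[of _ 1]) (auto simp: Z_def)
  ultimately have "\<exists>p2\<in>Z. p0 < p2"
    using assms(3) less_cSup_iff[of Z p0] unfolding critical_probability_def Z_def by blast
  then obtain p2 where p2: "p0 < p2" "p2 \<le> 1" "percolation_probability d p2 = 0" by (auto simp: Z_def)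
  have "1 - exp (p0 - p2) \<le> theta d p2 (lbox d origin n)" for n
  proof (rule theta_lower_bound)
    fix p S assume "p0 < p" "p < p2" "S \<subseteq> lbox d origin n" "origin \<in> S"
    then show "1 \<le> p * psi d p S" using neg p2 by (metis less_imp_le not_less order_trans)
  qed (use assms p2 in \<open>auto intro: lbox_self\<close>)
  then have "1 - exp (p0 - p2) \<le> percolation_probability d p2"
    by (intro LIMSEQ_le_const[OF percolation_probability_limit]) (use assms p2 in auto)
  then have "1 \<le> exp (p0 - p2)" using p2 by simp
  then show False using p2(1) by simp
qed

theorem subcritical_exponential_decay:
  assumes "d \<ge> 1" "0 \<le> p0" "p0 < critical_probability d"
  shows "\<exists>p \<rho> L. p0 < p \<and> 0 \<le> \<rho> \<and> \<rho> < 1 \<and>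
    (\<forall>p' k. 0 \<le> p' \<longrightarrow> p' \<le> p \<longrightarrow> theta d p' (lbox d origin (k * Suc L)) \<le> \<rho> ^ k)"
proof -
  obtain p S L where p: "p0 < p" "p \<le> 1" and S: "S \<subseteq> lbox d origin L" "origin \<in> S" and lt: "p * psi d p S < 1"
    using ex_subcritical_set[OF assms] by blast
  have finS: "finite S" using S(1) finite_subset[OF S(1)] by simp
  have "theta d p' (lbox d origin (k * Suc L)) \<le> (p * psi d p S) ^ k" if p': "0 \<le> p'" "p' \<le> p" for p' k
  proof -
    have "theta d p' (lbox d origin (k * Suc L)) \<le> (p' * psi d p' S) ^ k"
      by (rule theta_exponential_decay) (use p p' S in auto)
    also have "\<dots> \<le> (p * psi d p S) ^ k"
      by (intro power_mono mult_mono psi_mono mult_nonneg_nonneg psi_nonneg) (use p p' finS in auto)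
    finally show ?thesis .
  qed
  moreover have "0 \<le> p * psi d p S" using p assms psi_nonneg[of p d S] by simp
  ultimately show ?thesis using p lt by blast
qed

section \<open>Optimal paths stay in a polynomially large box\<close>

lemma path_time_nonneg:
  assumes "xs \<in> paths d u v" "\<And>e. e \<in> edges d \<Longrightarrow> 0 \<le> t e"
  shows "0 \<le> path_time t xs"
  unfolding path_time_def
  by (rule sum_list_nonneg) (use paths_edges_subset[OF assms(1)] assms(2) in auto)

text \<open>A path that gets further than the open cluster of its starting point uses a closed edge, and the
  first one starts within reach of that cluster.\<close>

lemma first_closed_edge:
  assumes "xs \<noteq> []" "(x, hd xs) \<in> (open_step \<omega>)\<^sup>*" "last xs \<notin> \<Lambda>" "\<not> exits \<omega> \<Lambda> x"
  shows "\<exists>ys u v zs. xs = ys @ u # v # zs \<and> {u, v} \<notin> \<omega> \<and> u \<in> \<Lambda>"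
  using assms
proof (induction xs rule: induct_list012)
  case (2 h)
  then show ?case by (auto simp: exits_def)
next
  case (3 h h' zs)
  show ?case
  proof (cases "{h, h'} \<in> \<omega>")
    case True
    then have "(x, h') \<in> (open_step \<omega>)\<^sup>*"
      using 3(4) by (auto simp: open_step_def intro: rtrancl_into_rtrancl)
    then obtain ys u v ws where "h' # zs = ys @ u # v # ws" "{u, v} \<notin> \<omega>" "u \<in> \<Lambda>"
      using 3 by auto
    then show ?thesis by (intro exI[of _ "h # ys"] exI[of _ u] exI[of _ v] exI[of _ ws]) simp
  next
    case False
    moreover have "h \<in> \<Lambda>" using 3(4,6) by (auto simp: exits_def)
    ultimately show ?thesis by (intro exI[of _ "[]"] exI[of _ h] exI[of _ h'] exI[of _ zs]) simp
  qed
qed simp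

text \<open>If all clusters of edges of weight at most \<open>\<epsilon>\<close> have radius at most \<open>n\<close>, then a path pays more than \<open>\<epsilon>\<close>
  at least once while it moves by \<open>n + 1\<close>.\<close>

lemma path_time_leaving_box:
  assumes t: "\<And>e. e \<in> edges d \<Longrightarrow> 0 \<le> t e"
    and \<omega>: "\<omega> = {e \<in> edges d. t e \<le> \<epsilon>}"
    and small: "\<And>y. y \<in> lbox d origin m \<Longrightarrow> \<not> exits \<omega> (lbox d y n) y"
  shows "xs \<in> paths d x w \<Longrightarrow> w \<notin> lbox d origin m \<Longrightarrow> x \<in> lbox d origin j \<Longrightarrow>
    j + k * Suc n \<le> m \<Longrightarrow> real k * \<epsilon> \<le> path_time t xs"
proof (induction k arbitrary: j x xs)
  case 0
  then show ?case using path_time_nonneg[OF 0(1) t] by simp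
next
  case (Suc k)
  have xs: "xs \<noteq> []" "hd xs = x" "last xs = w" using Suc.prems(1) by (auto simp: paths_def)
  have "x \<in> lbox d origin m" using Suc.prems(3,4) lbox_mono[of j m d origin] by auto
  then have ne: "\<not> exits \<omega> (lbox d x n) x" by (rule small)
  have bx: "lbox d x n \<subseteq> lbox d origin (j + n)" using lbox_trans[OF Suc.prems(3)] by auto
  also have "\<dots> \<subseteq> lbox d origin m" by (rule lbox_mono) (use Suc.prems(4) in simp)
  finally have "last xs \<notin> lbox d x n" using Suc.prems(2) xs by auto
  then obtain ys u v zs where dec: "xs = ys @ u # v # zs" "{u, v} \<notin> \<omega>" "u \<in> lbox d x n"
    using first_closed_edge[of xs x \<omega> "lbox d x n"] xs ne by auto
  have p1: "ys @ [u] \<in> paths d x u" and p2: "u # v # zs \<in> paths d u w"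
    using Suc.prems(1) paths_split[of ys u "v # zs" d x w] dec(1) by auto
  have p3: "[u] @ [v] \<in> paths d u v" "v # zs \<in> paths d v w"
    using p2 paths_split[of "[u]" v zs d u w] by auto
  have adj: "adjacent d u v" using p3(1) by (simp add: paths_def)
  then have tuv: "\<epsilon> < t {u, v}" using dec(2) by (auto simp: \<omega> edge_iff_adjacent)
  have "v \<in> lbox d origin (Suc (j + n))" using adjacent_lbox_Suc[OF adj] dec(3) bx by blast
  then have "real k * \<epsilon> \<le> path_time t (v # zs)"
    by (rule Suc.IH[OF p3(2) Suc.prems(2)]) (use Suc.prems(4) in simp)
  moreover have "path_time t xs = path_time t (ys @ [u]) + (t {u, v} + path_time t (v # zs))"
    unfolding dec(1) path_time_append[of t ys u "v # zs"] by simp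
  moreover have "0 \<le> path_time t (ys @ [u])" by (rule path_time_nonneg[OF p1 t])
  ultimately show ?case using tuv by (simp add: algebra_simps)
qed

lemma path_time_visiting_outside:
  assumes t: "\<And>e. e \<in> edges d \<Longrightarrow> 0 \<le> t e"
    and \<omega>: "\<omega> = {e \<in> edges d. t e \<le> \<epsilon>}"
    and small: "\<And>y. y \<in> lbox d origin (k * Suc n) \<Longrightarrow> \<not> exits \<omega> (lbox d y n) y"
    and xs: "xs \<in> paths d origin w" "z \<in> set xs" "z \<notin> lbox d origin (k * Suc n)"
  shows "real k * \<epsilon> \<le> path_time t xs"
proof -
  obtain ys zs where dec: "xs = ys @ z # zs" using xs(2) by (meson split_list)
  have p: "ys @ [z] \<in> paths d origin z" "z # zs \<in> paths d z w"
    using xs(1) paths_split[of ys z zs d origin w] dec by auto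
  have "real k * \<epsilon> \<le> path_time t (ys @ [z])"
    by (rule path_time_leaving_box[OF t \<omega> small p(1) xs(3), of 0]) (auto intro: lbox_self)
  moreover have "path_time t xs = path_time t (ys @ [z]) + path_time t (z # zs)"
    unfolding dec by (rule path_time_append)
  moreover have "0 \<le> path_time t (z # zs)" by (rule path_time_nonneg[OF p(2) t])
  ultimately show ?thesis by simp
qed

definition axis_point :: "nat \<Rightarrow> vertex" where
  "axis_point N = (\<lambda>i. int N * e1 i)"

definition axis_edge :: "nat \<Rightarrow> edge" where
  "axis_edge i = {axis_point i, axis_point (Suc i)}"

lemma axis_point_lattice: "d \<ge> 1 \<Longrightarrow> axis_point N \<in> lattice d"
  by (auto simp: axis_point_def lattice_def e1_def)

lemma axis_point_adjacent:
  assumes "d \<ge> 1" shows "adjacent d (axis_point i) (axis_point (Suc i))"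
proof -
  have "(\<Sum>j<d. \<bar>axis_point i j - axis_point (Suc i) j\<bar>) = (\<Sum>j<d. if j = 0 then 1 else 0 :: int)"
    by (intro sum.cong) (auto simp: axis_point_def e1_def)
  also have "\<dots> = 1" using assms by simp
  finally show ?thesis using axis_point_lattice[OF assms] by (simp add: adjacent_def)
qed

lemma axis_edge_in_edges: "d \<ge> 1 \<Longrightarrow> axis_edge i \<in> edges d"
  by (simp add: axis_edge_def edge_iff_adjacent axis_point_adjacent)

lemma ex_axis_path:
  assumes "d \<ge> 1"
  shows "\<exists>xs\<in>paths d origin (axis_point N). \<forall>t. path_time t xs = (\<Sum>i<N. t (axis_edge i))"
proof (induction N)
  case 0
  have "axis_point 0 = origin" by (simp add: axis_point_def origin_def)
  then show ?case using paths_singleton[of origin d] by (intro bexI[of _ "[origin]"]) auto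
next
  case (Suc N)
  then obtain xs where xs: "xs \<in> paths d origin (axis_point N)" "\<And>t. path_time t xs = (\<Sum>i<N. t (axis_edge i))"
    by blast
  have e: "[axis_point N, axis_point (Suc N)] \<in> paths d (axis_point N) (axis_point (Suc N))"
    by (rule paths_edge[OF axis_point_adjacent[OF assms]])
  show ?case
    by (rule bexI[OF _ paths_join(1)[OF xs(1) e]])
      (simp add: paths_join(2)[OF xs(1) e] xs(2) axis_edge_def)
qed

lemma optimal_path_le:
  assumes t: "\<And>e. e \<in> edges d \<Longrightarrow> 0 \<le> t e" and g: "\<gamma> \<in> optimal_paths d t v w" and xs: "xs \<in> paths d v w"
  shows "path_time t \<gamma> \<le> path_time t xs"
proof -
  have "passage_time d t v w \<le> path_time t xs"
    unfolding passage_time_def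
    by (rule cINF_lower[OF _ xs]) (rule bdd_belowI[of _ 0], use path_time_nonneg[OF _ t] in auto)
  then show ?thesis using g by (simp add: optimal_paths_def)
qed

lemma squeeze_to_zero:
  fixes f g :: "nat \<Rightarrow> real"
  assumes "\<And>n. 0 \<le> f n" "\<And>n. f n \<le> g n" "g \<longlonglongrightarrow> 0"
  shows "f \<longlonglongrightarrow> 0"
  by (rule tendsto_sandwich[OF _ _ tendsto_const assms(3)]) (use assms in auto)

text \<open>The hypotheses of the theorem, so that the probabilistic lemmas need not repeat them.\<close>

locale passage_percolation = prob_space M for M :: "'a measure" +
  fixes d :: nat and \<tau> :: "edge \<Rightarrow> 'a \<Rightarrow> real" and r a b :: real
  assumes d2: "d \<ge> 2"
    and indep: "indep_vars (\<lambda>_. borel) \<tau> (edges d)"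
    and ident: "e \<in> edges d \<Longrightarrow> e' \<in> edges d \<Longrightarrow> distr M borel (\<tau> e) = distr M borel (\<tau> e')"
    and nonneg: "e \<in> edges d \<Longrightarrow> \<omega> \<in> space M \<Longrightarrow> 0 \<le> \<tau> e \<omega>"
    and r_pos: "r > 0" and a_pos: "a > 0" and b_pos: "b > 0"
    and tail: "e \<in> edges d \<Longrightarrow> t \<ge> 0 \<Longrightarrow> prob {\<omega> \<in> space M. t \<le> \<tau> e \<omega>} \<le> a * exp (- b * t powr r)"
    and subcritical: "e \<in> edges d \<Longrightarrow> prob {\<omega> \<in> space M. \<tau> e \<omega> = 0} < critical_probability d"
begin

lemma d1: "d \<ge> 1" using d2 by simp

lemma rv [measurable]: "e \<in> edges d \<Longrightarrow> \<tau> e \<in> borel_measurable M"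
  using indep by (auto simp: indep_vars_def)

text \<open>Right continuity of the distribution function at zero.\<close>

lemma ex_almost_zero_threshold:
  assumes "prob {\<omega> \<in> space M. \<tau> (axis_edge 0) \<omega> = 0} < p"
  shows "\<exists>\<epsilon>>0. \<forall>e\<in>edges d. prob {\<omega> \<in> space M. \<tau> e \<omega> \<le> \<epsilon>} < p"
proof -
  let ?e = "axis_edge 0"
  have e: "?e \<in> edges d" by (rule axis_edge_in_edges[OF d1])
  note [measurable] = rv[OF e]
  define A where "A n = {\<omega> \<in> space M. \<tau> ?e \<omega> \<le> 1 / real (Suc n)}" for n
  have "decseq A"
  proof (rule decseq_SucI)
    fix n
    have "1 / real (Suc (Suc n)) \<le> 1 / real (Suc n)" by (simp add: frac_le)
    then show "A (Suc n) \<subseteq> A n" unfolding A_def by auto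
  qed
  moreover have "range A \<subseteq> events" unfolding A_def by auto
  ultimately have "(\<lambda>n. prob (A n)) \<longlonglongrightarrow> prob (\<Inter>n. A n)" by (intro finite_Lim_measure_decseq)
  also have "(\<Inter>n. A n) = {\<omega> \<in> space M. \<tau> ?e \<omega> = 0}"
  proof (intro set_eqI iffI)
    fix \<omega> assume w: "\<omega> \<in> (\<Inter>n. A n)"
    then have "\<tau> ?e \<omega> \<le> inverse (real (Suc n))" for n by (auto simp: A_def inverse_eq_divide)
    then have "\<tau> ?e \<omega> \<le> 0" by (intro LIMSEQ_le_const[OF LIMSEQ_inverse_real_of_nat]) auto
    then show "\<omega> \<in> {\<omega> \<in> space M. \<tau> ?e \<omega> = 0}" using w nonneg[OF e] by (force simp: A_def)
  qed (auto simp: A_def)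
  finally have "\<forall>\<^sub>F n in sequentially. prob (A n) < p" using assms by (intro order_tendstoD)
  then obtain n where n: "prob (A n) < p" by (auto simp: eventually_sequentially)
  have "prob {\<omega> \<in> space M. \<tau> e \<omega> \<le> 1 / real (Suc n)} < p" if e': "e \<in> edges d" for e
  proof -
    have m: "measure (distr M borel (\<tau> f)) {..1 / real (Suc n)} = prob {\<omega> \<in> space M. \<tau> f \<omega> \<le> 1 / real (Suc n)}"
      if f: "f \<in> edges d" for f
      by (subst measure_distr) (use rv[OF f] in \<open>auto intro!: arg_cong[of _ _ prob]\<close>)
    show ?thesis using m[OF e'] m[OF e] ident[OF e' e] n unfolding A_def by simp
  qed
  then show ?thesis by (intro exI[of _ "1 / real (Suc n)"]) auto
qed

lemma ident_prob_le:
  assumes "e \<in> edges d" "e' \<in> edges d"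
  shows "prob {\<omega> \<in> space M. \<tau> e \<omega> \<le> c} = prob {\<omega> \<in> space M. \<tau> e' \<omega> \<le> c}"
proof -
  have "measure (distr M borel (\<tau> f)) {..c} = prob {\<omega> \<in> space M. \<tau> f \<omega> \<le> c}" if f: "f \<in> edges d" for f
    by (subst measure_distr) (use rv[OF f] in \<open>auto intro!: arg_cong[of _ _ prob]\<close>)
  then show ?thesis using assms ident[OF assms] by metis
qed

lemma cheap_cluster_decay:
  "\<exists>\<epsilon>>0. \<exists>\<rho> L. 0 \<le> \<rho> \<and> \<rho> < 1 \<and> (\<forall>x\<in>lattice d. \<forall>k.
     {\<omega> \<in> space M. exits {e \<in> edges d. \<tau> e \<omega> \<le> \<epsilon>} (lbox d x (k * Suc L)) x} \<in> events \<and>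
     prob {\<omega> \<in> space M. exits {e \<in> edges d. \<tau> e \<omega> \<le> \<epsilon>} (lbox d x (k * Suc L)) x} \<le> \<rho> ^ k)"
proof -
  let ?e = "axis_edge 0"
  have e0: "?e \<in> edges d" by (rule axis_edge_in_edges[OF d1])
  obtain p \<rho> L where p: "prob {\<omega> \<in> space M. \<tau> ?e \<omega> = 0} < p" and rho: "0 \<le> \<rho>" "\<rho> < 1"
    and decay: "\<And>p' k. 0 \<le> p' \<Longrightarrow> p' \<le> p \<Longrightarrow> theta d p' (lbox d origin (k * Suc L)) \<le> \<rho> ^ k"
    using subcritical_exponential_decay[OF d1 measure_nonneg subcritical[OF e0]] by blast
  obtain \<epsilon> where eps: "\<epsilon> > 0" "\<And>e. e \<in> edges d \<Longrightarrow> prob {\<omega> \<in> space M. \<tau> e \<omega> \<le> \<epsilon>} < p"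
    using ex_almost_zero_threshold[OF p] by blast
  define p' where "p' = prob {\<omega> \<in> space M. \<tau> ?e \<omega> \<le> \<epsilon>}"
  have p': "0 \<le> p'" "p' \<le> p" using eps(2)[OF e0] by (auto simp: p'_def)
  have ind: "indep_vars (\<lambda>_. count_space UNIV) (\<lambda>e \<omega>. \<tau> e \<omega> \<le> \<epsilon>) (edges d)"
    by (rule indep_vars_compose2[OF indep]) auto
  have "{\<omega> \<in> space M. exits {e \<in> edges d. \<tau> e \<omega> \<le> \<epsilon>} (lbox d x (k * Suc L)) x} \<in> events \<and>
     prob {\<omega> \<in> space M. exits {e \<in> edges d. \<tau> e \<omega> \<le> \<epsilon>} (lbox d x (k * Suc L)) x} \<le> \<rho> ^ k"
    if x: "x \<in> lattice d" for x k
  proof -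
    let ?\<Lambda> = "lbox d x (k * Suc L)"
    have "{e \<in> touching d ?\<Lambda>. \<tau> e \<omega> \<le> \<epsilon>} = {e \<in> edges d. \<tau> e \<omega> \<le> \<epsilon>} \<inter> touching d ?\<Lambda>" for \<omega>
      by (auto simp: touching_def)
    then have eq: "exits {e \<in> edges d. \<tau> e \<omega> \<le> \<epsilon>} ?\<Lambda> x \<longleftrightarrow> exits {e \<in> touching d ?\<Lambda>. \<tau> e \<omega> \<le> \<epsilon>} ?\<Lambda> x" for \<omega>
      using exits_restrict_touching[of "{e \<in> edges d. \<tau> e \<omega> \<le> \<epsilon>}" d ?\<Lambda> x] by auto
    have pe: "prob {\<omega> \<in> space M. \<tau> e \<omega> \<le> \<epsilon>} = p'" if "e \<in> touching d ?\<Lambda>" for e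
      unfolding p'_def by (rule ident_prob_le) (use that e0 touching_subset_edges in auto)
    note * = prob_bernoulli_configuration[OF indep_vars_subset[OF ind touching_subset_edges] _ pe,
        of "?\<Lambda>" "\<lambda>\<omega>. exits \<omega> ?\<Lambda> x"]
    have "{\<omega> \<in> space M. exits {e \<in> edges d. \<tau> e \<omega> \<le> \<epsilon>} ?\<Lambda> x} \<in> events"
      unfolding eq by (rule *(1)) auto
    moreover have "prob {\<omega> \<in> space M. exits {e \<in> edges d. \<tau> e \<omega> \<le> \<epsilon>} ?\<Lambda> x} = theta d p' (lbox d origin (k * Suc L))"
      unfolding eq theta_translate[OF x, symmetric] by (rule *(2)) auto
    ultimately show ?thesis using decay[OF p'] by simp
  qed
  then show ?thesis using eps(1) rho by blast
qed

text \<open>The straight path to \<open>N e\<^sub>1\<close> takes time at most \<open>\<epsilon> * N\<^sup>2\<close>; this crude bound suffices because the size of the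
  confining box may be any polynomial in \<open>N\<close>.\<close>

lemma axis_edges_light:
  assumes "\<epsilon> > 0"
  shows "(\<lambda>N. prob {\<omega> \<in> space M. \<exists>i<N. \<epsilon> * real N \<le> \<tau> (axis_edge i) \<omega>}) \<longlonglongrightarrow> 0"
proof -
  have ev: "{\<omega> \<in> space M. \<epsilon> * real N \<le> \<tau> (axis_edge i) \<omega>} \<in> events" for i N
    using rv[OF axis_edge_in_edges[OF d1, of i]] by measurable
  have "prob {\<omega> \<in> space M. \<exists>i<N. \<epsilon> * real N \<le> \<tau> (axis_edge i) \<omega>} \<le> real N * (a * exp (- b * (\<epsilon> * real N) powr r))" for N
  proof -
    have "{\<omega> \<in> space M. \<exists>i<N. \<epsilon> * real N \<le> \<tau> (axis_edge i) \<omega>} = (\<Union>i<N. {\<omega> \<in> space M. \<epsilon> * real N \<le> \<tau> (axis_edge i) \<omega>})"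
      by auto
    then have "prob {\<omega> \<in> space M. \<exists>i<N. \<epsilon> * real N \<le> \<tau> (axis_edge i) \<omega>}
       \<le> (\<Sum>i<N. prob {\<omega> \<in> space M. \<epsilon> * real N \<le> \<tau> (axis_edge i) \<omega>})"
      using ev by (simp add: finite_measure_subadditive_finite image_subset_iff)
    also have "\<dots> \<le> (\<Sum>i<N. a * exp (- b * (\<epsilon> * real N) powr r))"
      by (intro sum_mono tail axis_edge_in_edges d1) (use assms in auto)
    finally show ?thesis by simp
  qed
  moreover have "(\<lambda>N. real N * (a * exp (- b * (\<epsilon> * real N) powr r))) \<longlonglongrightarrow> 0"
    using a_pos b_pos assms r_pos by real_asymp
  ultimately show ?thesis by (rule squeeze_to_zero[OF measure_nonneg])
qed

text \<open>Clusters of radius more than a multiple of \<open>N\<close> are exponentially unlikely, hence absent from a box of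
  polynomial size. A path that leaves the box of radius of order \<open>N\<^sup>3\<close> therefore takes time at
  least \<open>\<epsilon> * N\<^sup>2\<close>, more than the straight path.\<close>

theorem optimal_paths_confined:
  "\<exists>c B. (\<forall>N. B N \<in> events) \<and> (\<lambda>N. prob (B N)) \<longlonglongrightarrow> 0 \<and>
    (\<forall>N\<ge>1. \<forall>\<omega>\<in>space M - B N. \<forall>\<gamma>\<in>optimal_paths d (\<lambda>e. \<tau> e \<omega>) origin (axis_point N).
       set \<gamma> \<subseteq> lbox d origin (c * N ^ 3))"
proof -
  obtain \<epsilon> \<rho> L where eps: "\<epsilon> > 0" and rho: "0 \<le> \<rho>" "\<rho> < 1"
    and ev: "\<And>x k. x \<in> lattice d \<Longrightarrow> {\<omega> \<in> space M. exits {e \<in> edges d. \<tau> e \<omega> \<le> \<epsilon>} (lbox d x (k * Suc L)) x} \<in> events"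
    and pr: "\<And>x k. x \<in> lattice d \<Longrightarrow> prob {\<omega> \<in> space M. exits {e \<in> edges d. \<tau> e \<omega> \<le> \<epsilon>} (lbox d x (k * Suc L)) x} \<le> \<rho> ^ k"
    using cheap_cluster_decay by blast
  \<comment> \<open>\<open>N\<^sup>2\<close> times the distance travelled per edge of weight more than \<open>\<epsilon>\<close>\<close>
  define m where "m N = N ^ 2 * Suc (N * Suc L)" for N
  define B1 where "B1 N = (\<Union>x\<in>lbox d origin (m N). {\<omega> \<in> space M. exits {e \<in> edges d. \<tau> e \<omega> \<le> \<epsilon>} (lbox d x (N * Suc L)) x})" for N
  define B2 where "B2 N = {\<omega> \<in> space M. \<exists>i<N. \<epsilon> * real N \<le> \<tau> (axis_edge i) \<omega>}" for N
  have B1ev: "B1 N \<in> events" for N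
    unfolding B1_def by (intro sets.finite_UN ev) (use lbox_sub_lattice in auto)
  have B2ev: "B2 N \<in> events" for N
  proof -
    have "B2 N = (\<Union>i<N. {\<omega> \<in> space M. \<epsilon> * real N \<le> \<tau> (axis_edge i) \<omega>})" by (auto simp: B2_def)
    also have "\<dots> \<in> events"
    proof (intro sets.finite_UN)
      fix i
      show "{\<omega> \<in> space M. \<epsilon> * real N \<le> \<tau> (axis_edge i) \<omega>} \<in> events"
        using rv[OF axis_edge_in_edges[OF d1, of i]] by measurable
    qed auto
    finally show ?thesis .
  qed
  have "prob (B1 N) \<le> real ((2 * m N + 1) ^ d) * \<rho> ^ N" for N
  proof -
    have "prob (B1 N) \<le> (\<Sum>x\<in>lbox d origin (m N). prob {\<omega> \<in> space M. exits {e \<in> edges d. \<tau> e \<omega> \<le> \<epsilon>} (lbox d x (N * Suc L)) x})"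
      unfolding B1_def
      by (rule finite_measure_subadditive_finite) (use ev[OF subsetD[OF lbox_sub_lattice]] in auto)
    also have "\<dots> \<le> (\<Sum>x\<in>lbox d origin (m N). \<rho> ^ N)"
      by (intro sum_mono pr) (use lbox_sub_lattice in auto)
    finally show ?thesis by (simp add: card_lbox)
  qed
  moreover have "(\<lambda>N. real ((2 * m N + 1) ^ d) * \<rho> ^ N) \<longlonglongrightarrow> 0"
  proof (cases "\<rho> = 0")
    case True
    then show ?thesis by (intro tendsto_eventually) (auto simp: eventually_sequentially intro!: exI[of _ 1])
  next
    case False
    then have "0 < \<rho>" using rho by simp
    have "(\<lambda>N. real ((2 * m N + 1) ^ d) * \<rho> ^ N) = (\<lambda>N. (2 * (real N ^ 2 * (1 + real N * (1 + real L))) + 1) ^ d * \<rho> ^ N)"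
      by (simp add: m_def fun_eq_iff algebra_simps)
    also have "\<dots> \<longlonglongrightarrow> 0"
      using \<open>0 < \<rho>\<close> \<open>\<rho> < 1\<close> by real_asymp
    finally show ?thesis .
  qed
  ultimately have lim1: "(\<lambda>N. prob (B1 N)) \<longlonglongrightarrow> 0"
    by (rule squeeze_to_zero[OF measure_nonneg])
  have lim2: "(\<lambda>N. prob (B2 N)) \<longlonglongrightarrow> 0" unfolding B2_def by (rule axis_edges_light[OF eps])
  have le: "prob (B1 N \<union> B2 N) \<le> prob (B1 N) + prob (B2 N)" for N
    by (rule measure_Un_le[OF B1ev B2ev])
  have lim: "(\<lambda>N. prob (B1 N \<union> B2 N)) \<longlonglongrightarrow> 0"
    by (rule squeeze_to_zero[OF measure_nonneg le]) (use tendsto_add[OF lim1 lim2] in simp)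
  have conf: "set \<gamma> \<subseteq> lbox d origin ((L + 2) * N ^ 3)"
    if N: "N \<ge> 1" and w: "\<omega> \<in> space M - (B1 N \<union> B2 N)"
      and g: "\<gamma> \<in> optimal_paths d (\<lambda>e. \<tau> e \<omega>) origin (axis_point N)" for N \<omega> \<gamma>
  proof -
    let ?t = "\<lambda>e. \<tau> e \<omega>"
    have t: "\<And>e. e \<in> edges d \<Longrightarrow> 0 \<le> ?t e" using nonneg w by auto
    obtain xs where xs: "xs \<in> paths d origin (axis_point N)" "path_time ?t xs = (\<Sum>i<N. ?t (axis_edge i))"
      using ex_axis_path[OF d1] by blast
    have "path_time ?t \<gamma> \<le> (\<Sum>i<N. ?t (axis_edge i))" using optimal_path_le[OF t g xs(1)] xs(2) by simp
    also have "\<dots> < (\<Sum>i<N. \<epsilon> * real N)"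
      by (rule sum_strict_mono) (use w N in \<open>auto simp: B2_def not_le lessThan_empty_iff\<close>)
    also have "\<dots> = real (N ^ 2) * \<epsilon>" by (simp add: power2_eq_square)
    finally have lt: "path_time ?t \<gamma> < real (N ^ 2) * \<epsilon>" .
    have "z \<in> lbox d origin (m N)" if z: "z \<in> set \<gamma>" for z
    proof (rule ccontr)
      assume "z \<notin> lbox d origin (m N)"
      then have "real (N ^ 2) * \<epsilon> \<le> path_time ?t \<gamma>"
        unfolding m_def
        by (intro path_time_visiting_outside[OF t refl _ _ z])
          (use w g in \<open>auto simp: B1_def m_def optimal_paths_def\<close>)
      then show False using lt by simp
    qed
    moreover have "m N \<le> (L + 2) * N ^ 3"
    proof -
      have "m N = N ^ 2 + (L + 1) * N ^ 3" by (simp add: m_def power2_eq_square power3_eq_cube algebra_simps)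
      also have "N ^ 2 \<le> N ^ 3" by (rule power_increasing) (use N in auto)
      finally show ?thesis by simp
    qed
    ultimately show ?thesis using lbox_mono by blast
  qed
  show ?thesis
    by (rule exI[of _ "L + 2"], rule exI[of _ "\<lambda>N. B1 N \<union> B2 N"])
      (use B1ev B2ev lim conf in auto)
qed

end

section \<open>Averaging over product boxes\<close>

text \<open>Lattice boxes with one set of admissible values per coordinate. The uniform distribution on such
  a box makes the coordinates independent, and this is all that is needed of random points.\<close>

definition pbox :: "nat \<Rightarrow> (nat \<Rightarrow> int set) \<Rightarrow> vertex set" where
  "pbox d A = PiE_dflt {..<d} 0 A"

definition proper_box :: "nat \<Rightarrow> (nat \<Rightarrow> int set) \<Rightarrow> bool" where
  "proper_box d A \<longleftrightarrow> (\<forall>i<d. finite (A i) \<and> A i \<noteq> {})"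

definition avg :: "nat \<Rightarrow> (vertex \<Rightarrow> real) \<Rightarrow> (nat \<Rightarrow> int set) \<Rightarrow> real" where
  "avg d g A = (\<Sum>z\<in>pbox d A. g z) / card (pbox d A)"

definition lines :: "nat \<Rightarrow> (nat \<Rightarrow> int set) \<Rightarrow> nat \<Rightarrow> int \<Rightarrow> int \<Rightarrow> edge set" where
  "lines d A k l h = (\<lambda>(y, c). {y(k := c), y(k := c + 1)}) ` (pbox d (A(k := {0})) \<times> {l..<h})"

definition line_weight :: "nat \<Rightarrow> (nat \<Rightarrow> int set) \<Rightarrow> nat \<Rightarrow> int \<Rightarrow> int \<Rightarrow> edge \<Rightarrow> real" where
  "line_weight d A k l h e = of_bool (e \<in> lines d A k l h) / card (pbox d (A(k := {0})))"

text \<open>Functions that are Lipschitz for the passage times of single edges, like the distance from a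
  fixed point.\<close>

definition slowly_varying :: "nat \<Rightarrow> (edge \<Rightarrow> real) \<Rightarrow> (vertex \<Rightarrow> real) \<Rightarrow> bool" where
  "slowly_varying d t g \<longleftrightarrow> (\<forall>x y. adjacent d x y \<longrightarrow> g y \<le> g x + t {x, y})"

lemma pbox_iff: "z \<in> pbox d A \<longleftrightarrow> (\<forall>i<d. z i \<in> A i) \<and> (\<forall>i\<ge>d. z i = 0)"
proof -
  have "z \<in> pbox d A \<longleftrightarrow> (\<forall>i. (i < d \<longrightarrow> z i \<in> A i) \<and> (\<not> i < d \<longrightarrow> z i = 0))"
    by (simp add: pbox_def PiE_dflt_def)
  then show ?thesis by (simp add: not_less) blast
qed

lemma pbox_sub_lattice: "z \<in> pbox d A \<Longrightarrow> z \<in> lattice d"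
  by (simp add: pbox_iff lattice_def)

lemma finite_pbox: "proper_box d A \<Longrightarrow> finite (pbox d A)"
  unfolding pbox_def by (rule finite_PiE_dflt) (auto simp: proper_box_def)

lemma card_pbox: "proper_box d A \<Longrightarrow> card (pbox d A) = (\<Prod>i<d. card (A i))"
  unfolding pbox_def by (rule card_PiE_dflt) (auto simp: proper_box_def)

lemma card_pbox_pos: "proper_box d A \<Longrightarrow> card (pbox d A) > 0"
  by (simp add: card_pbox) (auto simp: proper_box_def card_gt_0_iff intro!: prod_pos)

lemma pbox_mono: "(\<And>i. i < d \<Longrightarrow> A i \<subseteq> B i) \<Longrightarrow> pbox d A \<subseteq> pbox d B"
  by (auto simp: pbox_iff subset_iff)

lemma proper_box_upd: "proper_box d A \<Longrightarrow> finite B \<Longrightarrow> B \<noteq> {} \<Longrightarrow> proper_box d (A(k := B))"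
  by (simp add: proper_box_def)

lemma sum_pbox_upd:
  assumes k: "k < d"
  shows "(\<Sum>z\<in>pbox d (A(k := B)). f z) = (\<Sum>y\<in>pbox d (A(k := {0})). \<Sum>b\<in>B. f (y(k := b)))"
proof -
  have "(\<Sum>z\<in>pbox d (A(k := B)). f z) = (\<Sum>(y, b)\<in>pbox d (A(k := {0})) \<times> B. f (y(k := b)))"
  proof (rule sum.reindex_bij_witness[of _ "\<lambda>(y, b). y(k := b)" "\<lambda>z. (z(k := 0), z k)"])
    fix p assume p: "p \<in> pbox d (A(k := {0})) \<times> B"
    obtain y b where yb: "p = (y, b)" by (cases p)
    then have "y k = 0" using p k by (auto simp: pbox_iff dest: spec[of _ k])
    then have "y(k := 0) = y" by (simp add: fun_upd_idem)
    then show "((case p of (y, b) \<Rightarrow> y(k := b))(k := 0), (case p of (y, b) \<Rightarrow> y(k := b)) k) = p" using yb by simp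
    show "(case p of (y, b) \<Rightarrow> y(k := b)) \<in> pbox d (A(k := B))" using p yb k by (auto simp: pbox_iff)
  next
    fix z assume z: "z \<in> pbox d (A(k := B))"
    have "z k \<in> B" using z k by (auto simp: pbox_iff dest: spec[of _ k])
    moreover have "z(k := 0) \<in> pbox d (A(k := {0}))" using z k by (auto simp: pbox_iff)
    ultimately show "(z(k := 0), z k) \<in> pbox d (A(k := {0})) \<times> B" by simp
  qed auto
  then show ?thesis by (simp add: sum.cartesian_product)
qed

lemma card_pbox_upd:
  assumes k: "k < d" and "proper_box d A" "finite B" "B \<noteq> {}"
  shows "card (pbox d (A(k := B))) = card (pbox d (A(k := {0}))) * card B"
  using sum_pbox_upd[OF k, where f = "\<lambda>_. 1::nat" and A = A and B = B] by simp

lemma increments_along_interval: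
  fixes s :: "int \<Rightarrow> real"
  assumes T: "\<And>c. l \<le> c \<Longrightarrow> c < h \<Longrightarrow> \<bar>s (c + 1) - s c\<bar> \<le> T c"
    and ab: "a \<in> {l..h}" "b \<in> {l..h}"
  shows "s b \<le> s a + (\<Sum>c\<in>{l..<h}. T c)"
proof -
  have T0: "0 \<le> T c" if "l \<le> c" "c < h" for c using T[OF that] by linarith
  have main: "\<bar>s b - s a\<bar> \<le> (\<Sum>c\<in>{l..<h}. T c)" if a: "l \<le> a" and ab: "a \<le> b" and b: "b \<le> h" for a b
  proof -
    have "b \<le> h \<longrightarrow> \<bar>s b - s a\<bar> \<le> (\<Sum>c\<in>{a..<b}. T c)" using ab
    proof (induction b rule: int_ge_induct)
      case (step i)
      show ?case
      proof
        assume i: "i + 1 \<le> h"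
        have "{a..<i + 1} = insert i {a..<i}" using step(1) by auto
        then have "(\<Sum>c\<in>{a..<i + 1}. T c) = T i + (\<Sum>c\<in>{a..<i}. T c)" by simp
        moreover have "\<bar>s (i + 1) - s i\<bar> \<le> T i" by (rule T) (use step(1) a i in auto)
        moreover have "\<bar>s i - s a\<bar> \<le> (\<Sum>c\<in>{a..<i}. T c)" using step(2) i by simp
        ultimately show "\<bar>s (i + 1) - s a\<bar> \<le> (\<Sum>c\<in>{a..<i + 1}. T c)" by linarith
      qed
    qed simp
    moreover have "(\<Sum>c\<in>{a..<b}. T c) \<le> (\<Sum>c\<in>{l..<h}. T c)"
      by (rule sum_mono2) (use a b T0 in auto)
    ultimately show ?thesis using b by simp
  qed
  show ?thesis
  proof (cases "a \<le> b")
    case True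
    then show ?thesis using main[of a b] ab by auto
  next
    case False
    then show ?thesis using main[of b a] ab by auto
  qed
qed

lemma adjacent_fun_upd:
  assumes "y \<in> lattice d" "k < d"
  shows "adjacent d (y(k := c)) (y(k := c + 1))"
proof -
  have "(\<Sum>i<d. \<bar>(y(k := c)) i - (y(k := c + 1)) i\<bar>) = (\<Sum>i<d. if i = k then 1 else 0)"
    by (intro sum.cong) auto
  also have "\<dots> = 1" using assms by simp
  finally show ?thesis using assms by (auto simp: adjacent_def lattice_def)
qed

lemma mean_le_mean:
  fixes f g :: "'b \<Rightarrow> real"
  assumes "finite A" "A \<noteq> {}" "finite B" "B \<noteq> {}" "\<And>a b. a \<in> A \<Longrightarrow> b \<in> B \<Longrightarrow> g b \<le> f a + L"
  shows "(\<Sum>b\<in>B. g b) / card B \<le> (\<Sum>a\<in>A. f a) / card A + L"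
proof -
  have cA: "real (card A) > 0" and cB: "real (card B) > 0" using assms by (auto simp: card_gt_0_iff)
  have gb: "g b \<le> (\<Sum>a\<in>A. f a) / card A + L" if b: "b \<in> B" for b
  proof -
    have "real (card A) * (g b - L) = (\<Sum>a\<in>A. g b - L)" by simp
    also have "\<dots> \<le> (\<Sum>a\<in>A. f a)" by (rule sum_mono) (use assms(5)[OF _ b] in \<open>simp add: diff_le_eq\<close>)
    finally have "g b - L \<le> (\<Sum>a\<in>A. f a) / card A" using cA by (simp add: pos_le_divide_eq mult.commute)
    then show ?thesis by simp
  qed
  have "(\<Sum>b\<in>B. g b) \<le> real (card B) * ((\<Sum>a\<in>A. f a) / card A + L)"
    using sum_mono[of B g "\<lambda>_. (\<Sum>a\<in>A. f a) / card A + L"] gb by simp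
  then show ?thesis using cB by (simp add: pos_divide_le_eq mult.commute)
qed

lemma lines_inj:
  assumes k: "k < d"
  shows "inj_on (\<lambda>(y, c). {y(k := c), y(k := c + 1)}) (pbox d (A(k := {0})) \<times> {l..<h})"
proof (rule inj_onI)
  fix p q assume p: "p \<in> pbox d (A(k := {0})) \<times> {l..<h}" and q: "q \<in> pbox d (A(k := {0})) \<times> {l..<h}"
    and eq: "(case p of (y, c) \<Rightarrow> {y(k := c), y(k := c + 1)}) = (case q of (y, c) \<Rightarrow> {y(k := c), y(k := c + 1)})"
  obtain y c y' c' where yc: "p = (y, c)" "q = (y', c')" by (cases p, cases q)
  have y0: "y k = 0" "y' k = 0" using p q yc k by (auto simp: pbox_iff dest: spec[of _ k])
  have *: "{y(k := c), y(k := c + 1)} = {y'(k := c'), y'(k := c' + 1)}" using eq yc by simp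
  have ck: "c = c'"
  proof -
    have "(\<lambda>z. z k) ` {y(k := c), y(k := c + 1)} = (\<lambda>z. z k) ` {y'(k := c'), y'(k := c' + 1)}" using * by simp
    then have "{c, c + 1} = {c', c' + 1}" by simp
    then show ?thesis by (auto simp: doubleton_eq_iff)
  qed
  have "(\<lambda>z. z(k := 0)) ` {y(k := c), y(k := c + 1)} = (\<lambda>z. z(k := 0)) ` {y'(k := c'), y'(k := c' + 1)}" using * by simp
  then have "y(k := 0) = y'(k := 0)" by simp
  then have "y = y'" using y0 by (metis fun_upd_triv)
  then show "p = q" using yc ck by simp
qed

lemma lines_subset_inner_edges:
  assumes k: "k < d" and S: "pbox d (A(k := {l..h})) \<subseteq> S"
  shows "lines d A k l h \<subseteq> inner_edges d S"
proof
  fix e assume "e \<in> lines d A k l h"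
  then obtain y c where yc: "y \<in> pbox d (A(k := {0}))" "l \<le> c" "c < h" and e: "e = {y(k := c), y(k := c + 1)}"
    by (auto simp: lines_def)
  have "y(k := c) \<in> pbox d (A(k := {l..h}))" "y(k := c + 1) \<in> pbox d (A(k := {l..h}))"
    using yc k by (auto simp: pbox_iff)
  then have "e \<subseteq> S" using S e by auto
  moreover have "e \<in> edges d" unfolding e edge_iff_adjacent
    by (rule adjacent_fun_upd[OF pbox_sub_lattice[OF yc(1)] k])
  ultimately show "e \<in> inner_edges d S" by (simp add: inner_edges_def)
qed

text \<open>Re-randomising one coordinate of a uniform point of a product box moves it along a line in that
  coordinate direction. The remaining coordinates are uniform, which spreads the cost evenly over
  all parallel lines.\<close>

lemma avg_move:
  assumes k: "k < d" and A: "proper_box d A" and B: "finite B" "B \<noteq> {}"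
    and AB: "A k \<subseteq> {l..h}" "B \<subseteq> {l..h}" and g: "slowly_varying d t g"
  shows "avg d g (A(k := B)) \<le> avg d g A + (\<Sum>e\<in>lines d A k l h. line_weight d A k l h e * t e)"
proof -
  let ?Y = "pbox d (A(k := {0}))"
  define L where "L y = (\<Sum>c\<in>{l..<h}. t {y(k := c), y(k := c + 1)})" for y
  have Ak: "finite (A k)" "A k \<noteq> {}" using A k by (auto simp: proper_box_def)
  have avg_eq: "avg d g (A(k := X)) = (\<Sum>y\<in>?Y. (\<Sum>b\<in>X. g (y(k := b))) / card X) / card ?Y"
    if "finite X" "X \<noteq> {}" for X
    unfolding avg_def sum_pbox_upd[OF k, where B = X] card_pbox_upd[OF k A that]
    by (simp add: sum_divide_distrib mult.commute)
  have step: "(\<Sum>b\<in>B. g (y(k := b))) / card B \<le> (\<Sum>a\<in>A k. g (y(k := a))) / card (A k) + L y" if y: "y \<in> ?Y" for y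
  proof (rule mean_le_mean[OF Ak B])
    fix a b assume "a \<in> A k" "b \<in> B"
    then have ab: "a \<in> {l..h}" "b \<in> {l..h}" using AB by auto
    show "g (y(k := b)) \<le> g (y(k := a)) + L y"
      unfolding L_def
    proof (rule increments_along_interval[OF _ ab, where s = "\<lambda>c. g (y(k := c))"])
      fix c
      have adj: "adjacent d (y(k := c)) (y(k := c + 1))" by (rule adjacent_fun_upd[OF pbox_sub_lattice[OF y] k])
      have "g (y(k := c + 1)) \<le> g (y(k := c)) + t {y(k := c), y(k := c + 1)}"
        "g (y(k := c)) \<le> g (y(k := c + 1)) + t {y(k := c + 1), y(k := c)}"
        using g adj adjacent_sym[OF adj] by (auto simp: slowly_varying_def)
      then show "\<bar>g (y(k := c + 1)) - g (y(k := c))\<bar> \<le> t {y(k := c), y(k := c + 1)}"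
        by (simp add: insert_commute)
    qed
  qed
  have "avg d g (A(k := B)) \<le> (\<Sum>y\<in>?Y. (\<Sum>a\<in>A k. g (y(k := a))) / card (A k) + L y) / card ?Y"
    unfolding avg_eq[OF B] by (rule divide_right_mono[OF sum_mono]) (use step in auto)
  also have "\<dots> = avg d g (A(k := A k)) + (\<Sum>y\<in>?Y. L y) / card ?Y"
    unfolding avg_eq[OF Ak] by (simp add: sum.distrib add_divide_distrib)
  also have "(\<Sum>y\<in>?Y. L y) = (\<Sum>e\<in>lines d A k l h. t e)"
    unfolding lines_def sum.reindex[OF lines_inj[OF k]] L_def
    by (simp add: sum.cartesian_product case_prod_unfold)
  also have "(\<Sum>e\<in>lines d A k l h. t e) / card ?Y = (\<Sum>e\<in>lines d A k l h. line_weight d A k l h e * t e)"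
    by (simp add: line_weight_def sum_divide_distrib)
  finally show ?thesis unfolding fun_upd_triv .
qed

text \<open>A transport from \<open>A\<close> to \<open>B\<close> stands for a random path inside \<open>S\<close> from a uniform point of \<open>A\<close> to a uniform
  point of \<open>B\<close>, with \<open>w e\<close> the expected number of passages through \<open>e\<close>. Only the resulting inequality for
  slowly varying functions is recorded, so no paths have to be constructed.\<close>

definition transport :: "nat \<Rightarrow> vertex set \<Rightarrow> (nat \<Rightarrow> int set) \<Rightarrow> (nat \<Rightarrow> int set) \<Rightarrow> (edge \<Rightarrow> real) \<Rightarrow> bool" where
  "transport d S A B w \<longleftrightarrow> (\<forall>e. 0 \<le> w e) \<and>
     (\<forall>t g. slowly_varying d t g \<longrightarrow>
       avg d g B \<le> avg d g A + (\<Sum>e\<in>inner_edges d S. w e * t e))"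

lemma transport_refl: "transport d S A A (\<lambda>_. 0)"
  by (simp add: transport_def)

lemma transport_trans:
  assumes "transport d S A B w" "transport d S B C w'"
  shows "transport d S A C (\<lambda>e. w e + w' e)"
  unfolding transport_def
proof (intro conjI allI impI)
  fix t g assume g: "slowly_varying d t g"
  have "avg d g C \<le> avg d g B + (\<Sum>e\<in>inner_edges d S. w' e * t e)"
    "avg d g B \<le> avg d g A + (\<Sum>e\<in>inner_edges d S. w e * t e)"
    using assms g by (auto simp: transport_def)
  then show "avg d g C \<le> avg d g A + (\<Sum>e\<in>inner_edges d S. (w e + w' e) * t e)"
    by (simp add: distrib_right sum.distrib)
qed (use assms in \<open>auto simp: transport_def add_nonneg_nonneg\<close>)

lemma transport_move:
  assumes k: "k < d" and A: "proper_box d A" and B: "finite B" "B \<noteq> {}"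
    and AB: "A k \<subseteq> {l..h}" "B \<subseteq> {l..h}" and S: "finite S" "pbox d (A(k := {l..h})) \<subseteq> S"
    and n: "l < h \<Longrightarrow> n \<le> card (pbox d (A(k := {0})))" "n > 0" and m: "real_of_int (h - l) \<le> m"
  shows "\<exists>w. transport d S A (A(k := B)) w \<and> (\<forall>e. w e \<le> 1 / real n) \<and> (\<Sum>e\<in>inner_edges d S. w e) \<le> m"
proof -
  let ?w = "line_weight d A k l h"
  have Y: "proper_box d (A(k := {0}))" using A by (rule proper_box_upd) auto
  have cY: "card (pbox d (A(k := {0}))) > 0" by (rule card_pbox_pos[OF Y])
  have lh: "l \<le> h" using AB B by force
  have sub: "lines d A k l h \<subseteq> inner_edges d S" by (rule lines_subset_inner_edges[OF k S(2)])
  have fin: "finite (inner_edges d S)" using S(1) by auto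
  have sum_w: "(\<Sum>e\<in>inner_edges d S. ?w e * f e) = (\<Sum>e\<in>lines d A k l h. ?w e * f e)" for f
    by (rule sum.mono_neutral_right[OF fin sub]) (simp add: line_weight_def)
  have "transport d S A (A(k := B)) ?w"
    unfolding transport_def sum_w
    using avg_move[OF k A B AB] by (auto simp: line_weight_def)
  moreover have "?w e \<le> 1 / real n" for e
  proof (cases "e \<in> lines d A k l h")
    case True
    then have "l < h" by (auto simp: lines_def)
    then have "n \<le> card (pbox d (A(k := {0})))" by (rule n)
    then show ?thesis using n(2) by (simp add: line_weight_def frac_le)
  qed (simp add: line_weight_def)
  moreover have "(\<Sum>e\<in>inner_edges d S. ?w e) \<le> m"
  proof -
    have "card (lines d A k l h) = card (pbox d (A(k := {0}))) * nat (h - l)"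
      unfolding lines_def card_image[OF lines_inj[OF k]] by (simp add: card_cartesian_product)
    then have "(\<Sum>e\<in>lines d A k l h. ?w e) = real (nat (h - l))"
      using cY by (simp add: line_weight_def)
    then show ?thesis using sum_w[of "\<lambda>_. 1"] m lh by simp
  qed
  ultimately show ?thesis by blast
qed

text \<open>The number of parallel lines over which a move in direction \<open>k\<close> is spread. Two coordinates do not
  contribute: the direction itself and the coordinate \<open>a\<close> that is fixed on a face of the sphere.\<close>

lemma card_pbox_remove_two:
  assumes A: "proper_box d A" and ak: "a < d" "k < d" "a \<noteq> k"
    and n: "\<And>i. i < d \<Longrightarrow> i \<noteq> a \<Longrightarrow> i \<noteq> k \<Longrightarrow> n \<le> card (A i)"
  shows "n ^ (d - 2) \<le> card (pbox d (A(k := {0})))"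
proof -
  have Y: "proper_box d (A(k := {0}))" using A by (rule proper_box_upd) auto
  have pos: "card (A i) > 0" if "i < d" for i using A that by (auto simp: proper_box_def card_gt_0_iff)
  have "n ^ (d - 2) = (\<Prod>i\<in>{..<d} - {a, k}. n)" using ak by (simp add: card_Diff_subset numeral_2_eq_2)
  also have "\<dots> \<le> (\<Prod>i\<in>{..<d} - {a, k}. card ((A(k := {0})) i))"
    by (rule prod_mono) (use n in auto)
  also have "\<dots> \<le> (\<Prod>i\<in>{..<d} - {a, k}. card ((A(k := {0})) i)) * (\<Prod>i\<in>{a, k}. card ((A(k := {0})) i))"
    using ak pos[of a] by simp
  also have "\<dots> = (\<Prod>i<d. card ((A(k := {0})) i))"
    by (rule prod.subset_diff[symmetric]) (use ak in auto)
  also have "\<dots> = card (pbox d (A(k := {0})))" by (rule card_pbox[OF Y, symmetric])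
  finally show ?thesis .
qed

text \<open>All coordinates are re-randomised in turn. Coordinate \<open>a\<close> is fixed throughout: in the application
  both boxes lie in a face of the sphere on which this coordinate is extreme.\<close>

lemma transport_sweep:
  assumes a: "a < d" and A: "proper_box d A" and B: "proper_box d B" and S: "finite S"
    and la: "h a = l a" and n: "n > 0"
    and sub: "\<And>i. i < d \<Longrightarrow> A i \<subseteq> {l i..h i}" "\<And>i. i < d \<Longrightarrow> B i \<subseteq> {l i..h i}"
    and card: "\<And>i. i < d \<Longrightarrow> i \<noteq> a \<Longrightarrow> n \<le> card (A i)" "\<And>i. i < d \<Longrightarrow> i \<noteq> a \<Longrightarrow> n \<le> card (B i)"
    and box: "pbox d (\<lambda>i. {l i..h i}) \<subseteq> S" and m: "\<And>i. i < d \<Longrightarrow> real_of_int (h i - l i) \<le> m"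
  shows "\<exists>w. transport d S A B w \<and> (\<forall>e. w e \<le> real d / real (n ^ (d - 2))) \<and>
     (\<Sum>e\<in>inner_edges d S. w e) \<le> real d * m"
proof -
  \<comment> \<open>the box after the first \<open>j\<close> coordinates have been re-randomised\<close>
  define X where "X j = (\<lambda>i. if i < j then B i else A i)" for j
  have "\<exists>w. transport d S A (X j) w \<and> (\<forall>e. w e \<le> real j / real (n ^ (d - 2))) \<and>
     (\<Sum>e\<in>inner_edges d S. w e) \<le> real j * m" if "j \<le> d" for j
    using that
  proof (induction j)
    case 0
    have "X 0 = A" by (auto simp: X_def)
    then show ?case using transport_refl[of d S A] by (intro exI[of _ "\<lambda>_. 0"]) auto
  next
    case (Suc j)
    then obtain w where w: "transport d S A (X j) w" "\<And>e. w e \<le> real j / real (n ^ (d - 2))"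
      "(\<Sum>e\<in>inner_edges d S. w e) \<le> real j * m" by auto
    have j: "j < d" using Suc.prems by simp
    have pX: "proper_box d (X j)" using A B by (auto simp: proper_box_def X_def)
    have up: "X (Suc j) = (X j)(j := B j)" by (rule ext) (auto simp: X_def less_Suc_eq)
    have "\<exists>w'. transport d S (X j) ((X j)(j := B j)) w' \<and> (\<forall>e. w' e \<le> 1 / real (n ^ (d - 2))) \<and>
        (\<Sum>e\<in>inner_edges d S. w' e) \<le> m"
    proof (rule transport_move[OF j pX, where l = "l j" and h = "h j"])
      show "finite (B j)" "B j \<noteq> {}" using B j by (auto simp: proper_box_def)
      show "X j j \<subseteq> {l j..h j}" "B j \<subseteq> {l j..h j}" using sub j by (auto simp: X_def)
      show "pbox d ((X j)(j := {l j..h j})) \<subseteq> S"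
        by (rule subset_trans[OF pbox_mono box]) (use sub in \<open>auto simp: X_def\<close>)
      assume "l j < h j"
      then have "j \<noteq> a" using la by auto
      then show "n ^ (d - 2) \<le> card (pbox d ((X j)(j := {0})))"
        by (intro card_pbox_remove_two[OF pX a j]) (use card in \<open>auto simp: X_def\<close>)
    qed (use S n m j in auto)
    then obtain w' where w': "transport d S (X j) (X (Suc j)) w'" "\<And>e. w' e \<le> 1 / real (n ^ (d - 2))"
        "(\<Sum>e\<in>inner_edges d S. w' e) \<le> m" unfolding up by auto
    show ?case
    proof (intro exI conjI allI)
      show "transport d S A (X (Suc j)) (\<lambda>e. w e + w' e)" by (rule transport_trans[OF w(1) w'(1)])
      show "w e + w' e \<le> real (Suc j) / real (n ^ (d - 2))" for e
        using w(2)[of e] w'(2)[of e] by (simp add: add_divide_distrib)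
      show "(\<Sum>e\<in>inner_edges d S. w e + w' e) \<le> real (Suc j) * m"
        using w(3) w'(3) by (simp add: sum.distrib algebra_simps)
    qed
  qed
  from this[of d] obtain w where w: "transport d S A (X d) w" "\<forall>e. w e \<le> real d / real (n ^ (d - 2))"
    "(\<Sum>e\<in>inner_edges d S. w e) \<le> real d * m" by auto
  have "pbox d (X d) = pbox d B" by (auto simp: pbox_iff X_def)
  then have "transport d S A B w" using w(1) by (simp add: transport_def avg_def)
  then show ?thesis using w by blast
qed

section \<open>Spreading flows on spheres of the supremum norm\<close>

text \<open>For \<open>j = 0\<close> the difference is empty, as \<open>j - 1\<close> is truncated; only positive radii occur.\<close>

definition sphere_at :: "nat \<Rightarrow> vertex \<Rightarrow> nat \<Rightarrow> vertex set" where
  "sphere_at d x j = lbox d x j - lbox d x (j - 1)"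

definition full_box :: "vertex \<Rightarrow> nat \<Rightarrow> nat \<Rightarrow> int set" where
  "full_box x j i = {x i - int j..x i + int j}"

definition face :: "vertex \<Rightarrow> nat \<Rightarrow> nat \<Rightarrow> int \<Rightarrow> nat \<Rightarrow> int set" where
  "face x j a s = (full_box x j)(a := {s})"

text \<open>All points of a sphere are sent to the uniform distribution on one and the same face, which then
  connects any two of them.\<close>

abbreviation target_face :: "vertex \<Rightarrow> nat \<Rightarrow> nat \<Rightarrow> int set" where
  "target_face x j \<equiv> face x j 0 (x 0 + int j)"

abbreviation point_box :: "vertex \<Rightarrow> nat \<Rightarrow> int set" where
  "point_box u \<equiv> (\<lambda>i. {u i})"

lemma finite_sphere_at [simp, intro]: "finite (sphere_at d x j)"
  by (simp add: sphere_at_def)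

lemma card_sphere_at: "card (sphere_at d x j) \<le> (2 * j + 1) ^ d"
  unfolding sphere_at_def card_lbox[symmetric, of j d x] by (rule card_mono) auto

lemma sphere_atE:
  assumes "u \<in> sphere_at d x j" "j \<ge> 1"
  obtains a where "a < d" "\<bar>u a - x a\<bar> = int j" "\<And>i. i < d \<Longrightarrow> \<bar>u i - x i\<bar> \<le> int j" "u \<in> lattice d"
proof -
  have u: "u \<in> lattice d" "\<And>i. i < d \<Longrightarrow> \<bar>u i - x i\<bar> \<le> int j" and "u \<notin> lbox d x (j - 1)"
    using assms by (auto simp: sphere_at_def lbox_def)
  then obtain a where "a < d" "\<not> \<bar>u a - x a\<bar> \<le> int (j - 1)" by (auto simp: lbox_def)
  moreover from this u(2)[of a] assms(2) have "\<bar>u a - x a\<bar> = int j" by simp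
  ultimately show ?thesis using that u by blast
qed

lemma pbox_subset_sphere:
  assumes "a < d" "j \<ge> 1" "\<bar>s - x a\<bar> = int j" "A a \<subseteq> {s}"
    and "\<And>i. i < d \<Longrightarrow> i \<noteq> a \<Longrightarrow> A i \<subseteq> full_box x j i"
  shows "pbox d A \<subseteq> sphere_at d x j"
proof
  fix z assume z: "z \<in> pbox d A"
  then have za: "z a = s" using assms by (auto simp: pbox_iff)
  have "\<bar>z i - x i\<bar> \<le> int j" if "i < d" for i
  proof (cases "i = a")
    case False
    then have "z i \<in> full_box x j i" using z assms(5)[OF that] that by (auto simp: pbox_iff)
    then show ?thesis by (auto simp: full_box_def)
  qed (use za assms in auto)
  moreover have "z \<in> lattice d" by (rule pbox_sub_lattice[OF z])
  moreover have "\<not> \<bar>z a - x a\<bar> \<le> int (j - 1)" using za assms by simp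
  ultimately show "z \<in> sphere_at d x j" using assms(1) by (auto simp: sphere_at_def lbox_def)
qed

lemma card_full_box: "card (full_box x j i) = 2 * j + 1"
  by (simp add: full_box_def nat_add_distrib nat_mult_distrib)

lemma proper_full_box: "proper_box d (full_box x j)"
  by (simp add: proper_box_def full_box_def)

lemma proper_face: "proper_box d (face x j a s)"
  unfolding face_def by (rule proper_box_upd[OF proper_full_box]) auto

text \<open>Between adjacent faces: first move coordinate \<open>b\<close> to its extreme value \<open>s'\<close>, which reaches the common
  ridge, then release coordinate \<open>a\<close>. In both moves the \<open>d - 2\<close> other coordinates are uniform on full
  intervals.\<close>

lemma transport_face_switch:
  assumes ab: "a < d" "b < d" "a \<noteq> b" and j: "j \<ge> 1"
    and s: "\<bar>s - x a\<bar> = int j" "\<bar>s' - x b\<bar> = int j"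
  shows "\<exists>w. transport d (sphere_at d x j) (face x j a s) (face x j b s') w \<and>
    (\<forall>e. w e \<le> 2 / real ((2 * j + 1) ^ (d - 2))) \<and>
    (\<Sum>e\<in>inner_edges d (sphere_at d x j). w e) \<le> 4 * real j"
proof -
  let ?S = "sphere_at d x j"
  have sin: "s \<in> full_box x j a" "s' \<in> full_box x j b" using s by (auto simp: full_box_def abs_if split: if_splits)
  let ?A2 = "(face x j a s)(b := {s'})"
  have pA2: "proper_box d ?A2" by (rule proper_box_upd[OF proper_face]) auto
  have "\<exists>w. transport d ?S (face x j a s) ?A2 w \<and>
     (\<forall>e. w e \<le> 1 / real ((2 * j + 1) ^ (d - 2))) \<and> (\<Sum>e\<in>inner_edges d ?S. w e) \<le> 2 * real j"
  proof (rule transport_move[OF ab(2) proper_face, where l = "x b - int j" and h = "x b + int j"])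
    show "face x j a s b \<subseteq> {x b - int j..x b + int j}" using ab by (simp add: face_def full_box_def)
    show "{s'} \<subseteq> {x b - int j..x b + int j}" using sin by (simp add: full_box_def)
    show "pbox d ((face x j a s)(b := {x b - int j..x b + int j})) \<subseteq> ?S"
      by (rule pbox_subset_sphere[where x = x, OF ab(1) j s(1)]) (use ab in \<open>auto simp: face_def full_box_def\<close>)
    show "(2 * j + 1) ^ (d - 2) \<le> card (pbox d ((face x j a s)(b := {0})))"
      by (rule card_pbox_remove_two[OF proper_face ab(1,2,3)]) (simp add: face_def card_full_box)
  qed auto
  then obtain w where w: "transport d ?S (face x j a s) ?A2 w"
    "\<And>e. w e \<le> 1 / real ((2 * j + 1) ^ (d - 2))" "(\<Sum>e\<in>inner_edges d ?S. w e) \<le> 2 * real j" by auto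
  have up: "?A2(a := full_box x j a) = face x j b s'" by (rule ext) (use ab in \<open>auto simp: face_def\<close>)
  have "\<exists>w. transport d ?S ?A2 (?A2(a := full_box x j a)) w \<and>
     (\<forall>e. w e \<le> 1 / real ((2 * j + 1) ^ (d - 2))) \<and> (\<Sum>e\<in>inner_edges d ?S. w e) \<le> 2 * real j"
  proof (rule transport_move[OF ab(1) pA2, where l = "x a - int j" and h = "x a + int j"])
    show "?A2 a \<subseteq> {x a - int j..x a + int j}" using ab sin by (simp add: face_def full_box_def)
    show "full_box x j a \<subseteq> {x a - int j..x a + int j}" by (simp add: full_box_def)
    show "pbox d (?A2(a := {x a - int j..x a + int j})) \<subseteq> ?S"
      by (rule pbox_subset_sphere[where x = x, OF ab(2) j s(2)]) (use ab in \<open>auto simp: face_def full_box_def\<close>)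
    show "(2 * j + 1) ^ (d - 2) \<le> card (pbox d (?A2(a := {0})))"
      by (rule card_pbox_remove_two[OF pA2 ab(2,1)]) (use ab in \<open>auto simp: face_def card_full_box\<close>)
  qed (auto simp: full_box_def)
  then obtain w' where w': "transport d ?S ?A2 (face x j b s') w'"
    "\<And>e. w' e \<le> 1 / real ((2 * j + 1) ^ (d - 2))" "(\<Sum>e\<in>inner_edges d ?S. w' e) \<le> 2 * real j" unfolding up by auto
  show ?thesis
  proof (intro exI conjI allI)
    show "transport d ?S (face x j a s) (face x j b s') (\<lambda>e. w e + w' e)" by (rule transport_trans[OF w(1) w'(1)])
    show "w e + w' e \<le> 2 / real ((2 * j + 1) ^ (d - 2))" for e using w(2)[of e] w'(2)[of e] by simp
    show "(\<Sum>e\<in>inner_edges d ?S. w e + w' e) \<le> 4 * real j" using w(3) w'(3) by (simp add: sum.distrib)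
  qed
qed

text \<open>The opposite face is reached through a face of direction \<open>1\<close>, which exists as \<open>d \<ge> 2\<close>.\<close>

lemma transport_to_target_face:
  assumes d: "d \<ge> 2" and a: "a < d" and j: "j \<ge> 1" and s: "\<bar>s - x a\<bar> = int j"
  shows "\<exists>w. transport d (sphere_at d x j) (face x j a s) (target_face x j) w \<and>
    (\<forall>e. w e \<le> 4 / real ((2 * j + 1) ^ (d - 2))) \<and>
    (\<Sum>e\<in>inner_edges d (sphere_at d x j). w e) \<le> 8 * real j"
proof -
  let ?S = "sphere_at d x j" and ?n = "real ((2 * j + 1) ^ (d - 2))"
  have le: "2 / ?n \<le> 4 / ?n" by (simp add: divide_right_mono)
  consider "a \<noteq> 0" | "a = 0" "s = x 0 + int j" | "a = 0" "s = x 0 - int j"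
    using s by (cases "a = 0") (auto simp: abs_if split: if_splits)
  then show ?thesis
  proof cases
    case 1
    obtain w where w: "transport d ?S (face x j a s) (target_face x j) w" "\<And>e. w e \<le> 2 / ?n"
      "(\<Sum>e\<in>inner_edges d ?S. w e) \<le> 4 * real j"
      using transport_face_switch[of a d 0 j s x "x 0 + int j"] 1 a j s d by auto
    show ?thesis by (rule exI[of _ w]) (use w order_trans[OF w(2) le] in auto)
  next
    case 2
    show ?thesis using transport_refl[of d ?S "target_face x j"] 2
      by (intro exI[of _ "\<lambda>_. 0"]) auto
  next
    case 3
    obtain w where w: "transport d ?S (face x j a s) (face x j 1 (x 1 + int j)) w" "\<And>e. w e \<le> 2 / ?n"
      "(\<Sum>e\<in>inner_edges d ?S. w e) \<le> 4 * real j"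
      using transport_face_switch[of a d 1 j s x "x 1 + int j"] a d 3 j s by auto
    obtain w' where w': "transport d ?S (face x j 1 (x 1 + int j)) (target_face x j) w'" "\<And>e. w' e \<le> 2 / ?n"
      "(\<Sum>e\<in>inner_edges d ?S. w' e) \<le> 4 * real j"
      using transport_face_switch[of 1 d 0 j "x 1 + int j" x "x 0 + int j"] d j by auto
    show ?thesis
    proof (intro exI conjI allI)
      show "transport d ?S (face x j a s) (target_face x j) (\<lambda>e. w e + w' e)" by (rule transport_trans[OF w(1) w'(1)])
      show "w e + w' e \<le> 4 / ?n" for e using w(2)[of e] w'(2)[of e] by simp
      show "(\<Sum>e\<in>inner_edges d ?S. w e + w' e) \<le> 8 * real j" using w(3) w'(3) by (simp add: sum.distrib)
    qed
  qed
qed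

text \<open>Spread over the whole face first. The density of the flow is governed by the side \<open>n\<close> of the
  box where it starts.\<close>

lemma transport_from_small_box:
  assumes d: "d \<ge> 2" and a: "a < d" and j: "j \<ge> 1" and s: "\<bar>s - x a\<bar> = int j"
    and A: "proper_box d A" "A a = {s}" "\<And>i. i < d \<Longrightarrow> A i \<subseteq> full_box x j i"
    and n: "n > 0" "n \<le> 2 * j + 1" "\<And>i. i < d \<Longrightarrow> i \<noteq> a \<Longrightarrow> n \<le> card (A i)"
  shows "\<exists>w. transport d (sphere_at d x j) A (target_face x j) w \<and>
    (\<forall>e. w e \<le> real (d + 4) / real (n ^ (d - 2))) \<and>
    (\<Sum>e\<in>inner_edges d (sphere_at d x j). w e) \<le> real (2 * d + 8) * real j"
proof -
  let ?S = "sphere_at d x j"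
  define l where "l = (\<lambda>i. if i = a then s else x i - int j)"
  define h where "h = (\<lambda>i. if i = a then s else x i + int j)"
  have "\<exists>w. transport d ?S A (face x j a s) w \<and> (\<forall>e. w e \<le> real d / real (n ^ (d - 2))) \<and>
     (\<Sum>e\<in>inner_edges d ?S. w e) \<le> real d * (2 * real j)"
  proof (rule transport_sweep[OF a A(1) proper_face, where l = l and h = h])
    show "pbox d (\<lambda>i. {l i..h i}) \<subseteq> ?S"
      by (rule pbox_subset_sphere[where x = x, OF a j s]) (auto simp: l_def h_def full_box_def)
    show "A i \<subseteq> {l i..h i}" if "i < d" for i using A(2) A(3)[OF that] by (auto simp: l_def h_def full_box_def)
    show "face x j a s i \<subseteq> {l i..h i}" if "i < d" for i by (auto simp: l_def h_def full_box_def face_def)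
    show "n \<le> card (face x j a s i)" if "i < d" "i \<noteq> a" for i using that n(2) by (simp add: face_def card_full_box)
    show "real_of_int (h i - l i) \<le> 2 * real j" for i by (simp add: l_def h_def)
  qed (use n in \<open>auto simp: l_def h_def\<close>)
  then obtain w where w: "transport d ?S A (face x j a s) w" "\<And>e. w e \<le> real d / real (n ^ (d - 2))"
    "(\<Sum>e\<in>inner_edges d ?S. w e) \<le> real d * (2 * real j)" by auto
  obtain w' where w': "transport d ?S (face x j a s) (target_face x j) w'"
    "\<And>e. w' e \<le> 4 / real ((2 * j + 1) ^ (d - 2))" "(\<Sum>e\<in>inner_edges d ?S. w' e) \<le> 8 * real j"
    using transport_to_target_face[where x = x, OF d a j s] by auto
  have le: "4 / real ((2 * j + 1) ^ (d - 2)) \<le> 4 / real (n ^ (d - 2))"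
    by (intro divide_left_mono) (use n in \<open>auto intro!: mult_pos_pos zero_less_power power_mono simp flip: of_nat_power of_nat_Suc of_nat_mult of_nat_add\<close>)
  show ?thesis
  proof (intro exI conjI allI)
    show "transport d ?S A (target_face x j) (\<lambda>e. w e + w' e)" by (rule transport_trans[OF w(1) w'(1)])
    show "w e + w' e \<le> real (d + 4) / real (n ^ (d - 2))" for e
      using w(2)[of e] order_trans[OF w'(2)[of e] le] by (simp add: add_divide_distrib)
    show "(\<Sum>e\<in>inner_edges d ?S. w e + w' e) \<le> real (2 * d + 8) * real j"
      using w(3) w'(3) by (simp add: sum.distrib algebra_simps)
  qed
qed

lemma proper_point_box: "proper_box d (point_box u)"
  by (simp add: proper_box_def)

lemma avg_point_box:
  assumes "u \<in> lattice d" shows "avg d g (point_box u) = g u"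
proof -
  have "pbox d (point_box u) = {u}"
  proof (intro set_eqI iffI)
    fix z assume z: "z \<in> pbox d (point_box u)"
    have "z i = u i" for i
      using z assms by (cases "i < d") (auto simp: pbox_iff lattice_def)
    then show "z \<in> {u}" by auto
  qed (use assms in \<open>auto simp: pbox_iff lattice_def\<close>)
  then show ?thesis by (simp add: avg_def)
qed

text \<open>Starting from a single point, the crudest choice: a bounded number of passages per edge.\<close>

lemma bounded_transport:
  assumes d: "d \<ge> 2" and j: "j \<ge> 1" and u: "u \<in> sphere_at d x j"
  shows "\<exists>w. transport d (sphere_at d x j) (point_box u) (target_face x j) w \<and>
    (\<forall>e. w e \<le> real (d + 4)) \<and> (\<Sum>e\<in>inner_edges d (sphere_at d x j). w e) \<le> real (2 * d + 8) * real j"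
proof -
  obtain a where a: "a < d" "\<bar>u a - x a\<bar> = int j" and ui: "\<And>i. i < d \<Longrightarrow> \<bar>u i - x i\<bar> \<le> int j"
    using sphere_atE[OF u j] by blast
  have "point_box u i \<subseteq> full_box x j i" if "i < d" for i
    using ui[OF that] by (auto simp: full_box_def abs_diff_le_iff)
  then have "\<exists>w. transport d (sphere_at d x j) (point_box u) (target_face x j) w \<and>
    (\<forall>e. w e \<le> real (d + 4) / real (1 ^ (d - 2))) \<and>
    (\<Sum>e\<in>inner_edges d (sphere_at d x j). w e) \<le> real (2 * d + 8) * real j"
    by (intro transport_from_small_box[where x = x, OF d a(1) j a(2), where A = "point_box u"]) (auto simp: proper_point_box)
  then show ?thesis by simp
qed

lemma transport_chain:
  assumes "\<And>i. i < m \<Longrightarrow> transport d S (Q i) (Q (Suc i)) (w i)"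
  shows "transport d S (Q 0) (Q m) (\<lambda>e. \<Sum>i<m. w i e)"
  using assms
proof (induction m)
  case 0
  show ?case using transport_refl by simp
next
  case (Suc m)
  have "transport d S (Q 0) (Q (Suc m)) (\<lambda>e. (\<Sum>i<m. w i e) + w m e)"
    by (rule transport_trans[OF Suc.IH]) (use Suc.prems in auto)
  then show ?case by simp
qed

text \<open>The box of side \<open>2 ^ i\<close> with corner \<open>u\<close> that extends towards the centre \<open>x\<close> of the sphere.\<close>

definition corner_box :: "vertex \<Rightarrow> vertex \<Rightarrow> nat \<Rightarrow> nat \<Rightarrow> nat \<Rightarrow> int set" where
  "corner_box x u a i k = (if k = a then {u a} else if u k \<le> x k then {u k..u k + 2 ^ i - 1} else {u k - 2 ^ i + 1..u k})"

text \<open>Re-randomise the position successively in boxes of side \<open>1, 2, 4, ...\<close> with corner \<open>u\<close>, and finally over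
  the sphere. Within the face, the move from scale \<open>2 ^ i\<close> to scale \<open>2 ^ (i + 1)\<close> has length of order
  \<open>2 ^ i\<close> and is spread over \<open>2 ^ (i * (d - 2))\<close> lines in each direction.\<close>

lemma multiscale_transport:
  assumes d: "d \<ge> 2" and j: "j \<ge> 1" and u: "u \<in> sphere_at d x j"
    and I: "2 ^ I \<le> j + 1" "j + 1 < 2 ^ Suc I"
  shows "\<exists>w. transport d (sphere_at d x j) (point_box u) (target_face x j) (\<lambda>e. \<Sum>i<Suc I. w i e) \<and>
    (\<forall>i e. 0 \<le> w i e) \<and> (\<forall>i<Suc I. \<forall>e. w i e \<le> real (4 * d + 16) / (2 ^ i) ^ (d - 2)) \<and>
    (\<forall>i<Suc I. (\<Sum>e\<in>inner_edges d (sphere_at d x j). w i e) \<le> real (4 * d + 16) * 2 ^ i)"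
proof -
  let ?S = "sphere_at d x j"
  obtain a where a: "a < d" "\<bar>u a - x a\<bar> = int j" and ui: "\<And>i. i < d \<Longrightarrow> \<bar>u i - x i\<bar> \<le> int j"
    using sphere_atE[OF u j] by blast
  let ?Q = "corner_box x u a"
  have pw: "(1::int) \<le> 2 ^ i" for i by simp
  have pw': "- 1 < (2::int) ^ i" for i by (rule less_le_trans[of _ 0]) auto
  have propQ: "proper_box d (?Q i)" for i using pw[of i] by (auto simp: proper_box_def corner_box_def)
  have card: "card (?Q i k) = 2 ^ i" if "k \<noteq> a" for i k
    using that by (simp add: corner_box_def nat_power_eq)
  have mono: "?Q i k \<subseteq> ?Q (Suc i) k" for i k by (auto simp: corner_box_def pw')
  have small: "(2::int) ^ i \<le> int j + 1" if "i \<le> I" for i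
  proof -
    have "(2::nat) ^ i \<le> 2 ^ I" using that by (intro power_increasing) auto
    then have "(2::nat) ^ i \<le> j + 1" using I(1) by linarith
    then have "int (2 ^ i) \<le> int (j + 1)" by (simp only: of_nat_le_iff)
    then show ?thesis by simp
  qed
  have infull: "?Q i k \<subseteq> full_box x j k" if "i \<le> I" "k < d" for i k
    using small[OF that(1)] ui[OF that(2)] by (auto simp: corner_box_def full_box_def abs_le_iff)
  have Q0: "?Q 0 = point_box u" by (auto simp: corner_box_def fun_eq_iff)
  have "\<exists>w. transport d ?S (?Q i) (?Q (Suc i)) w \<and> (\<forall>e. w e \<le> real d / real ((2 ^ i) ^ (d - 2))) \<and>
     (\<Sum>e\<in>inner_edges d ?S. w e) \<le> real d * 2 ^ Suc i" if i: "i < I" for i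
  proof -
    define l where "l = (\<lambda>k. if k = a then u a else if u k \<le> x k then u k else u k - 2 ^ Suc i + 1)"
    define h where "h = (\<lambda>k. if k = a then u a else if u k \<le> x k then u k + 2 ^ Suc i - 1 else u k)"
    have lh: "{l k..h k} = ?Q (Suc i) k" for k by (simp add: l_def h_def corner_box_def)
    show ?thesis
    proof (rule transport_sweep[OF a(1) propQ propQ, where l = l and h = h])
      show "pbox d (\<lambda>i. {l i..h i}) \<subseteq> ?S" unfolding lh
        by (rule pbox_subset_sphere[where x = x, OF a(1) j a(2)]) (use infull[of "Suc i"] i in \<open>simp_all add: corner_box_def[of x u a _ a]\<close>)
      show "real_of_int (h k - l k) \<le> 2 ^ Suc i" for k
      proof -
        have "h k - l k \<le> 2 ^ Suc i" using pw[of "Suc i"] by (simp add: l_def h_def)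
        then have "real_of_int (h k - l k) \<le> real_of_int (2 ^ Suc i)" by (simp only: of_int_le_iff)
        then show ?thesis by simp
      qed
      show "?Q i k \<subseteq> {l k..h k}" for k unfolding lh by (rule mono)
      show "?Q (Suc i) k \<subseteq> {l k..h k}" for k unfolding lh by simp
      show "2 ^ i \<le> card (?Q i k)" "2 ^ i \<le> card (?Q (Suc i) k)" if "k \<noteq> a" for k using card[OF that] by simp_all
    qed (auto simp: l_def h_def)
  qed
  then have "\<forall>i. \<exists>w. i < I \<longrightarrow> transport d ?S (?Q i) (?Q (Suc i)) w \<and> (\<forall>e. w e \<le> real d / real ((2 ^ i) ^ (d - 2))) \<and>
     (\<Sum>e\<in>inner_edges d ?S. w e) \<le> real d * 2 ^ Suc i" by blast
  then obtain w where w: "\<And>i. i < I \<Longrightarrow> transport d ?S (?Q i) (?Q (Suc i)) (w i)"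
    "\<And>i e. i < I \<Longrightarrow> w i e \<le> real d / real ((2 ^ i) ^ (d - 2))"
    "\<And>i. i < I \<Longrightarrow> (\<Sum>e\<in>inner_edges d ?S. w i e) \<le> real d * 2 ^ Suc i"
    by metis
  have "\<exists>w. transport d ?S (?Q I) (target_face x j) w \<and> (\<forall>e. w e \<le> real (d + 4) / real ((2 ^ I) ^ (d - 2))) \<and>
    (\<Sum>e\<in>inner_edges d ?S. w e) \<le> real (2 * d + 8) * real j"
    by (rule transport_from_small_box[where x = x, OF d a(1) j a(2) propQ]) (use infull card I in \<open>auto simp: corner_box_def\<close>)
  then obtain w' where w': "transport d ?S (?Q I) (target_face x j) w'"
    "\<And>e. w' e \<le> real (d + 4) / real ((2 ^ I) ^ (d - 2))" "(\<Sum>e\<in>inner_edges d ?S. w' e) \<le> real (2 * d + 8) * real j"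
    by auto
  \<comment> \<open>the last scale covers the move from the largest corner box to the target face\<close>
  define W where "W i = (if i < I then w i else w')" for i
  have "transport d ?S (?Q 0) (target_face x j) (\<lambda>e. (\<Sum>i<I. w i e) + w' e)"
    by (rule transport_trans[OF transport_chain[where Q = ?Q and w = w and m = I] w'(1)]) (use w in auto)
  moreover have "(\<lambda>e. (\<Sum>i<I. w i e) + w' e) = (\<lambda>e. \<Sum>i<Suc I. W i e)" by (simp add: W_def)
  ultimately have "transport d ?S (point_box u) (target_face x j) (\<lambda>e. \<Sum>i<Suc I. W i e)" by (simp only: Q0)
  moreover have "0 \<le> W i e" for i e using w(1) w'(1) by (auto simp: W_def transport_def)
  moreover have "W i e \<le> real (4 * d + 16) / (2 ^ i) ^ (d - 2)" if "i < Suc I" for i e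
  proof (cases "i < I")
    case True
    have "W i e \<le> real d / (2 ^ i) ^ (d - 2)" using w(2)[OF True, of e] True by (simp add: W_def)
    also have "\<dots> \<le> real (4 * d + 16) / (2 ^ i) ^ (d - 2)" by (intro divide_right_mono) auto
    finally show ?thesis .
  next
    case False
    then have i: "i = I" using that by simp
    have "W i e \<le> real (d + 4) / (2 ^ i) ^ (d - 2)" using w'(2)[of e] i by (simp add: W_def)
    also have "\<dots> \<le> real (4 * d + 16) / (2 ^ i) ^ (d - 2)" by (intro divide_right_mono) auto
    finally show ?thesis .
  qed
  moreover have "(\<Sum>e\<in>inner_edges d ?S. W i e) \<le> real (4 * d + 16) * 2 ^ i" if "i < Suc I" for i
  proof (cases "i < I")
    case True
    have "(\<Sum>e\<in>inner_edges d ?S. W i e) \<le> real d * 2 ^ Suc i" using w(3)[OF True] True by (simp add: W_def)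
    also have "\<dots> \<le> real (4 * d + 16) * 2 ^ i" by (simp add: mult_right_mono)
    finally show ?thesis .
  next
    case False
    then have i: "i = I" using that by simp
    have "real (j + 1) \<le> real (2 ^ Suc I)" using I(2) by (simp only: of_nat_le_iff less_imp_le)
    then have jI: "real j \<le> 2 * 2 ^ I" by simp
    have "(\<Sum>e\<in>inner_edges d ?S. W i e) \<le> real (2 * d + 8) * real j" using w'(3) i by (simp add: W_def)
    also have "\<dots> \<le> real (2 * d + 8) * (2 * 2 ^ I)" by (intro mult_left_mono jI) auto
    finally show ?thesis using i by (simp add: algebra_simps)
  qed
  ultimately show ?thesis by (intro exI[of _ W]) auto
qed

section \<open>Power sums of flow densities\<close>

lemma powr_tangent:
  fixes y z q :: real
  assumes "0 \<le> y" "y \<le> z" "1 \<le> q"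
  shows "z powr q - y powr q \<le> q * (z - y) * z powr (q - 1)"
proof (cases "y = 0")
  case True
  have e: "z powr q = z * z powr (q - 1)"
    using assms by (cases "z = 0") (simp_all add: powr_diff)
  have "z powr q \<le> q * z powr q" using assms by (simp add: mult_le_cancel_right1)
  then have "z powr q \<le> q * (z * z powr (q - 1))" by (simp only: e)
  then show ?thesis using True by (simp add: mult.assoc)
next
  case False
  then have y: "0 < y" using assms by simp
  show ?thesis
  proof (cases "y = z")
    case False
    then have "y < z" using assms by simp
    have "\<exists>\<xi>>y. \<xi> < z \<and> z powr q - y powr q = (z - y) * (q * \<xi> powr (q - 1))"
    proof (rule MVT2[OF \<open>y < z\<close>])
      fix x assume "y \<le> x" "x \<le> z"
      then show "((\<lambda>x. x powr q) has_real_derivative q * x powr (q - 1)) (at x)"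
        using y by (intro DERIV_powr[THEN DERIV_cong] derivative_eq_intros | simp add: powr_diff)+
    qed
    then obtain \<xi> where xi: "y < \<xi>" "\<xi> < z" "z powr q - y powr q = (z - y) * (q * \<xi> powr (q - 1))" by blast
    have "\<xi> powr (q - 1) \<le> z powr (q - 1)" by (rule powr_mono2) (use xi y assms in auto)
    then have "(z - y) * (q * \<xi> powr (q - 1)) \<le> (z - y) * (q * z powr (q - 1))"
      by (intro mult_left_mono) (use assms in auto)
    then show ?thesis using xi(3) by (simp add: mult_ac)
  qed simp
qed

text \<open>A discrete version of integrating the derivative of a power: add the summands one after the
  other, starting from the last, and apply the tangent bound to each increment.\<close>

lemma powr_sum_le:
  fixes x :: "nat \<Rightarrow> real"
  assumes "\<And>i. 0 \<le> x i" "1 \<le> q"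
  shows "(\<Sum>i<n. x i) powr q \<le> q * (\<Sum>i<n. x i * (\<Sum>l<n - i. x (i + l)) powr (q - 1))"
  using assms(1)
proof (induction n arbitrary: x)
  case 0
  show ?case by simp
next
  case (Suc n)
  let ?S = "\<Sum>i<Suc n. x i" and ?T = "\<Sum>i<n. x (Suc i)"
  have ST: "?S = x 0 + ?T" by (rule sum.lessThan_Suc_shift)
  have T0: "0 \<le> ?T" using Suc.prems by (intro sum_nonneg) auto
  have "?S powr q \<le> ?T powr q + q * x 0 * ?S powr (q - 1)"
    using powr_tangent[OF T0 _ assms(2), of ?S] ST Suc.prems[of 0] by simp
  also have "?T powr q \<le> q * (\<Sum>i<n. x (Suc i) * (\<Sum>l<n - i. x (Suc (i + l))) powr (q - 1))"
    using Suc.IH[of "\<lambda>i. x (Suc i)"] Suc.prems by simp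
  finally have "?S powr q \<le> q * (\<Sum>i<n. x (Suc i) * (\<Sum>l<n - i. x (Suc (i + l))) powr (q - 1)) + q * (x 0 * ?S powr (q - 1))"
    by (simp add: mult.assoc)
  also have "\<dots> = q * (\<Sum>i<Suc n. x i * (\<Sum>l<Suc n - i. x (i + l)) powr (q - 1))"
    by (subst sum.lessThan_Suc_shift) (simp add: distrib_left add.commute)
  finally show ?case .
qed

text \<open>The scale sum below governs the cost of separating two points of a sphere: the sphere has
  dimension \<open>d - 1\<close>, and a flow spread over scale \<open>2 ^ i\<close> has density \<open>2 ^ (- i * (d - 2))\<close>.\<close>

definition scale_sum :: "nat \<Rightarrow> real \<Rightarrow> nat \<Rightarrow> real" where
  "scale_sum d q I = (\<Sum>i<Suc I. 2 powr (real i * (1 - real (d - 2) * (q - 1))))"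

text \<open>At scale \<open>i\<close> and coarser the total density at an edge is of order \<open>2 ^ (- i * s)\<close>, as \<open>s \<ge> 1\<close> makes the
  densities summable. So each scale contributes its total mass \<open>c * 2 ^ i\<close> times this density to the
  power \<open>q - 1\<close>.\<close>

lemma multiscale_power_sum:
  assumes s: "s \<ge> 1" and q: "q > 1" and c: "c \<ge> 0"
    and w: "\<And>i e. 0 \<le> w i e" "\<And>i e. i < n \<Longrightarrow> w i e \<le> c / (2 ^ i) ^ s"
      "\<And>i. i < n \<Longrightarrow> (\<Sum>e\<in>E. w i e) \<le> c * 2 ^ i"
  shows "(\<Sum>e\<in>E. (\<Sum>i<n. w i e) powr q) \<le> q * (2 * c) powr (q - 1) * c * (\<Sum>i<n. 2 powr (real i * (1 - real s * (q - 1))))"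
proof -
  have tail: "(\<Sum>l<n - i. w (i + l) e) \<le> 2 * c / (2 ^ i) ^ s" if i: "i < n" for i e
  proof -
    have "(\<Sum>l<n - i. w (i + l) e) \<le> (\<Sum>l<n - i. c / (2 ^ i) ^ s * (1 / 2) ^ l)"
    proof (rule sum_mono)
      fix l assume "l \<in> {..<n - i}"
      then have "w (i + l) e \<le> c / (2 ^ (i + l)) ^ s" by (intro w) auto
      also have "\<dots> = c / (2 ^ i) ^ s * (1 / (2 ^ l) ^ s)" by (simp add: power_add power_mult_distrib)
      also have "\<dots> \<le> c / (2 ^ i) ^ s * (1 / 2 ^ l)"
      proof (intro mult_left_mono divide_left_mono)
        show "(2::real) ^ l \<le> (2 ^ l) ^ s" using s by (intro self_le_power) auto
      qed (use c in auto)
      finally show "w (i + l) e \<le> c / (2 ^ i) ^ s * (1 / 2) ^ l" by (simp add: power_one_over)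
    qed
    also have "\<dots> = c / (2 ^ i) ^ s * (\<Sum>l<n - i. (1 / 2) ^ l)" by (simp add: sum_distrib_left)
    also have "\<dots> \<le> c / (2 ^ i) ^ s * 2"
      by (intro mult_left_mono) (use c in \<open>auto simp: sum_gp_strict\<close>)
    finally show ?thesis by (simp add: mult.commute)
  qed
  have pw: "(2 * c / (2 ^ i) ^ s) powr (q - 1) = (2 * c) powr (q - 1) * 2 powr (- real i * real s * (q - 1))" for i
  proof -
    have "((2::real) ^ i) ^ s = 2 powr (real i * real s)" by (simp add: powr_realpow[symmetric] powr_powr)
    then show ?thesis using c by (simp add: powr_divide powr_powr powr_minus divide_simps)
  qed
  have "(\<Sum>e\<in>E. (\<Sum>i<n. w i e) powr q) \<le> (\<Sum>e\<in>E. q * (\<Sum>i<n. w i e * (\<Sum>l<n - i. w (i + l) e) powr (q - 1)))"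
    by (intro sum_mono powr_sum_le) (use w(1) q in auto)
  also have "\<dots> \<le> (\<Sum>e\<in>E. q * (\<Sum>i<n. w i e * (2 * c / (2 ^ i) ^ s) powr (q - 1)))"
    by (intro sum_mono mult_left_mono powr_mono2 tail) (use w(1) q in \<open>auto intro: sum_nonneg\<close>)
  also have "\<dots> = q * (\<Sum>i<n. (\<Sum>e\<in>E. w i e) * (2 * c / (2 ^ i) ^ s) powr (q - 1))"
    unfolding sum_distrib_left[symmetric] sum_distrib_right by (subst sum.swap) simp
  also have "\<dots> \<le> q * (\<Sum>i<n. c * 2 ^ i * (2 * c / (2 ^ i) ^ s) powr (q - 1))"
    by (intro mult_left_mono sum_mono mult_right_mono w) (use q in auto)
  also have "\<dots> = q * (\<Sum>i<n. (2 * c) powr (q - 1) * c * 2 powr (real i * (1 - real s * (q - 1))))"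
  proof -
    have "c * 2 ^ i * (2 * c / (2 ^ i) ^ s) powr (q - 1) = (2 * c) powr (q - 1) * c * 2 powr (real i * (1 - real s * (q - 1)))" for i
    proof -
      have "2 powr (real i * (1 - real s * (q - 1))) = 2 powr (real i + (- real i * real s * (q - 1)))"
        by (simp add: algebra_simps)
      also have "\<dots> = 2 ^ i * 2 powr (- real i * real s * (q - 1))" by (simp only: powr_add powr_realpow zero_less_numeral)
      finally show ?thesis unfolding pw by (simp add: mult_ac)
    qed
    then show ?thesis by (simp only:)
  qed
  finally show ?thesis by (simp add: sum_distrib_left mult_ac)
qed

text \<open>The weights \<open>w\<close> bound the distance from \<open>u\<close> to \<open>v\<close> for all edge times \<open>t\<close> at once. In the application
  \<open>g\<close> is the distance from \<open>u\<close>, \<open>h\<close> the distance to \<open>v\<close>, and the condition on \<open>c\<close> is the triangle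
  inequality.\<close>

definition dominates_pair :: "nat \<Rightarrow> vertex set \<Rightarrow> vertex \<Rightarrow> vertex \<Rightarrow> (edge \<Rightarrow> real) \<Rightarrow> bool" where
  "dominates_pair d S u v w \<longleftrightarrow> (\<forall>e. 0 \<le> w e) \<and>
     (\<forall>t g h c. slowly_varying d t g \<longrightarrow> slowly_varying d t h \<longrightarrow> g u \<le> 0 \<longrightarrow> h v \<le> 0 \<longrightarrow>
       (\<forall>z\<in>lattice d. c \<le> g z + h z) \<longrightarrow> c \<le> (\<Sum>e\<in>inner_edges d S. w e * t e))"

lemma dominates_pairI:
  assumes w: "transport d S (point_box u) F w" and w': "transport d S (point_box v) F w'"
    and F: "proper_box d F" and uv: "u \<in> lattice d" "v \<in> lattice d"
  shows "dominates_pair d S u v (\<lambda>e. w e + w' e)"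
  unfolding dominates_pair_def
proof (intro conjI allI impI)
  fix t g h c
  assume sv: "slowly_varying d t g" "slowly_varying d t h" and uv0: "g u \<le> 0" "h v \<le> 0"
    and c: "\<forall>z\<in>lattice d. c \<le> g z + h z"
  have pos: "real (card (pbox d F)) > 0" using card_pbox_pos[OF F] by simp
  have "real (card (pbox d F)) * c = (\<Sum>z\<in>pbox d F. c)" by simp
  also have "\<dots> \<le> (\<Sum>z\<in>pbox d F. g z + h z)" by (intro sum_mono) (use c pbox_sub_lattice in blast)
  finally have "c \<le> (\<Sum>z\<in>pbox d F. g z + h z) / card (pbox d F)"
    using pos by (simp add: pos_le_divide_eq mult.commute)
  also have "\<dots> = avg d g F + avg d h F" by (simp add: avg_def sum.distrib add_divide_distrib)
  also have "\<dots> \<le> (g u + (\<Sum>e\<in>inner_edges d S. w e * t e)) + (h v + (\<Sum>e\<in>inner_edges d S. w' e * t e))"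
    using w w' sv by (intro add_mono) (auto simp: transport_def avg_point_box[OF uv(1)] avg_point_box[OF uv(2)])
  also have "\<dots> \<le> (\<Sum>e\<in>inner_edges d S. (w e + w' e) * t e)"
    using uv0 by (simp add: distrib_right sum.distrib)
  finally show "c \<le> (\<Sum>e\<in>inner_edges d S. (w e + w' e) * t e)" .
qed (use w w' in \<open>auto simp: transport_def add_nonneg_nonneg\<close>)

lemma sphere_at_lattice: "u \<in> sphere_at d x j \<Longrightarrow> u \<in> lattice d"
  by (simp add: sphere_at_def lbox_def)

lemma bounded_pair_weight:
  assumes d: "d \<ge> 2" and j: "j \<ge> 1" and u: "u \<in> sphere_at d x j" and v: "v \<in> sphere_at d x j"
  shows "\<exists>w. dominates_pair d (sphere_at d x j) u v w \<and> (\<forall>e. w e \<le> real (4 * d + 16)) \<and>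
    (\<Sum>e\<in>inner_edges d (sphere_at d x j). w e) \<le> real (4 * d + 16) * real j"
proof -
  let ?E = "inner_edges d (sphere_at d x j)"
  obtain w where w: "transport d (sphere_at d x j) (point_box u) (target_face x j) w"
    "\<And>e. w e \<le> real (d + 4)" "(\<Sum>e\<in>?E. w e) \<le> real (2 * d + 8) * real j"
    using bounded_transport[OF d j u] by blast
  obtain w' where w': "transport d (sphere_at d x j) (point_box v) (target_face x j) w'"
    "\<And>e. w' e \<le> real (d + 4)" "(\<Sum>e\<in>?E. w' e) \<le> real (2 * d + 8) * real j"
    using bounded_transport[OF d j v] by blast
  show ?thesis
  proof (intro exI conjI allI)
    show "dominates_pair d (sphere_at d x j) u v (\<lambda>e. w e + w' e)"
      by (rule dominates_pairI[OF w(1) w'(1) proper_face]) (use u v sphere_at_lattice in auto)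
    show "w e + w' e \<le> real (4 * d + 16)" for e using w(2)[of e] w'(2)[of e] by simp
    show "(\<Sum>e\<in>?E. w e + w' e) \<le> real (4 * d + 16) * real j"
      using w(3) w'(3) by (simp add: sum.distrib algebra_simps)
  qed
qed

text \<open>In dimension two the sphere is one-dimensional, there is nothing to spread over, and the density
  at different scales is not summable; there the crude transport has the right order. In higher
  dimensions the multiscale transport is used.\<close>

lemma power_transport:
  assumes d: "d \<ge> 2" and q: "q > 1" and j: "j \<ge> 1" and u: "u \<in> sphere_at d x j"
    and I: "2 ^ I \<le> j + 1" "j + 1 < 2 ^ Suc I" and C: "C = q * (8 * (4 * real d + 16)) powr q"
  shows "\<exists>w. transport d (sphere_at d x j) (point_box u) (target_face x j) w \<and>
    (\<Sum>e\<in>inner_edges d (sphere_at d x j). w e) \<le> 4 * (4 * real d + 16) * real j \<and>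
    (\<Sum>e\<in>inner_edges d (sphere_at d x j). w e powr q) \<le> C * scale_sum d q I"
proof -
  let ?E = "inner_edges d (sphere_at d x j)"
  define c where "c = 4 * real d + 16"
  have c: "c \<ge> 1" by (simp add: c_def)
  have fin: "finite ?E" by auto
  have jI: "real j \<le> 2 * 2 ^ I" "2 ^ I \<le> 2 * real j"
  proof -
    have "real (j + 1) \<le> real (2 ^ Suc I)" using I(2) by (simp only: of_nat_le_iff less_imp_le)
    then show "real j \<le> 2 * 2 ^ I" by simp
    have "real (2 ^ I) \<le> real (j + 1)" using I(1) by (simp only: of_nat_le_iff)
    then show "2 ^ I \<le> 2 * real j" using j by simp
  qed
  have csplit: "c powr q = c powr (q - 1) * c" using c by (simp add: powr_diff)
  have Cge: "q * (2 * c) powr (q - 1) * c \<le> C" "2 * c powr q \<le> C"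
  proof -
    have "(2 * c) powr (q - 1) * c \<le> (8 * c) powr (q - 1) * (8 * c)"
      by (intro mult_mono powr_mono2) (use c q in auto)
    also have "\<dots> = (8 * c) powr q" using c by (simp add: powr_diff)
    finally show "q * (2 * c) powr (q - 1) * c \<le> C" using q by (simp add: C c_def mult.assoc)
    have "2 * c powr q \<le> 8 powr q * c powr q"
    proof (rule mult_right_mono)
      have "(2::real) \<le> 8 powr 1" by simp
      also have "\<dots> \<le> 8 powr q" by (rule powr_mono) (use q in auto)
      finally show "2 \<le> 8 powr q" .
    qed simp
    also have "\<dots> = (8 * c) powr q" using c by (simp add: powr_mult)
    also have "\<dots> \<le> q * (8 * c) powr q" using q by (simp add: mult_le_cancel_right1)
    finally show "2 * c powr q \<le> C" by (simp add: C c_def)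
  qed
  show ?thesis
  proof (cases "d = 2")
    case True
    obtain w where w: "transport d (sphere_at d x j) (point_box u) (target_face x j) w"
      "\<And>e. w e \<le> real (d + 4)" "(\<Sum>e\<in>?E. w e) \<le> real (2 * d + 8) * real j"
      using bounded_transport[OF d j u] by blast
    have w0: "\<And>e. 0 \<le> w e" using w(1) by (simp add: transport_def)
    have wc: "w e \<le> c" for e using w(2)[of e] by (simp add: c_def)
    have sw: "(\<Sum>e\<in>?E. w e) \<le> c * real j"
      by (rule order_trans[OF w(3)]) (simp add: c_def mult_right_mono)
    have "(\<Sum>e\<in>?E. w e powr q) \<le> (\<Sum>e\<in>?E. c powr (q - 1) * w e)"
    proof (rule sum_mono)
      fix e
      have "w e powr q = w e powr (q - 1) * w e" using w0[of e] by (cases "w e = 0") (simp_all add: powr_diff)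
      also have "\<dots> \<le> c powr (q - 1) * w e" by (intro mult_right_mono powr_mono2) (use w0 wc q in auto)
      finally show "w e powr q \<le> c powr (q - 1) * w e" .
    qed
    also have "\<dots> \<le> c powr (q - 1) * (c * real j)"
      unfolding sum_distrib_left[symmetric] by (intro mult_left_mono sw) auto
    also have "\<dots> = c powr q * real j" by (simp add: csplit)
    also have "\<dots> \<le> c powr q * (2 * 2 ^ I)" by (intro mult_left_mono jI) auto
    also have "2 ^ I \<le> scale_sum d q I"
    proof -
      have "(2::real) ^ I = 2 powr (real I * (1 - real (d - 2) * (q - 1)))" using True by (simp add: powr_realpow)
      also have "\<dots> \<le> scale_sum d q I" unfolding scale_sum_def
        by (rule member_le_sum[where f = "\<lambda>i. 2 powr (real i * (1 - real (d - 2) * (q - 1)))"]) auto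
      finally show ?thesis .
    qed
    then have "c powr q * (2 * 2 ^ I) \<le> C * scale_sum d q I"
    proof -
      have "c powr q * (2 * 2 ^ I) = (2 * c powr q) * 2 ^ I" by simp
      also have "\<dots> \<le> (2 * c powr q) * scale_sum d q I"
        by (intro mult_left_mono \<open>2 ^ I \<le> scale_sum d q I\<close>) simp
      also have "\<dots> \<le> C * scale_sum d q I"
        by (rule mult_right_mono[OF Cge(2)], unfold scale_sum_def, intro sum_nonneg) simp
      finally show ?thesis .
    qed
    finally have "(\<Sum>e\<in>?E. w e powr q) \<le> C * scale_sum d q I" .
    moreover have "(\<Sum>e\<in>?E. w e) \<le> 4 * c * real j"
      by (rule order_trans[OF sw]) (use c in \<open>simp add: mult_right_mono\<close>)
    ultimately show ?thesis using w(1) unfolding c_def by blast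
  next
    case False
    then have s: "d - 2 \<ge> 1" using d by simp
    obtain w where w: "transport d (sphere_at d x j) (point_box u) (target_face x j) (\<lambda>e. \<Sum>i<Suc I. w i e)"
      "\<And>i e. 0 \<le> w i e" "\<And>i e. i < Suc I \<Longrightarrow> w i e \<le> c / (2 ^ i) ^ (d - 2)"
      "\<And>i. i < Suc I \<Longrightarrow> (\<Sum>e\<in>?E. w i e) \<le> c * 2 ^ i"
      using multiscale_transport[OF d j u I] unfolding c_def by auto
    have c0: "c \<ge> 0" using c by simp
    have "(\<Sum>e\<in>?E. \<Sum>i<Suc I. w i e) = (\<Sum>i<Suc I. \<Sum>e\<in>?E. w i e)" by (rule sum.swap)
    also have "\<dots> \<le> (\<Sum>i<Suc I. c * 2 ^ i)" by (intro sum_mono w) auto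
    also have "\<dots> = c * (2 ^ Suc I - 1)"
      unfolding sum_distrib_left[symmetric] by (subst sum_gp_strict) auto
    also have "\<dots> \<le> c * (4 * real j)" using jI(2) c0 by (intro mult_left_mono) auto
    finally have 1: "(\<Sum>e\<in>?E. \<Sum>i<Suc I. w i e) \<le> 4 * c * real j" by (simp add: mult_ac)
    have "(\<Sum>e\<in>?E. (\<Sum>i<Suc I. w i e) powr q) \<le> q * (2 * c) powr (q - 1) * c * (\<Sum>i<Suc I. 2 powr (real i * (1 - real (d - 2) * (q - 1))))"
      by (rule multiscale_power_sum[where s = "d - 2", OF s q c0 w(2,3,4)])
    also have "\<dots> \<le> C * scale_sum d q I"
      unfolding scale_sum_def by (intro mult_right_mono Cge sum_nonneg) auto
    finally show ?thesis using w(1) 1 unfolding c_def by blast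
  qed
qed

lemma powr_add_le:
  fixes x y :: real
  assumes "0 \<le> x" "0 \<le> y" "q > 0"
  shows "(x + y) powr q \<le> 2 powr q * (x powr q + y powr q)"
proof -
  have "(x + y) powr q \<le> (2 * max x y) powr q" by (rule powr_mono2) (use assms in auto)
  also have "\<dots> = 2 powr q * max x y powr q" using assms by (simp add: powr_mult)
  also have "max x y powr q \<le> x powr q + y powr q" by (auto simp: max_def)
  finally show ?thesis by simp
qed

lemma ex_power_pair_weight:
  assumes d: "d \<ge> 2" and q: "q > 1"
  shows "\<exists>C>0. \<forall>x j I u v. j \<ge> 1 \<longrightarrow> 2 ^ I \<le> j + 1 \<longrightarrow> j + 1 < 2 ^ Suc I \<longrightarrow>
    u \<in> sphere_at d x j \<longrightarrow> v \<in> sphere_at d x j \<longrightarrow>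
    (\<exists>w. dominates_pair d (sphere_at d x j) u v w \<and>
      (\<Sum>e\<in>inner_edges d (sphere_at d x j). w e) \<le> C * real j \<and>
      (\<Sum>e\<in>inner_edges d (sphere_at d x j). w e powr q) \<le> C * scale_sum d q I)"
proof -
  define C0 where "C0 = q * (8 * (4 * real d + 16)) powr q"
  define C1 where "C1 = 8 * (4 * real d + 16)"
  have C0: "0 < C0" using q by (simp add: C0_def)
  have C1: "0 < C1" by (simp add: C1_def)
  show ?thesis
  proof (intro exI[of _ "max C1 (2 powr q * (2 * C0))"] conjI allI impI)
    show "0 < max C1 (2 powr q * (2 * C0))" using C1 by simp
    fix x j I u v
    assume j: "1 \<le> j" and I: "2 ^ I \<le> j + 1" "j + 1 < 2 ^ Suc I"
      and u: "u \<in> sphere_at d x j" and v: "v \<in> sphere_at d x j"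
    let ?E = "inner_edges d (sphere_at d x j)"
    have Z0: "0 \<le> scale_sum d q I" unfolding scale_sum_def by (intro sum_nonneg) auto
    obtain w where w: "transport d (sphere_at d x j) (point_box u) (target_face x j) w"
      "(\<Sum>e\<in>?E. w e) \<le> 4 * (4 * real d + 16) * real j" "(\<Sum>e\<in>?E. w e powr q) \<le> C0 * scale_sum d q I"
      using power_transport[OF d q j u I C0_def] by blast
    obtain w' where w': "transport d (sphere_at d x j) (point_box v) (target_face x j) w'"
      "(\<Sum>e\<in>?E. w' e) \<le> 4 * (4 * real d + 16) * real j" "(\<Sum>e\<in>?E. w' e powr q) \<le> C0 * scale_sum d q I"
      using power_transport[OF d q j v I C0_def] by blast
    have nn: "\<And>e. 0 \<le> w e" "\<And>e. 0 \<le> w' e" using w(1) w'(1) by (auto simp: transport_def)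
    show "\<exists>w. dominates_pair d (sphere_at d x j) u v w \<and>
      (\<Sum>e\<in>?E. w e) \<le> max C1 (2 powr q * (2 * C0)) * real j \<and>
      (\<Sum>e\<in>?E. w e powr q) \<le> max C1 (2 powr q * (2 * C0)) * scale_sum d q I"
    proof (intro exI conjI)
      show "dominates_pair d (sphere_at d x j) u v (\<lambda>e. w e + w' e)"
        by (rule dominates_pairI[OF w(1) w'(1) proper_face]) (use u v sphere_at_lattice in auto)
      have "(\<Sum>e\<in>?E. w e + w' e) \<le> C1 * real j"
        using w(2) w'(2) by (simp add: sum.distrib C1_def algebra_simps)
      also have "\<dots> \<le> max C1 (2 powr q * (2 * C0)) * real j" by (intro mult_right_mono) auto
      finally show "(\<Sum>e\<in>?E. w e + w' e) \<le> max C1 (2 powr q * (2 * C0)) * real j" .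
      have "(\<Sum>e\<in>?E. (w e + w' e) powr q) \<le> (\<Sum>e\<in>?E. 2 powr q * (w e powr q + w' e powr q))"
        by (intro sum_mono powr_add_le) (use nn q in auto)
      also have "\<dots> = 2 powr q * ((\<Sum>e\<in>?E. w e powr q) + (\<Sum>e\<in>?E. w' e powr q))"
        by (simp add: sum_distrib_left[symmetric] sum.distrib)
      also have "\<dots> \<le> 2 powr q * (C0 * scale_sum d q I + C0 * scale_sum d q I)"
        by (intro mult_left_mono add_mono w w') auto
      also have "\<dots> = 2 powr q * (2 * C0) * scale_sum d q I" by simp
      also have "\<dots> \<le> max C1 (2 powr q * (2 * C0)) * scale_sum d q I"
        by (intro mult_right_mono Z0) auto
      finally show "(\<Sum>e\<in>?E. (w e + w' e) powr q) \<le> max C1 (2 powr q * (2 * C0)) * scale_sum d q I" .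
    qed
  qed
qed

section \<open>Truncated distances\<close>

text \<open>The passage time truncated at \<open>m\<close>. It satisfies the triangle inequality, is slowly varying for the
  weights truncated at \<open>m\<close>, and, since \<open>m\<close> is inserted, it is meaningful without showing that the
  lattice is connected.\<close>

definition trunc_dist :: "nat \<Rightarrow> (edge \<Rightarrow> real) \<Rightarrow> real \<Rightarrow> vertex \<Rightarrow> vertex \<Rightarrow> real" where
  "trunc_dist d t m u v = Inf (insert m (path_time t ` paths d u v))"

context
  fixes d :: nat and t :: "edge \<Rightarrow> real" and m :: real
  assumes t: "\<And>e. e \<in> edges d \<Longrightarrow> 0 \<le> t e" and m: "0 \<le> m"
begin

lemma trunc_dist_lower: "a \<in> insert m (path_time t ` paths d u v) \<Longrightarrow> trunc_dist d t m u v \<le> a"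
  unfolding trunc_dist_def
  by (rule cInf_lower) (auto intro!: bdd_belowI[of _ 0] m path_time_nonneg t)

lemma trunc_dist_greatest: "(\<And>a. a \<in> insert m (path_time t ` paths d u v) \<Longrightarrow> c \<le> a) \<Longrightarrow> c \<le> trunc_dist d t m u v"
  unfolding trunc_dist_def by (rule cInf_greatest) auto

lemma trunc_dist_nonneg: "0 \<le> trunc_dist d t m u v"
  by (rule trunc_dist_greatest) (auto intro: m path_time_nonneg t)

lemma trunc_dist_same: "u \<in> lattice d \<Longrightarrow> trunc_dist d t m u u \<le> 0"
proof -
  assume "u \<in> lattice d"
  then have "path_time t [u] \<in> insert m (path_time t ` paths d u u)" using paths_singleton by blast
  from trunc_dist_lower[OF this] show ?thesis by simp
qed

lemma slowly_varying_trunc_dist: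
  "slowly_varying d (\<lambda>e. min (t e) m) (\<lambda>z. trunc_dist d t m u z)"
  unfolding slowly_varying_def
proof (intro allI impI)
  fix x y assume adj: "adjacent d x y"
  then have txy: "0 \<le> t {x, y}" using t edge_iff_adjacent by blast
  have "trunc_dist d t m u y - t {x, y} \<le> trunc_dist d t m u x"
  proof (rule trunc_dist_greatest)
    fix a assume "a \<in> insert m (path_time t ` paths d u x)"
    then consider "a = m" | xs where "xs \<in> paths d u x" "a = path_time t xs" by auto
    then show "trunc_dist d t m u y - t {x, y} \<le> a"
    proof cases
      case 1
      then show ?thesis using trunc_dist_lower[of m u y] txy by simp
    next
      case 2
      note j = paths_join[OF 2(1) paths_edge[OF adj]]
      have "path_time t (butlast xs @ [x, y]) \<in> insert m (path_time t ` paths d u y)" using j(1) by blast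
      from trunc_dist_lower[OF this] show ?thesis using j(2)[of t] 2(2) by simp
    qed
  qed
  moreover have "trunc_dist d t m u y \<le> trunc_dist d t m u x + m"
    using trunc_dist_lower[of m u y] trunc_dist_nonneg[of u x] by simp
  ultimately show "trunc_dist d t m u y \<le> trunc_dist d t m u x + min (t {x, y}) m" by simp
qed

lemma slowly_varying_trunc_dist':
  "slowly_varying d (\<lambda>e. min (t e) m) (\<lambda>z. trunc_dist d t m z v)"
  unfolding slowly_varying_def
proof (intro allI impI)
  fix x y assume adj: "adjacent d x y"
  then have txy: "0 \<le> t {x, y}" using t edge_iff_adjacent by blast
  have "trunc_dist d t m y v - t {x, y} \<le> trunc_dist d t m x v"
  proof (rule trunc_dist_greatest)
    fix a assume "a \<in> insert m (path_time t ` paths d x v)"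
    then consider "a = m" | xs where "xs \<in> paths d x v" "a = path_time t xs" by auto
    then show "trunc_dist d t m y v - t {x, y} \<le> a"
    proof cases
      case 1
      then show ?thesis using trunc_dist_lower[of m y v] txy by simp
    next
      case 2
      note j = paths_join[OF paths_edge[OF adjacent_sym[OF adj]] 2(1)]
      have "path_time t (butlast [y, x] @ xs) \<in> insert m (path_time t ` paths d y v)" using j(1) by blast
      from trunc_dist_lower[OF this] show ?thesis using j(2)[of t] 2(2) by (simp add: insert_commute)
    qed
  qed
  moreover have "trunc_dist d t m y v \<le> trunc_dist d t m x v + m"
    using trunc_dist_lower[of m y v] trunc_dist_nonneg[of x v] by simp
  ultimately show "trunc_dist d t m y v \<le> trunc_dist d t m x v + min (t {x, y}) m" by simp
qed

lemma trunc_dist_triangle: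
  assumes "\<And>xs. xs \<in> paths d u v \<Longrightarrow> m \<le> path_time t xs"
  shows "m \<le> trunc_dist d t m u z + trunc_dist d t m z v"
proof -
  have "m - a \<le> trunc_dist d t m z v" if a: "a \<in> insert m (path_time t ` paths d u z)" for a
  proof (rule trunc_dist_greatest)
    fix b assume b: "b \<in> insert m (path_time t ` paths d z v)"
    have "0 \<le> a" "0 \<le> b" using a b m path_time_nonneg[OF _ t] by auto
    then show "m - a \<le> b" using a b assms paths_join by fastforce
  qed
  then have "m - trunc_dist d t m z v \<le> trunc_dist d t m u z"
    by (intro trunc_dist_greatest) (use le_diff_eq diff_le_eq add.commute in metis)
  then show ?thesis by simp
qed

lemma dominates_pair_trunc:
  assumes w: "dominates_pair d S u v w" and uv: "u \<in> lattice d" "v \<in> lattice d"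
    and far: "\<And>xs. xs \<in> paths d u v \<Longrightarrow> m \<le> path_time t xs"
  shows "m \<le> (\<Sum>e\<in>inner_edges d S. w e * min (t e) m)"
proof -
  have "\<forall>z\<in>lattice d. m \<le> trunc_dist d t m u z + trunc_dist d t m z v"
    using trunc_dist_triangle[OF far] by blast
  then show ?thesis using w slowly_varying_trunc_dist[of u] slowly_varying_trunc_dist'[of v]
      trunc_dist_same[OF uv(1)] trunc_dist_same[OF uv(2)]
    unfolding dominates_pair_def by blast
qed

end

section \<open>Exponential moments\<close>

text \<open>Compare \<open>x\<close> with the point where the two sides of Young's inequality balance.\<close>

lemma young_powr:
  fixes x \<theta> b r :: real
  assumes "0 \<le> x" "0 \<le> \<theta>" "b > 0" "r > 1"
  shows "\<theta> * x \<le> b * x powr r + (1 / b) powr (1 / (r - 1)) * \<theta> powr (r / (r - 1))"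
proof (cases "x \<le> (\<theta> / b) powr (1 / (r - 1))")
  case True
  have "\<theta> * x \<le> \<theta> * (\<theta> / b) powr (1 / (r - 1))" by (rule mult_left_mono[OF True assms(2)])
  also have "\<dots> = (1 / b) powr (1 / (r - 1)) * \<theta> powr (r / (r - 1))"
  proof (cases "\<theta> = 0")
    case False
    then have "\<theta> > 0" using assms by simp
    have "r / (r - 1) = 1 + 1 / (r - 1)" using assms by (simp add: field_simps)
    then have "\<theta> powr (r / (r - 1)) = \<theta> * \<theta> powr (1 / (r - 1))" using \<open>\<theta> > 0\<close> by (simp add: powr_add)
    then show ?thesis using \<open>\<theta> > 0\<close> assms by (simp add: powr_divide)
  qed simp
  also have "\<dots> \<le> b * x powr r + \<dots>" using assms by simp
  finally show ?thesis .
next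
  case False
  then have lt: "(\<theta> / b) powr (1 / (r - 1)) < x" by simp
  have x0: "x > 0" using le_less_trans[OF powr_ge_zero lt] .
  have "\<theta> / b = ((\<theta> / b) powr (1 / (r - 1))) powr (r - 1)" using assms by (simp add: powr_powr)
  also have "\<dots> \<le> x powr (r - 1)" by (rule powr_mono2) (use lt assms in auto)
  finally have "\<theta> \<le> b * x powr (r - 1)" using assms by (simp add: field_simps)
  then have "\<theta> * x \<le> b * x powr (r - 1) * x" using x0 by (simp add: mult_right_mono)
  also have "\<dots> = b * x powr r" using x0 by (simp add: powr_diff)
  also have "\<dots> \<le> b * x powr r + (1 / b) powr (1 / (r - 1)) * \<theta> powr (r / (r - 1))" by simp
  finally show ?thesis .
qed

lemma exp_le_1_plus:
  fixes x :: real assumes "0 \<le> x" shows "exp x \<le> 1 + x * exp x"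
proof -
  have "1 - x \<le> exp (- x)" using exp_ge_add_one_self[of "- x"] by simp
  then have "(1 - x) * exp x \<le> exp (- x) * exp x" by (rule mult_right_mono) simp
  then show ?thesis by (simp add: exp_minus algebra_simps)
qed

context passage_percolation
begin

text \<open>Sum the tail bound over the unit intervals that contain \<open>\<tau> e \<omega> powr r\<close>.\<close>

lemma exp_moment_finite:
  assumes \<beta>: "0 < \<beta>" "\<beta> < b"
  shows "\<exists>A>0. \<forall>e\<in>edges d. (\<integral>\<^sup>+\<omega>. ennreal (exp (\<beta> * \<tau> e \<omega> powr r)) \<partial>M) \<le> ennreal A"
proof -
  define f where "f k = a * exp \<beta> * exp (- (b - \<beta>)) ^ k" for k :: nat
  have sf: "summable f" unfolding f_def by (intro summable_mult summable_geometric) (use \<beta> in auto)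
  have f0: "\<And>k. 0 \<le> f k" using a_pos by (simp add: f_def)
  have "(\<integral>\<^sup>+\<omega>. ennreal (exp (\<beta> * \<tau> e \<omega> powr r)) \<partial>M) \<le> ennreal (suminf f + 1)" if e: "e \<in> edges d" for e
  proof -
    note [measurable] = rv[OF e]
    define B where "B k = {\<omega> \<in> space M. real k powr (1 / r) \<le> \<tau> e \<omega>}" for k :: nat
    have Bm [measurable]: "B k \<in> events" for k unfolding B_def by measurable
    have pB: "prob (B k) \<le> a * exp (- b * real k)" for k
    proof -
      have "(real k powr (1 / r)) powr r = real k" using r_pos by (simp add: powr_powr)
      then show ?thesis using tail[OF e, of "real k powr (1 / r)"] unfolding B_def by simp
    qed
    have point: "ennreal (exp (\<beta> * \<tau> e \<omega> powr r)) \<le> (\<Sum>k. ennreal (exp (\<beta> * (real k + 1))) * indicator (B k) \<omega>)"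
      if w: "\<omega> \<in> space M" for \<omega>
    proof -
      \<comment> \<open>only the unit interval that contains the value is needed\<close>
      define k where "k = nat \<lfloor>\<tau> e \<omega> powr r\<rfloor>"
      have k: "real k \<le> \<tau> e \<omega> powr r" "\<tau> e \<omega> powr r \<le> real k + 1"
        unfolding k_def by (simp_all add: of_nat_nat)
      have t0: "0 \<le> \<tau> e \<omega>" by (rule nonneg[OF e w])
      have "real k powr (1 / r) \<le> (\<tau> e \<omega> powr r) powr (1 / r)" by (rule powr_mono2) (use k r_pos in auto)
      then have "\<omega> \<in> B k" using w t0 r_pos by (simp add: B_def powr_powr)
      then have "ennreal (exp (\<beta> * \<tau> e \<omega> powr r)) \<le> ennreal (exp (\<beta> * (real k + 1))) * indicator (B k) \<omega>"
        using k(2) \<beta> by (simp add: ennreal_leI)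
      also have "\<dots> = (\<Sum>i\<in>{k}. ennreal (exp (\<beta> * (real i + 1))) * indicator (B i) \<omega>)"
        by (simp only: sum.insert finite.emptyI empty_iff not_False_eq_True sum.empty add_0_right)
      also have "\<dots> \<le> (\<Sum>k. ennreal (exp (\<beta> * (real k + 1))) * indicator (B k) \<omega>)"
        by (rule sum_le_suminf) auto
      finally show ?thesis .
    qed
    have "(\<integral>\<^sup>+\<omega>. ennreal (exp (\<beta> * \<tau> e \<omega> powr r)) \<partial>M)
        \<le> (\<integral>\<^sup>+\<omega>. (\<Sum>k. ennreal (exp (\<beta> * (real k + 1))) * indicator (B k) \<omega>) \<partial>M)"
      by (rule nn_integral_mono) (rule point)
    also have "\<dots> = (\<Sum>k. \<integral>\<^sup>+\<omega>. ennreal (exp (\<beta> * (real k + 1))) * indicator (B k) \<omega> \<partial>M)"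
      by (rule nn_integral_suminf) measurable
    also have "\<dots> = (\<Sum>k. ennreal (exp (\<beta> * (real k + 1)) * prob (B k)))"
      by (simp add: nn_integral_cmult_indicator emeasure_eq_measure ennreal_mult)
    also have "\<dots> \<le> (\<Sum>k. ennreal (f k))"
    proof (rule suminf_le)
      fix k
      have "exp (\<beta> * (real k + 1)) * prob (B k) \<le> exp (\<beta> * (real k + 1)) * (a * exp (- b * real k))"
        by (rule mult_left_mono[OF pB]) simp
      also have "\<dots> = a * (exp (\<beta> * (real k + 1)) * exp (- b * real k))" by simp
      also have "exp (\<beta> * (real k + 1)) * exp (- b * real k) = exp \<beta> * exp (- (b - \<beta>)) ^ k"
        by (simp add: exp_add[symmetric] exp_of_nat_mult[symmetric] algebra_simps)
      finally show "ennreal (exp (\<beta> * (real k + 1)) * prob (B k)) \<le> ennreal (f k)"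
        by (simp add: f_def ennreal_leI mult.assoc)
    qed auto
    also have "\<dots> = ennreal (suminf f)" by (rule suminf_ennreal2[OF f0 sf])
    also have "\<dots> \<le> ennreal (suminf f + 1)" by (rule ennreal_leI) simp
    finally show ?thesis .
  qed
  moreover have "suminf f + 1 > 0" using suminf_nonneg[OF sf f0] by simp
  ultimately show ?thesis by blast
qed

text \<open>For \<open>\<theta> \<le> 1\<close> the bound is linear by convexity of the exponential function, for \<open>\<theta> \<ge> 1\<close> it comes from Young's
  inequality.\<close>

lemma mgf_superlinear:
  assumes r: "r > 1"
  shows "\<exists>K>0. \<forall>e\<in>edges d. \<forall>\<theta>\<ge>0.
    (\<integral>\<^sup>+\<omega>. ennreal (exp (\<theta> * \<tau> e \<omega>)) \<partial>M) \<le> ennreal (exp (K * (\<theta> + \<theta> powr (r / (r - 1)))))"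
proof -
  obtain A where A: "A > 0" "\<And>e. e \<in> edges d \<Longrightarrow> (\<integral>\<^sup>+\<omega>. ennreal (exp (b / 2 * \<tau> e \<omega> powr r)) \<partial>M) \<le> ennreal A"
    using exp_moment_finite[of "b / 2"] b_pos by auto
  define q where "q = r / (r - 1)"
  define K2 where "K2 = (1 / (b / 2)) powr (1 / (r - 1))"
  have K2: "K2 \<ge> 0" by (simp add: K2_def)
  have young: "(\<integral>\<^sup>+\<omega>. ennreal (exp (\<theta> * \<tau> e \<omega>)) \<partial>M) \<le> ennreal (exp (K2 * \<theta> powr q) * A)"
    if e: "e \<in> edges d" and th: "0 \<le> \<theta>" for e \<theta>
  proof -
    note [measurable] = rv[OF e]
    have "(\<integral>\<^sup>+\<omega>. ennreal (exp (\<theta> * \<tau> e \<omega>)) \<partial>M) \<le> (\<integral>\<^sup>+\<omega>. ennreal (exp (K2 * \<theta> powr q)) * ennreal (exp (b / 2 * \<tau> e \<omega> powr r)) \<partial>M)"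
    proof (rule nn_integral_mono)
      fix \<omega> assume w: "\<omega> \<in> space M"
      have "\<theta> * \<tau> e \<omega> \<le> b / 2 * \<tau> e \<omega> powr r + K2 * \<theta> powr q"
        unfolding K2_def q_def by (rule young_powr) (use nonneg[OF e w] th b_pos r in auto)
      then have "exp (\<theta> * \<tau> e \<omega>) \<le> exp (K2 * \<theta> powr q) * exp (b / 2 * \<tau> e \<omega> powr r)"
        by (simp add: exp_add[symmetric] add.commute)
      then show "ennreal (exp (\<theta> * \<tau> e \<omega>)) \<le> ennreal (exp (K2 * \<theta> powr q)) * ennreal (exp (b / 2 * \<tau> e \<omega> powr r))"
        by (simp add: ennreal_mult[symmetric] ennreal_leI)
    qed
    also have "\<dots> = ennreal (exp (K2 * \<theta> powr q)) * (\<integral>\<^sup>+\<omega>. ennreal (exp (b / 2 * \<tau> e \<omega> powr r)) \<partial>M)"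
      by (rule nn_integral_cmult) measurable
    also have "\<dots> \<le> ennreal (exp (K2 * \<theta> powr q)) * ennreal A" by (intro mult_left_mono A e) auto
    finally show ?thesis using A(1) by (simp add: ennreal_mult)
  qed
  define A1 where "A1 = exp K2 * A"
  define K where "K = K2 + A1 + \<bar>ln A\<bar>"
  have A1: "A1 > 0" using A(1) by (simp add: A1_def)
  have "(\<integral>\<^sup>+\<omega>. ennreal (exp (\<theta> * \<tau> e \<omega>)) \<partial>M) \<le> ennreal (exp (K * (\<theta> + \<theta> powr q)))"
    if e: "e \<in> edges d" and th: "0 \<le> \<theta>" for e \<theta>
  proof (cases "\<theta> \<le> 1")
    case True
    note [measurable] = rv[OF e]
    have "(\<integral>\<^sup>+\<omega>. ennreal (exp (\<theta> * \<tau> e \<omega>)) \<partial>M) \<le> (\<integral>\<^sup>+\<omega>. 1 + ennreal \<theta> * ennreal (exp (1 * \<tau> e \<omega>)) \<partial>M)"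
    proof (rule nn_integral_mono)
      fix \<omega> assume w: "\<omega> \<in> space M"
      have "exp ((1 - \<theta>) *\<^sub>R 0 + \<theta> *\<^sub>R \<tau> e \<omega>) \<le> (1 - \<theta>) * exp 0 + \<theta> * exp (\<tau> e \<omega>)"
        by (rule convex_onD[OF exp_convex]) (use th True in auto)
      also have "\<dots> \<le> 1 + \<theta> * exp (\<tau> e \<omega>)" using th by simp
      finally have "exp (\<theta> * \<tau> e \<omega>) \<le> 1 + \<theta> * exp (\<tau> e \<omega>)" by simp
      then have "ennreal (exp (\<theta> * \<tau> e \<omega>)) \<le> ennreal (1 + \<theta> * exp (\<tau> e \<omega>))" by (rule ennreal_leI)
      also have "\<dots> = 1 + ennreal \<theta> * ennreal (exp (1 * \<tau> e \<omega>))" using th by (simp add: ennreal_mult)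
      finally show "ennreal (exp (\<theta> * \<tau> e \<omega>)) \<le> 1 + ennreal \<theta> * ennreal (exp (1 * \<tau> e \<omega>))" .
    qed
    also have "\<dots> = 1 + ennreal \<theta> * (\<integral>\<^sup>+\<omega>. ennreal (exp (1 * \<tau> e \<omega>)) \<partial>M)"
      by (subst nn_integral_add) (simp_all add: nn_integral_cmult emeasure_space_1)
    also have "\<dots> \<le> 1 + ennreal \<theta> * ennreal A1"
      using young[OF e, of 1] by (intro add_left_mono mult_left_mono) (auto simp: A1_def)
    also have "\<dots> = ennreal (1 + \<theta> * A1)" using th A1 by (simp add: ennreal_mult)
    also have "\<dots> \<le> ennreal (exp (K * (\<theta> + \<theta> powr q)))"
    proof (rule ennreal_leI)
      have "1 + \<theta> * A1 \<le> exp (\<theta> * A1)" by (rule exp_ge_add_one_self)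
      also have "\<dots> \<le> exp (K * (\<theta> + \<theta> powr q))"
      proof -
        have "A1 * \<theta> \<le> K * (\<theta> + \<theta> powr q)" by (rule mult_mono) (use K2 A1 th in \<open>auto simp: K_def\<close>)
        then show ?thesis by (simp add: mult.commute)
      qed
      finally show "1 + \<theta> * A1 \<le> exp (K * (\<theta> + \<theta> powr q))" .
    qed
    finally show ?thesis .
  next
    case False
    then have th1: "1 \<le> \<theta>" by simp
    have "exp (K2 * \<theta> powr q) * A \<le> exp (K * (\<theta> + \<theta> powr q))"
    proof -
      have "ln A \<le> \<bar>ln A\<bar> * \<theta>" using th1 by (metis abs_ge_self abs_ge_zero mult.right_neutral mult_left_mono order_trans)
      then have "K2 * \<theta> powr q + ln A \<le> K2 * \<theta> powr q + \<bar>ln A\<bar> * \<theta>" by simp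
      also have "\<dots> \<le> K * \<theta> powr q + K * \<theta>"
        by (intro add_mono mult_right_mono) (use K2 A1 th in \<open>auto simp: K_def\<close>)
      finally have "exp (K2 * \<theta> powr q + ln A) \<le> exp (K * (\<theta> + \<theta> powr q))" by (simp add: algebra_simps)
      then show ?thesis using A(1) by (simp add: exp_add)
    qed
    then show ?thesis using young[OF e th] by (meson ennreal_leI order_trans)
  qed
  moreover have "K > 0" using K2 A1 by (simp add: K_def add_nonneg_pos add_pos_nonneg)
  ultimately show ?thesis unfolding q_def by blast
qed

text \<open>Without truncation the weights may have no exponential moments if \<open>r < 1\<close>. Below the level \<open>m\<close>, however,
  \<open>x powr r\<close> is at least \<open>m powr (r - 1) * x\<close>, so that exponents up to this order are harmless.\<close>

lemma mgf_sublinear: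
  assumes r: "r \<le> 1"
  shows "\<exists>K>0. \<forall>e\<in>edges d. \<forall>m>0. \<forall>\<theta>\<ge>0. \<theta> \<le> b / 2 * m powr (r - 1) \<longrightarrow>
    (\<integral>\<^sup>+\<omega>. ennreal (exp (\<theta> * min (\<tau> e \<omega>) m)) \<partial>M) \<le> ennreal (exp (K * \<theta>))"
proof -
  obtain A where A: "A > 0" "\<And>e. e \<in> edges d \<Longrightarrow> (\<integral>\<^sup>+\<omega>. ennreal (exp (3 / 4 * b * \<tau> e \<omega> powr r)) \<partial>M) \<le> ennreal A"
    using exp_moment_finite[of "3 / 4 * b"] b_pos by auto
  have "eventually (\<lambda>x::real. x \<le> exp (b / 4 * x powr r)) at_top"
    using b_pos r_pos by real_asymp
  then obtain x0 where x0: "\<And>x. x \<ge> x0 \<Longrightarrow> x \<le> exp (b / 4 * x powr r)" by (auto simp: eventually_at_top_linorder)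
  define C where "C = max 1 x0"
  have C: "x \<le> C * exp (b / 4 * x powr r)" if "x \<ge> 0" for x
  proof (cases "x \<ge> x0")
    case True
    have "x \<le> 1 * exp (b / 4 * x powr r)" using x0[OF True] by simp
    also have "\<dots> \<le> C * exp (b / 4 * x powr r)" by (rule mult_right_mono) (auto simp: C_def)
    finally show ?thesis .
  next
    case False
    then have "x \<le> C * 1" by (simp add: C_def)
    also have "\<dots> \<le> C * exp (b / 4 * x powr r)" by (rule mult_left_mono) (use b_pos in \<open>auto simp: C_def\<close>)
    finally show ?thesis .
  qed
  have C1: "C \<ge> 1" by (simp add: C_def)
  have "(\<integral>\<^sup>+\<omega>. ennreal (exp (\<theta> * min (\<tau> e \<omega>) m)) \<partial>M) \<le> ennreal (exp (C * A * \<theta>))"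
    if e: "e \<in> edges d" and m: "m > 0" and th: "0 \<le> \<theta>" "\<theta> \<le> b / 2 * m powr (r - 1)" for e m \<theta>
  proof -
    note [measurable] = rv[OF e]
    have "(\<integral>\<^sup>+\<omega>. ennreal (exp (\<theta> * min (\<tau> e \<omega>) m)) \<partial>M) \<le> (\<integral>\<^sup>+\<omega>. 1 + ennreal (\<theta> * C) * ennreal (exp (3 / 4 * b * \<tau> e \<omega> powr r)) \<partial>M)"
    proof (rule nn_integral_mono)
      fix \<omega> assume w: "\<omega> \<in> space M"
      have t0: "0 \<le> \<tau> e \<omega>" by (rule nonneg[OF e w])
      define X where "X = min (\<tau> e \<omega>) m"
      have X: "0 \<le> X" "X \<le> \<tau> e \<omega>" "X \<le> m" using t0 m by (auto simp: X_def)
      have thX: "\<theta> * X \<le> b / 2 * \<tau> e \<omega> powr r"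
      proof (cases "X = 0")
        case True
        then show ?thesis using b_pos by simp
      next
        case False
        then have X0: "X > 0" using X by simp
        have "\<theta> * X \<le> b / 2 * m powr (r - 1) * X" by (rule mult_right_mono[OF th(2) X(1)])
        also have "m powr (r - 1) \<le> X powr (r - 1)" using X0 X m r by (intro powr_mono2') auto
        then have "b / 2 * m powr (r - 1) * X \<le> b / 2 * X powr (r - 1) * X"
          using b_pos X by (intro mult_right_mono mult_left_mono) auto
        also have "\<dots> = b / 2 * X powr r" using X0 by (simp add: powr_diff)
        also have "\<dots> \<le> b / 2 * \<tau> e \<omega> powr r" using X b_pos r_pos by (intro mult_left_mono powr_mono2) auto
        finally show ?thesis .
      qed
      have "exp (\<theta> * X) \<le> 1 + \<theta> * X * exp (\<theta> * X)" by (rule exp_le_1_plus) (use th X in auto)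
      also have "\<theta> * X * exp (\<theta> * X) \<le> \<theta> * (C * exp (b / 4 * \<tau> e \<omega> powr r)) * exp (b / 2 * \<tau> e \<omega> powr r)"
        by (intro mult_mono order_trans[OF X(2) C[OF t0]]) (use th X thX C1 in auto)
      also have "\<dots> = \<theta> * C * exp (3 / 4 * b * \<tau> e \<omega> powr r)"
        by (simp add: mult.assoc exp_add[symmetric])
      finally have "ennreal (exp (\<theta> * X)) \<le> ennreal (1 + \<theta> * C * exp (3 / 4 * b * \<tau> e \<omega> powr r))"
        by (intro ennreal_leI) simp
      also have "\<dots> = 1 + ennreal (\<theta> * C) * ennreal (exp (3 / 4 * b * \<tau> e \<omega> powr r))"
        using th C1 by (simp add: ennreal_mult)
      finally show "ennreal (exp (\<theta> * min (\<tau> e \<omega>) m)) \<le> 1 + ennreal (\<theta> * C) * ennreal (exp (3 / 4 * b * \<tau> e \<omega> powr r))"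
        by (simp add: X_def)
    qed
    also have "\<dots> = 1 + ennreal (\<theta> * C) * (\<integral>\<^sup>+\<omega>. ennreal (exp (3 / 4 * b * \<tau> e \<omega> powr r)) \<partial>M)"
      by (subst nn_integral_add) (simp_all add: nn_integral_cmult emeasure_space_1)
    also have "\<dots> \<le> 1 + ennreal (\<theta> * C) * ennreal A"
      by (intro add_left_mono mult_left_mono A e) auto
    also have "\<dots> = ennreal (1 + C * A * \<theta>)" using th C1 A(1) by (simp add: ennreal_mult[symmetric] mult_ac)
    also have "\<dots> \<le> ennreal (exp (C * A * \<theta>))" by (rule ennreal_leI[OF exp_ge_add_one_self])
    finally show ?thesis .
  qed
  moreover have "C * A > 0" using C1 A(1) by simp
  ultimately show ?thesis by blast
qed

lemma chernoff_bound:
  fixes \<theta> \<beta> :: "edge \<Rightarrow> real"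
  assumes E: "finite E" "E \<subseteq> edges d" and \<phi> [measurable]: "\<phi> \<in> borel_measurable borel"
    and mgf: "\<And>e. e \<in> E \<Longrightarrow> (\<integral>\<^sup>+\<omega>. ennreal (exp (\<theta> e * \<phi> (\<tau> e \<omega>))) \<partial>M) \<le> ennreal (exp (\<beta> e))"
  shows "{\<omega> \<in> space M. c \<le> (\<Sum>e\<in>E. \<theta> e * \<phi> (\<tau> e \<omega>))} \<in> events"
    and "prob {\<omega> \<in> space M. c \<le> (\<Sum>e\<in>E. \<theta> e * \<phi> (\<tau> e \<omega>))} \<le> exp ((\<Sum>e\<in>E. \<beta> e) - c)"
proof -
  have [measurable]: "\<tau> e \<in> borel_measurable M" if "e \<in> E" for e using that E rv by auto
  have meas: "(\<lambda>\<omega>. \<Sum>e\<in>E. \<theta> e * \<phi> (\<tau> e \<omega>)) \<in> borel_measurable M"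
  proof (rule borel_measurable_sum)
    fix e assume "e \<in> E"
    then have [measurable]: "\<tau> e \<in> borel_measurable M" using E rv by auto
    show "(\<lambda>\<omega>. \<theta> e * \<phi> (\<tau> e \<omega>)) \<in> borel_measurable M" by measurable
  qed
  note [measurable] = meas
  show ev: "{\<omega> \<in> space M. c \<le> (\<Sum>e\<in>E. \<theta> e * \<phi> (\<tau> e \<omega>))} \<in> events" by measurable
  have ind: "indep_vars (\<lambda>_. borel) (\<lambda>e \<omega>. ennreal (exp (\<theta> e * \<phi> (\<tau> e \<omega>)))) E"
    by (rule indep_vars_compose2[OF indep_vars_subset[OF indep E(2)], where Y = "\<lambda>e x. ennreal (exp (\<theta> e * \<phi> x))"]) measurable
  have "(\<integral>\<^sup>+\<omega>. ennreal (exp (\<Sum>e\<in>E. \<theta> e * \<phi> (\<tau> e \<omega>))) \<partial>M) = (\<integral>\<^sup>+\<omega>. (\<Prod>e\<in>E. ennreal (exp (\<theta> e * \<phi> (\<tau> e \<omega>)))) \<partial>M)"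
    by (simp add: exp_sum[OF E(1)] prod_ennreal)
  also have "\<dots> = (\<Prod>e\<in>E. \<integral>\<^sup>+\<omega>. ennreal (exp (\<theta> e * \<phi> (\<tau> e \<omega>))) \<partial>M)"
    by (rule indep_vars_nn_integral[OF E(1) ind]) auto
  also have "\<dots> \<le> (\<Prod>e\<in>E. ennreal (exp (\<beta> e)))" by (rule prod_mono_ennreal[OF mgf])
  also have "\<dots> = ennreal (exp (\<Sum>e\<in>E. \<beta> e))" by (simp add: exp_sum[OF E(1)] prod_ennreal)
  finally have int: "(\<integral>\<^sup>+\<omega>. ennreal (exp (\<Sum>e\<in>E. \<theta> e * \<phi> (\<tau> e \<omega>))) \<partial>M) \<le> ennreal (exp (\<Sum>e\<in>E. \<beta> e))" .
  have "emeasure M {\<omega> \<in> space M. c \<le> (\<Sum>e\<in>E. \<theta> e * \<phi> (\<tau> e \<omega>))}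
     \<le> emeasure M {\<omega> \<in> space M. 1 \<le> ennreal (exp (- c)) * ennreal (exp (\<Sum>e\<in>E. \<theta> e * \<phi> (\<tau> e \<omega>)))}"
  proof (rule emeasure_mono)
    show "{\<omega> \<in> space M. c \<le> (\<Sum>e\<in>E. \<theta> e * \<phi> (\<tau> e \<omega>))} \<subseteq> {\<omega> \<in> space M. 1 \<le> ennreal (exp (- c)) * ennreal (exp (\<Sum>e\<in>E. \<theta> e * \<phi> (\<tau> e \<omega>)))}"
      by (auto simp: ennreal_mult[symmetric] exp_add[symmetric])
  qed measurable
  also have "\<dots> \<le> ennreal (exp (- c)) * (\<integral>\<^sup>+\<omega>. ennreal (exp (\<Sum>e\<in>E. \<theta> e * \<phi> (\<tau> e \<omega>))) * indicator (space M) \<omega> \<partial>M)"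
    by (rule nn_integral_Markov_inequality) auto
  also have "\<dots> = ennreal (exp (- c)) * (\<integral>\<^sup>+\<omega>. ennreal (exp (\<Sum>e\<in>E. \<theta> e * \<phi> (\<tau> e \<omega>))) \<partial>M)"
    by (intro arg_cong2[where f = "(*)"] refl nn_integral_cong) (simp add: indicator_def)
  also have "\<dots> \<le> ennreal (exp (- c)) * ennreal (exp (\<Sum>e\<in>E. \<beta> e))" by (rule mult_left_mono[OF int]) simp
  also have "\<dots> = ennreal (exp ((\<Sum>e\<in>E. \<beta> e) - c))" by (simp add: ennreal_mult[symmetric] exp_add[symmetric])
  finally show "prob {\<omega> \<in> space M. c \<le> (\<Sum>e\<in>E. \<theta> e * \<phi> (\<tau> e \<omega>))} \<le> exp ((\<Sum>e\<in>E. \<beta> e) - c)"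
    by (simp add: emeasure_eq_measure)
qed

end

section \<open>Bad vertices\<close>

text \<open>Edges inside different spheres are different, which provides the independence of the spheres.\<close>

lemma inner_edges_sphere_disjoint:
  assumes "e \<in> inner_edges d (sphere_at d x i)" "e \<in> inner_edges d (sphere_at d x j)"
  shows "i = j"
proof -
  have "e \<in> edges d" using assms(1) by (simp add: inner_edges_def)
  then obtain u v where e: "e = {u, v}" by (rule edgeE)
  then have u: "u \<in> sphere_at d x i" "u \<in> sphere_at d x j" using assms by (auto simp: inner_edges_def)
  have "\<not> i < j" if "u \<in> sphere_at d x i" "u \<in> sphere_at d x j" for i j
  proof
    assume "i < j"
    then have "i \<le> j - 1" by simp
    then have "u \<in> lbox d x (j - 1)" using that(1) lbox_mono[of i "j - 1" d x] by (auto simp: sphere_at_def)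
    then show False using that(2) by (simp add: sphere_at_def)
  qed
  then show ?thesis using u by (metis linorder_neqE_nat)
qed

context passage_percolation
begin

text \<open>The event that \<open>x\<close> is bad. It involves passage times over infinitely many paths; below it is
  covered by measurable events instead of being shown measurable itself.\<close>

definition bad_vertex :: "real \<Rightarrow> nat \<Rightarrow> vertex \<Rightarrow> 'a set" where
  "bad_vertex m J x = {\<omega> \<in> space M. \<forall>j\<in>{1..J}. \<exists>u\<in>sphere_at d x j. \<exists>v\<in>sphere_at d x j.
     \<forall>xs\<in>paths d u v. m \<le> path_time (\<lambda>e. \<tau> e \<omega>) xs}"

abbreviation covered_by :: "'a set \<Rightarrow> real \<Rightarrow> bool" where
  "covered_by A c \<equiv> \<exists>B\<in>events. A \<subseteq> B \<and> prob B \<le> c"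

text \<open>Fix the pair of points on each sphere. Being bad then forces the sum over all spheres of the
  functionals given by \<open>w\<close>, multiplied by \<open>lam j\<close>, to exceed its mean by far, and
  one Chernoff bound handles all spheres at once. There are at most \<open>(2 * J + 1) ^ (2 * d)\<close> pairs per
  sphere.\<close>

lemma bad_vertex_union_bound:
  fixes lam :: "nat \<Rightarrow> real"
  assumes m: "m > 0" and lam: "\<And>j. j \<in> {1..J} \<Longrightarrow> 0 \<le> lam j"
    and W: "\<And>j u v. j \<in> {1..J} \<Longrightarrow> u \<in> sphere_at d x j \<Longrightarrow> v \<in> sphere_at d x j \<Longrightarrow>
      \<exists>w \<beta>. dominates_pair d (sphere_at d x j) u v w \<and>
        (\<forall>e\<in>inner_edges d (sphere_at d x j).
           (\<integral>\<^sup>+\<omega>. ennreal (exp (lam j * w e * min (\<tau> e \<omega>) m)) \<partial>M) \<le> ennreal (exp (\<beta> e))) \<and>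
        (\<Sum>e\<in>inner_edges d (sphere_at d x j). \<beta> e) \<le> lam j * m / 2"
  shows "covered_by (bad_vertex m J x) (real ((2 * J + 1) ^ (2 * d * J)) * exp (- (m / 2 * (\<Sum>j=1..J. lam j))))"
proof -
  define S where "S j = sphere_at d x j" for j
  define Ed where "Ed j = inner_edges d (S j)" for j
  have "\<forall>j u v. \<exists>w \<beta>. j \<in> {1..J} \<longrightarrow> u \<in> S j \<longrightarrow> v \<in> S j \<longrightarrow> dominates_pair d (S j) u v w \<and>
        (\<forall>e\<in>Ed j. (\<integral>\<^sup>+\<omega>. ennreal (exp (lam j * w e * min (\<tau> e \<omega>) m)) \<partial>M) \<le> ennreal (exp (\<beta> e))) \<and>
        (\<Sum>e\<in>Ed j. \<beta> e) \<le> lam j * m / 2"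
    using W unfolding S_def Ed_def by blast
  then obtain w \<beta> where w: "\<And>j u v. j \<in> {1..J} \<Longrightarrow> u \<in> S j \<Longrightarrow> v \<in> S j \<Longrightarrow> dominates_pair d (S j) u v (w j u v) \<and>
        (\<forall>e\<in>Ed j. (\<integral>\<^sup>+\<omega>. ennreal (exp (lam j * w j u v e * min (\<tau> e \<omega>) m)) \<partial>M) \<le> ennreal (exp (\<beta> j u v e))) \<and>
        (\<Sum>e\<in>Ed j. \<beta> j u v e) \<le> lam j * m / 2"
    by metis
  \<comment> \<open>the radius of the unique sphere that contains \<open>e\<close>\<close>
  define idx where "idx e = (LEAST j. e \<in> Ed j)" for e
  have idx: "idx e = j" if "e \<in> Ed j" for e j
  proof -
    have "e \<in> Ed (idx e)" unfolding idx_def by (rule LeastI[of "\<lambda>j. e \<in> Ed j", OF that])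
    then show ?thesis using that inner_edges_sphere_disjoint unfolding Ed_def S_def by blast
  qed
  define E where "E = (\<Union>j\<in>{1..J}. Ed j)"
  have finEd: "finite (Ed j)" for j unfolding Ed_def S_def by auto
  have E: "finite E" "E \<subseteq> edges d" using finEd by (auto simp: E_def Ed_def inner_edges_def)
  have sumE: "(\<Sum>e\<in>E. g (idx e) e) = (\<Sum>j=1..J. \<Sum>e\<in>Ed j. g j e)" for g :: "nat \<Rightarrow> edge \<Rightarrow> real"
  proof -
    have "(\<Sum>e\<in>E. g (idx e) e) = (\<Sum>j\<in>{1..J}. \<Sum>e\<in>Ed j. g (idx e) e)"
      unfolding E_def
    proof (rule sum.UNION_disjoint)
      show "\<forall>i\<in>{1..J}. \<forall>j\<in>{1..J}. i \<noteq> j \<longrightarrow> Ed i \<inter> Ed j = {}"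
        using inner_edges_sphere_disjoint unfolding Ed_def S_def by blast
    qed (use finEd in auto)
    also have "\<dots> = (\<Sum>j=1..J. \<Sum>e\<in>Ed j. g j e)" by (intro sum.cong refl) (simp add: idx)
    finally show ?thesis .
  qed
  define F where "F = (\<Pi>\<^sub>E j\<in>{1..J}. S j \<times> S j)"
  have finF: "finite F" unfolding F_def S_def by (intro finite_PiE) auto
  define L where "L = (\<Sum>j=1..J. lam j)"
  define th where "th f e = lam (idx e) * w (idx e) (fst (f (idx e))) (snd (f (idx e))) e" for f :: "nat \<Rightarrow> vertex \<times> vertex" and e
  define be where "be f e = \<beta> (idx e) (fst (f (idx e))) (snd (f (idx e))) e" for f :: "nat \<Rightarrow> vertex \<times> vertex" and e
  define B where "B f = {\<omega> \<in> space M. L * m \<le> (\<Sum>e\<in>E. th f e * min (\<tau> e \<omega>) m)}" for f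
  have fS: "fst (f j) \<in> S j" "snd (f j) \<in> S j" if "f \<in> F" "j \<in> {1..J}" for f j
  proof -
    have "f j \<in> S j \<times> S j" using that unfolding F_def by (rule PiE_mem)
    then show "fst (f j) \<in> S j" "snd (f j) \<in> S j" by auto
  qed
  have B: "B f \<in> events" "prob (B f) \<le> exp (- (m / 2 * L))" if f: "f \<in> F" for f
  proof -
    have mgf: "(\<integral>\<^sup>+\<omega>. ennreal (exp (th f e * min (\<tau> e \<omega>) m)) \<partial>M) \<le> ennreal (exp (be f e))" if eE: "e \<in> E" for e
    proof -
      obtain j where j: "j \<in> {1..J}" "e \<in> Ed j" using eE by (auto simp: E_def)
      then show ?thesis unfolding th_def be_def idx[OF j(2)] using w[OF j(1) fS[OF f j(1)]] by blast
    qed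
    note ch = chernoff_bound[OF E, where \<phi> = "\<lambda>x. min x m", of "th f" "be f" "L * m", OF _ mgf]
    show "B f \<in> events" unfolding B_def by (rule ch(1)) auto
    have "prob (B f) \<le> exp ((\<Sum>e\<in>E. be f e) - L * m)" unfolding B_def by (rule ch(2)) auto
    also have "(\<Sum>e\<in>E. be f e) = (\<Sum>j=1..J. \<Sum>e\<in>Ed j. \<beta> j (fst (f j)) (snd (f j)) e)"
      unfolding be_def by (rule sumE[of "\<lambda>j e. \<beta> j (fst (f j)) (snd (f j)) e"])
    also have "\<dots> \<le> (\<Sum>j=1..J. lam j * m / 2)"
      by (rule sum_mono) (use w fS[OF f] in blast)
    also have "\<dots> = L * m / 2" by (simp add: L_def sum_distrib_right sum_divide_distrib)
    finally show "prob (B f) \<le> exp (- (m / 2 * L))" by (simp add: mult.commute)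
  qed
  define BB where "BB = (\<Union>f\<in>F. B f)"
  have "BB \<in> events" unfolding BB_def by (intro sets.finite_UN finF B)
  moreover have "bad_vertex m J x \<subseteq> BB"
  proof
    fix \<omega> assume w': "\<omega> \<in> bad_vertex m J x"
    then have sp: "\<omega> \<in> space M" by (simp add: bad_vertex_def)
    have "\<forall>j\<in>{1..J}. \<exists>p\<in>S j \<times> S j. \<forall>xs\<in>paths d (fst p) (snd p). m \<le> path_time (\<lambda>e. \<tau> e \<omega>) xs"
      using w' unfolding bad_vertex_def S_def by fastforce
    then obtain g where g: "\<And>j. j \<in> {1..J} \<Longrightarrow> g j \<in> S j \<times> S j \<and> (\<forall>xs\<in>paths d (fst (g j)) (snd (g j)). m \<le> path_time (\<lambda>e. \<tau> e \<omega>) xs)"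
      by metis
    define f where "f = restrict g {1..J}"
    have fF: "f \<in> F" unfolding f_def F_def using g by auto
    have gf: "f j = g j" if "j \<in> {1..J}" for j using that by (simp add: f_def)
    have "L * m = (\<Sum>j=1..J. lam j * m)" by (simp add: L_def sum_distrib_right)
    also have "\<dots> \<le> (\<Sum>j=1..J. lam j * (\<Sum>e\<in>Ed j. w j (fst (f j)) (snd (f j)) e * min (\<tau> e \<omega>) m))"
    proof (rule sum_mono, rule mult_left_mono[OF _ lam])
      fix j assume j: "j \<in> {1..J}"
      show "m \<le> (\<Sum>e\<in>Ed j. w j (fst (f j)) (snd (f j)) e * min (\<tau> e \<omega>) m)"
        unfolding Ed_def
      proof (rule dominates_pair_trunc)
        show "dominates_pair d (S j) (fst (f j)) (snd (f j)) (w j (fst (f j)) (snd (f j)))"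
          using w[OF j fS[OF fF j]] by blast
        show "m \<le> path_time (\<lambda>e. \<tau> e \<omega>) xs" if "xs \<in> paths d (fst (f j)) (snd (f j))" for xs
          using g[OF j] that gf[OF j] by auto
        show "fst (f j) \<in> lattice d" "snd (f j) \<in> lattice d"
          using fS[OF fF j] sphere_at_lattice unfolding S_def by auto
      qed (use nonneg[OF _ sp] m in auto)
    qed
    also have "\<dots> = (\<Sum>j=1..J. \<Sum>e\<in>Ed j. lam j * w j (fst (f j)) (snd (f j)) e * min (\<tau> e \<omega>) m)"
      by (simp add: sum_distrib_left mult.assoc)
    also have "\<dots> = (\<Sum>e\<in>E. th f e * min (\<tau> e \<omega>) m)"
      unfolding th_def by (rule sumE[of "\<lambda>j e. lam j * w j (fst (f j)) (snd (f j)) e * min (\<tau> e \<omega>) m", symmetric])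
    finally show "\<omega> \<in> BB" using fF sp by (auto simp: BB_def B_def)
  qed
  moreover have "prob BB \<le> real ((2 * J + 1) ^ (2 * d * J)) * exp (- (m / 2 * (\<Sum>j=1..J. lam j)))"
  proof -
    have "prob BB \<le> (\<Sum>f\<in>F. prob (B f))"
      unfolding BB_def by (rule finite_measure_subadditive_finite[OF finF]) (use B in auto)
    also have "\<dots> \<le> (\<Sum>f\<in>F. exp (- (m / 2 * L)))" by (intro sum_mono B)
    also have "\<dots> = real (card F) * exp (- (m / 2 * L))" by simp
    also have "\<dots> \<le> real ((2 * J + 1) ^ (2 * d * J)) * exp (- (m / 2 * L))"
    proof (rule mult_right_mono)
      have "card F = (\<Prod>j\<in>{1..J}. card (S j \<times> S j))" unfolding F_def by (rule card_PiE) simp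
      also have "\<dots> \<le> (\<Prod>j\<in>{1..J}. (2 * J + 1) ^ (2 * d))"
      proof (rule prod_mono, intro conjI)
        fix j assume j: "j \<in> {1..J}"
        have "card (S j) \<le> (2 * j + 1) ^ d" unfolding S_def by (rule card_sphere_at)
        also have "\<dots> \<le> (2 * J + 1) ^ d" by (rule power_mono) (use j in auto)
        finally have cS: "card (S j) \<le> (2 * J + 1) ^ d" .
        have "card (S j) * card (S j) \<le> (2 * J + 1) ^ d * (2 * J + 1) ^ d" by (rule mult_le_mono[OF cS cS])
        then show "card (S j \<times> S j) \<le> (2 * J + 1) ^ (2 * d)"
          by (simp add: card_cartesian_product power_add[symmetric] mult_2)
      qed simp
      also have "\<dots> = (2 * J + 1) ^ (2 * d * J)" by (simp add: power_mult)
      finally show "real (card F) \<le> real ((2 * J + 1) ^ (2 * d * J))" by (simp only: of_nat_le_iff)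
    qed simp
    finally show ?thesis by (simp add: L_def)
  qed
  ultimately show ?thesis by blast
qed

text \<open>For \<open>r \<le> 1\<close> concentrating all the weight on single edges is cheapest, so a flow of bounded density
  is as good as any other.\<close>

lemma bad_vertex_sublinear:
  assumes r: "r \<le> 1"
  shows "\<exists>\<eta>>0. \<exists>\<delta>>0. \<forall>m>0. \<forall>J x. real J \<le> \<eta> * m \<longrightarrow>
    (covered_by (bad_vertex m J x) (real ((2 * J + 1) ^ (2 * d * J)) * exp (- (m / 2 * (\<Sum>j=1..J. \<delta> * m powr (r - 1))))))"
proof -
  obtain K where K: "K > 0" "\<And>e m \<theta>. e \<in> edges d \<Longrightarrow> m > 0 \<Longrightarrow> 0 \<le> \<theta> \<Longrightarrow> \<theta> \<le> b / 2 * m powr (r - 1) \<Longrightarrow>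
    (\<integral>\<^sup>+\<omega>. ennreal (exp (\<theta> * min (\<tau> e \<omega>) m)) \<partial>M) \<le> ennreal (exp (K * \<theta>))"
    using mgf_sublinear[OF r] by blast
  define c where "c = real (4 * d + 16)"
  have c: "c > 0" by (simp add: c_def)
  \<comment> \<open>keeps \<open>l * w e\<close> in the range where the moment generating function is controlled\<close>
  define \<delta> where "\<delta> = b / (2 * c)"
  have \<delta>: "\<delta> > 0" using b_pos c by (simp add: \<delta>_def)
  \<comment> \<open>makes the mean of the functional at most half of the level\<close>
  define \<eta> where "\<eta> = 1 / (2 * K * c)"
  have \<eta>: "\<eta> > 0" using K c by (simp add: \<eta>_def)
  show ?thesis
  proof (rule exI[of _ \<eta>], rule conjI[OF \<eta>], rule exI[of _ \<delta>], rule conjI[OF \<delta>], intro allI impI)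
    fix m :: real and J x
    assume m: "m > 0" and J: "real J \<le> \<eta> * m"
    define l where "l = \<delta> * m powr (r - 1)"
    have l: "l \<ge> 0" using \<delta> by (simp add: l_def)
    show "covered_by (bad_vertex m J x) (real ((2 * J + 1) ^ (2 * d * J)) * exp (- (m / 2 * (\<Sum>j=1..J. \<delta> * m powr (r - 1)))))"
      unfolding l_def[symmetric]
    proof (rule bad_vertex_union_bound[OF m l])
      fix j u v assume j: "j \<in> {1..J}" and uv: "u \<in> sphere_at d x j" "v \<in> sphere_at d x j"
      let ?E = "inner_edges d (sphere_at d x j)"
      obtain w where w: "dominates_pair d (sphere_at d x j) u v w" "\<And>e. w e \<le> c" "(\<Sum>e\<in>?E. w e) \<le> c * real j"
        using bounded_pair_weight[OF d2 _ uv] j unfolding c_def by auto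
      have w0: "\<And>e. 0 \<le> w e" using w(1) by (simp add: dominates_pair_def)
      show "\<exists>w \<beta>. dominates_pair d (sphere_at d x j) u v w \<and>
        (\<forall>e\<in>?E. (\<integral>\<^sup>+\<omega>. ennreal (exp (l * w e * min (\<tau> e \<omega>) m)) \<partial>M) \<le> ennreal (exp (\<beta> e))) \<and>
        (\<Sum>e\<in>?E. \<beta> e) \<le> l * m / 2"
      proof (intro exI conjI ballI)
        show "dominates_pair d (sphere_at d x j) u v w" by (rule w)
        fix e assume e: "e \<in> ?E"
        have "l * w e \<le> l * c" by (rule mult_left_mono[OF w(2) l])
        also have "\<dots> = b / 2 * m powr (r - 1)" using c by (simp add: l_def \<delta>_def)
        finally show "(\<integral>\<^sup>+\<omega>. ennreal (exp (l * w e * min (\<tau> e \<omega>) m)) \<partial>M) \<le> ennreal (exp (K * (l * w e)))"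
          by (intro K) (use e m l w0 in \<open>auto simp: inner_edges_def\<close>)
      next
        have "(\<Sum>e\<in>?E. K * (l * w e)) = K * l * (\<Sum>e\<in>?E. w e)" by (simp add: sum_distrib_left mult.assoc)
        also have "\<dots> \<le> K * l * (c * (\<eta> * m))"
        proof (rule mult_left_mono)
          have "real j \<le> \<eta> * m" using j J by (meson atLeastAtMost_iff of_nat_mono order_trans)
          then show "(\<Sum>e\<in>?E. w e) \<le> c * (\<eta> * m)" using w(3) c by (meson mult_left_mono less_imp_le order_trans)
        qed (use K l in auto)
        also have "\<dots> = l * m / 2" using K(1) c by (simp add: \<eta>_def)
        finally show "(\<Sum>e\<in>?E. K * (l * w e)) \<le> l * m / 2" .
      qed
    qed
  qed
qed

text \<open>The choice of \<open>lam j\<close> balances the two terms \<open>lam * m\<close> and \<open>lam powr q * V\<close> in the exponent, where \<open>q\<close> is the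
  exponent conjugate to \<open>r\<close>. The mean contributes \<open>lam * j\<close>, which is small against \<open>lam * m\<close> as \<open>J \<le> \<eta> * m\<close>.\<close>

lemma bad_vertex_superlinear:
  assumes r: "r > 1"
  shows "\<exists>\<eta>>0. \<exists>\<delta>>0. \<forall>m>0. \<forall>J x V. real J \<le> \<eta> * m \<longrightarrow>
    (\<forall>j\<in>{1..J}. 0 < V j \<and> (\<forall>I. 2 ^ I \<le> j + 1 \<longrightarrow> scale_sum d (r / (r - 1)) I \<le> V j)) \<longrightarrow>
    (covered_by (bad_vertex m J x) (real ((2 * J + 1) ^ (2 * d * J)) * exp (- (m / 2 * (\<Sum>j=1..J. \<delta> * (m / V j) powr (r - 1))))))"
proof -
  define q where "q = r / (r - 1)"
  have q: "q > 1" using r by (simp add: q_def field_simps)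
  have q1: "q - 1 = 1 / (r - 1)" using r by (simp add: q_def field_simps)
  obtain K where K: "K > 0" "\<And>e \<theta>. e \<in> edges d \<Longrightarrow> 0 \<le> \<theta> \<Longrightarrow>
    (\<integral>\<^sup>+\<omega>. ennreal (exp (\<theta> * \<tau> e \<omega>)) \<partial>M) \<le> ennreal (exp (K * (\<theta> + \<theta> powr q)))"
    using mgf_superlinear[OF r] unfolding q_def by blast
  obtain C where C: "C > 0" "\<And>x j I u v. j \<ge> 1 \<Longrightarrow> 2 ^ I \<le> j + 1 \<Longrightarrow> j + 1 < 2 ^ Suc I \<Longrightarrow>
    u \<in> sphere_at d x j \<Longrightarrow> v \<in> sphere_at d x j \<Longrightarrow>
    (\<exists>w. dominates_pair d (sphere_at d x j) u v w \<and>
      (\<Sum>e\<in>inner_edges d (sphere_at d x j). w e) \<le> C * real j \<and>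
      (\<Sum>e\<in>inner_edges d (sphere_at d x j). w e powr q) \<le> C * scale_sum d q I)"
    using ex_power_pair_weight[OF d2 q] by blast
  define \<eta> where "\<eta> = 1 / (4 * K * C)"
  define \<delta> where "\<delta> = (1 / (4 * K * C)) powr (r - 1)"
  have \<eta>: "\<eta> > 0" using K C by (simp add: \<eta>_def)
  have \<delta>: "\<delta> > 0" using K C by (simp add: \<delta>_def)
  \<comment> \<open>with this choice each of the two terms in the exponent is at most a quarter of \<open>lam j * m\<close>\<close>
  have \<delta>q: "\<delta> powr (q - 1) = 1 / (4 * K * C)" using K C r by (simp add: \<delta>_def q1 powr_powr)
  show ?thesis
  proof (rule exI[of _ \<eta>], rule conjI[OF \<eta>], rule exI[of _ \<delta>], rule conjI[OF \<delta>], intro allI impI)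
    fix m :: real and J x and V :: "nat \<Rightarrow> real"
    assume m: "m > 0" and J: "real J \<le> \<eta> * m"
      and V: "\<forall>j\<in>{1..J}. 0 < V j \<and> (\<forall>I. 2 ^ I \<le> j + 1 \<longrightarrow> scale_sum d (r / (r - 1)) I \<le> V j)"
    define lam where "lam j = \<delta> * (m / V j) powr (r - 1)" for j
    have lam: "lam j \<ge> 0" for j using \<delta> by (simp add: lam_def)
    show "covered_by (bad_vertex m J x) (real ((2 * J + 1) ^ (2 * d * J)) * exp (- (m / 2 * (\<Sum>j=1..J. \<delta> * (m / V j) powr (r - 1)))))"
      unfolding lam_def[symmetric]
    proof (rule bad_vertex_union_bound[OF m lam])
      fix j u v assume j: "j \<in> {1..J}" and uv: "u \<in> sphere_at d x j" "v \<in> sphere_at d x j"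
      let ?E = "inner_edges d (sphere_at d x j)"
      have Vj: "0 < V j" "\<And>I. 2 ^ I \<le> j + 1 \<Longrightarrow> scale_sum d q I \<le> V j" using V j unfolding q_def by auto
      obtain I where I: "2 ^ I \<le> j + 1" "j + 1 < 2 ^ Suc I"
        using ex_power_ivl1[of 2 "j + 1"] by auto
      obtain w where w: "dominates_pair d (sphere_at d x j) u v w" "(\<Sum>e\<in>?E. w e) \<le> C * real j"
          "(\<Sum>e\<in>?E. w e powr q) \<le> C * scale_sum d q I"
        using C(2)[OF _ I uv] j by auto
      have w0: "\<And>e. 0 \<le> w e" using w(1) by (simp add: dominates_pair_def)
      show "\<exists>w \<beta>. dominates_pair d (sphere_at d x j) u v w \<and>
        (\<forall>e\<in>?E. (\<integral>\<^sup>+\<omega>. ennreal (exp (lam j * w e * min (\<tau> e \<omega>) m)) \<partial>M) \<le> ennreal (exp (\<beta> e))) \<and>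
        (\<Sum>e\<in>?E. \<beta> e) \<le> lam j * m / 2"
      proof (intro exI conjI ballI)
        show "dominates_pair d (sphere_at d x j) u v w" by (rule w)
        fix e assume e: "e \<in> ?E"
        have th: "0 \<le> lam j * w e" using lam w0 by simp
        have "(\<integral>\<^sup>+\<omega>. ennreal (exp (lam j * w e * min (\<tau> e \<omega>) m)) \<partial>M) \<le> (\<integral>\<^sup>+\<omega>. ennreal (exp (lam j * w e * \<tau> e \<omega>)) \<partial>M)"
          by (intro nn_integral_mono ennreal_leI iffD2[OF exp_le_cancel_iff] mult_left_mono th) simp
        also have "\<dots> \<le> ennreal (exp (K * (lam j * w e + (lam j * w e) powr q)))"
          by (rule K(2)[OF _ th]) (use e in \<open>simp add: inner_edges_def\<close>)
        finally show "(\<integral>\<^sup>+\<omega>. ennreal (exp (lam j * w e * min (\<tau> e \<omega>) m)) \<partial>M)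
            \<le> ennreal (exp (K * (lam j * w e + (lam j * w e) powr q)))" .
      next
        have "(\<Sum>e\<in>?E. K * (lam j * w e + (lam j * w e) powr q))
            = K * lam j * (\<Sum>e\<in>?E. w e) + K * lam j powr q * (\<Sum>e\<in>?E. w e powr q)"
          using lam[of j] w0 by (simp add: powr_mult sum.distrib sum_distrib_left distrib_left mult.assoc)
        also have "\<dots> \<le> lam j * m / 4 + lam j * m / 4"
        proof (rule add_mono)
          have "real j \<le> \<eta> * m" using j J by (meson atLeastAtMost_iff of_nat_mono order_trans)
          then have "(\<Sum>e\<in>?E. w e) \<le> C * (\<eta> * m)" using w(2) C(1) by (meson mult_left_mono less_imp_le order_trans)
          then have "K * lam j * (\<Sum>e\<in>?E. w e) \<le> K * lam j * (C * (\<eta> * m))"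
            by (rule mult_left_mono) (use K lam in auto)
          also have "\<dots> = lam j * m / 4" using K(1) C(1) by (simp add: \<eta>_def)
          finally show "K * lam j * (\<Sum>e\<in>?E. w e) \<le> lam j * m / 4" .
          have mV: "m / V j > 0" using m Vj by simp
          have lpos: "lam j > 0" unfolding lam_def by (intro mult_pos_pos \<delta>) (use mV in \<open>simp only: powr_gt_zero\<close>)
          have "lam j powr (q - 1) = 1 / (4 * K * C) * (m / V j)"
          proof -
            have "lam j powr (q - 1) = \<delta> powr (q - 1) * ((m / V j) powr (r - 1)) powr (q - 1)"
              unfolding lam_def using \<delta> by (simp add: powr_mult)
            also have "((m / V j) powr (r - 1)) powr (q - 1) = m / V j"
            proof -
              have "(y powr (r - 1)) powr (q - 1) = y" if "y > 0" for y
                unfolding q1 using r that by (simp add: powr_powr)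
              then show ?thesis using mV by blast
            qed
            finally show ?thesis by (simp only: \<delta>q)
          qed
          then have lq: "lam j powr q = lam j * (1 / (4 * K * C) * (m / V j))"
            using lpos by (simp add: powr_diff field_simps)
          have "(\<Sum>e\<in>?E. w e powr q) \<le> C * V j"
            using w(3) Vj(2)[OF I(1)] C(1) by (meson mult_left_mono less_imp_le order_trans)
          then have "K * lam j powr q * (\<Sum>e\<in>?E. w e powr q) \<le> K * lam j powr q * (C * V j)"
            by (rule mult_left_mono) (use K in auto)
          also have "\<dots> = lam j * m / 4" unfolding lq using K(1) C(1) Vj(1) by simp
          finally show "K * lam j powr q * (\<Sum>e\<in>?E. w e powr q) \<le> lam j * m / 4" .
        qed
        finally show "(\<Sum>e\<in>?E. K * (lam j * w e + (lam j * w e) powr q)) \<le> lam j * m / 2" by (simp add: mult.commute)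
      qed
    qed
  qed
qed

end

section \<open>The cost of a bad vertex\<close>

text \<open>A vertex is bad at level \<open>m\<close> with probability at most \<open>exp (- c * cost_rate d r m)\<close>, for a constant \<open>c > 0\<close>
  and large \<open>m\<close>.\<close>

definition cost_rate :: "nat \<Rightarrow> real \<Rightarrow> real \<Rightarrow> real" where
  "cost_rate d r m =
    (if r < real d - 1 then m powr (1 + r)
     else if r = real d - 1 then m powr real d * ln m powr (- (real d - 2))
     else if r < real d then m powr real d
     else m powr real d * ln m)"

text \<open>The number of choices of the pairs of points on the spheres is \<open>exp (O(m * ln m))\<close>, negligible against
  the cost.\<close>

lemma entropy_negligible:
  fixes D s c \<eta> k :: real
  assumes "D > 1" "c > 0" "\<eta> > 0" "k > 0"
  shows "\<forall>\<^sub>F m in at_top. k * (\<eta> * m) * ln (2 * (\<eta> * m) + 1) \<le> c * (m powr D * ln m powr s)"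
  using assms by real_asymp

text \<open>The sign of \<open>r - (d - 1)\<close> decides whether this geometric sum converges.\<close>

lemma scale_sum_geometric:
  assumes "r > 1" "d \<ge> 2"
  shows "scale_sum d (r / (r - 1)) I = (\<Sum>i<Suc I. (2 powr ((r - (real d - 1)) / (r - 1))) ^ i)"
proof -
  have "1 - real (d - 2) * (r / (r - 1) - 1) = (r - (real d - 1)) / (r - 1)"
    using assms by (simp add: of_nat_diff field_simps)
  then show ?thesis unfolding scale_sum_def
    by (simp only: powr_powr[symmetric] powr_realpow powr_gt_zero mult.commute[of "real _"])
qed

context passage_percolation
begin

text \<open>The sum over the spheres \<open>j \<le> \<eta> * m\<close> of \<open>m * (m / V j) powr (r - 1)\<close>, where \<open>V j\<close> bounds the scale sum on the
  sphere of radius \<open>j\<close>: a constant below \<open>d - 1\<close>, a logarithm at \<open>d - 1\<close>, and a power of \<open>j\<close> above.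
  At \<open>r = d\<close> the terms are \<open>1 / j\<close> times \<open>m powr d\<close>, and the harmonic sum produces the logarithm in the cost.\<close>

lemma bad_vertex_decay_with_entropy:
  assumes r: "r \<le> real d"
  shows "\<exists>\<eta>>0. \<exists>c>0. \<forall>\<^sub>F m in at_top. \<forall>x. covered_by (bad_vertex m (nat \<lfloor>\<eta> * m\<rfloor>) x) (real ((2 * nat \<lfloor>\<eta> * m\<rfloor> + 1) ^ (2 * d * nat \<lfloor>\<eta> * m\<rfloor>)) * exp (- (c * cost_rate d r m)))"
proof (cases "r \<le> 1")
  case True
  obtain \<eta> \<delta> where \<eta>: "\<eta> > 0" and \<delta>: "\<delta> > 0" and bv: "\<forall>m>0. \<forall>J x. real J \<le> \<eta> * m \<longrightarrow>
    (covered_by (bad_vertex m J x) (real ((2 * J + 1) ^ (2 * d * J)) * exp (- (m / 2 * (\<Sum>j=1..J. \<delta> * m powr (r - 1))))))"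
    using bad_vertex_sublinear[OF True] by (elim exE conjE)
  define c where "c = \<eta> * \<delta> / 4"
  have "\<forall>\<^sub>F m in at_top. m > max (2 / \<eta>) 1" by (rule eventually_gt_at_top)
  then have "\<forall>\<^sub>F m in at_top. \<forall>x. covered_by (bad_vertex m (nat \<lfloor>\<eta> * m\<rfloor>) x) (real ((2 * nat \<lfloor>\<eta> * m\<rfloor> + 1) ^ (2 * d * nat \<lfloor>\<eta> * m\<rfloor>)) * exp (- (c * cost_rate d r m)))"
  proof eventually_elim
    case (elim m)
    define J where "J = nat \<lfloor>\<eta> * m\<rfloor>"
    have m: "m > 1" "\<eta> * m > 2" using elim \<eta> by (auto simp: field_simps)
    have J: "real J \<le> \<eta> * m" "\<eta> * m / 2 \<le> real J" unfolding J_def using m by linarith+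
    have "cost_rate d r m = m powr (1 + r)"
    proof (cases "r < real d - 1")
      case False
      then have "d = 2" "r = 1" using True d2 by linarith+
      then show ?thesis using m by (simp add: cost_rate_def)
    qed (simp add: cost_rate_def)
    also have "\<dots> = m * m * m powr (r - 1)" using m by (simp add: powr_add powr_diff)
    finally have "c * cost_rate d r m = m / 2 * (\<eta> * m / 2 * (\<delta> * m powr (r - 1)))" by (simp add: c_def)
    also have "\<dots> \<le> m / 2 * (real J * (\<delta> * m powr (r - 1)))"
      by (intro mult_left_mono mult_right_mono J) (use m \<delta> in auto)
    finally have le: "c * cost_rate d r m \<le> m / 2 * (\<Sum>j=1..J. \<delta> * m powr (r - 1))" by simp
    show ?case unfolding J_def[symmetric]
    proof
      fix x
      obtain B where B: "B \<in> events" "bad_vertex m J x \<subseteq> B"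
        "prob B \<le> real ((2 * J + 1) ^ (2 * d * J)) * exp (- (m / 2 * (\<Sum>j=1..J. \<delta> * m powr (r - 1))))"
        using bv[rule_format, OF _ J(1)] m by (meson less_trans zero_less_one)
      have "prob B \<le> real ((2 * J + 1) ^ (2 * d * J)) * exp (- (c * cost_rate d r m))"
        by (rule order_trans[OF B(3)], rule mult_left_mono) (use le in auto)
      then show "covered_by (bad_vertex m J x) (real ((2 * J + 1) ^ (2 * d * J)) * exp (- (c * cost_rate d r m)))"
        using B by blast
    qed
  qed
  then show ?thesis using \<eta> \<delta> unfolding c_def by (intro exI[of _ \<eta>] conjI exI[of _ "\<eta> * \<delta> / 4"]) auto
next
  case False
  then have r1: "r > 1" by simp
  define \<kappa> where "\<kappa> = (r - (real d - 1)) / (r - 1)"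
  define \<rho> where "\<rho> = 2 powr \<kappa>"
  have \<rho>0: "\<rho> > 0" by (simp add: \<rho>_def)
  have ss: "scale_sum d (r / (r - 1)) I = (\<Sum>i<Suc I. \<rho> ^ i)" for I
    unfolding \<rho>_def \<kappa>_def by (rule scale_sum_geometric[OF r1 d2])
  obtain \<eta> \<delta> where \<eta>: "\<eta> > 0" and \<delta>: "\<delta> > 0" and bv: "\<forall>m>0. \<forall>J x V. real J \<le> \<eta> * m \<longrightarrow>
    (\<forall>j\<in>{1..J}. 0 < V j \<and> (\<forall>I. 2 ^ I \<le> j + 1 \<longrightarrow> (\<Sum>i<Suc I. \<rho> ^ i) \<le> V j)) \<longrightarrow>
    (covered_by (bad_vertex m J x) (real ((2 * J + 1) ^ (2 * d * J)) * exp (- (m / 2 * (\<Sum>j=1..J. \<delta> * (m / V j) powr (r - 1))))))"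
    using bad_vertex_superlinear[OF r1] unfolding ss by (elim exE conjE)
  have suff: "\<exists>\<eta>>0. \<exists>c>0. \<forall>\<^sub>F m in at_top. \<forall>x. covered_by (bad_vertex m (nat \<lfloor>\<eta> * m\<rfloor>) x) (real ((2 * nat \<lfloor>\<eta> * m\<rfloor> + 1) ^ (2 * d * nat \<lfloor>\<eta> * m\<rfloor>)) * exp (- (c * cost_rate d r m)))"
    if c: "c > 0" and ev: "\<forall>\<^sub>F m in at_top. \<forall>J. \<eta> * m / 2 \<le> real J \<longrightarrow> real J \<le> \<eta> * m \<longrightarrow> \<eta> * m \<le> real J + 1 \<longrightarrow>
      (\<forall>j\<in>{1..J}. 0 < V m j \<and> (\<forall>I. 2 ^ I \<le> j + 1 \<longrightarrow> (\<Sum>i<Suc I. \<rho> ^ i) \<le> V m j)) \<and>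
      c * cost_rate d r m \<le> m / 2 * (\<Sum>j=1..J. \<delta> * (m / V m j) powr (r - 1))" for c V
  proof (intro exI conjI)
    show "\<eta> > 0" "c > 0" by fact+
    have "\<forall>\<^sub>F m in at_top. m > max (2 / \<eta>) 1" by (rule eventually_gt_at_top)
    with ev show "\<forall>\<^sub>F m in at_top. \<forall>x. covered_by (bad_vertex m (nat \<lfloor>\<eta> * m\<rfloor>) x) (real ((2 * nat \<lfloor>\<eta> * m\<rfloor> + 1) ^ (2 * d * nat \<lfloor>\<eta> * m\<rfloor>)) * exp (- (c * cost_rate d r m)))"
    proof eventually_elim
      case (elim m)
      define J where "J = nat \<lfloor>\<eta> * m\<rfloor>"
      have m: "m > 1" "\<eta> * m > 2" using elim(2) \<eta> by (auto simp: field_simps)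
      have J: "\<eta> * m / 2 \<le> real J" "real J \<le> \<eta> * m" "\<eta> * m \<le> real J + 1" unfolding J_def using m by linarith+
      have V: "\<forall>j\<in>{1..J}. 0 < V m j \<and> (\<forall>I. 2 ^ I \<le> j + 1 \<longrightarrow> (\<Sum>i<Suc I. \<rho> ^ i) \<le> V m j)"
        and le: "c * cost_rate d r m \<le> m / 2 * (\<Sum>j=1..J. \<delta> * (m / V m j) powr (r - 1))"
        using elim(1) J by blast+
      show ?case unfolding J_def[symmetric]
      proof
        fix x
        obtain B where B: "B \<in> events" "bad_vertex m J x \<subseteq> B"
          "prob B \<le> real ((2 * J + 1) ^ (2 * d * J)) * exp (- (m / 2 * (\<Sum>j=1..J. \<delta> * (m / V m j) powr (r - 1))))"
          using bv[rule_format, OF _ J(2), of "V m" x] V m by (meson less_trans zero_less_one)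
        have "prob B \<le> real ((2 * J + 1) ^ (2 * d * J)) * exp (- (c * cost_rate d r m))"
          by (rule order_trans[OF B(3)], rule mult_left_mono) (use le in auto)
        then show "covered_by (bad_vertex m J x) (real ((2 * J + 1) ^ (2 * d * J)) * exp (- (c * cost_rate d r m)))"
          using B by blast
      qed
    qed
  qed
  consider "r < real d - 1" | "r = real d - 1" | "r > real d - 1" by linarith
  then show ?thesis
  proof cases
    case 1
    have \<rho>1: "\<rho> < 1" unfolding \<rho>_def \<kappa>_def using 1 r1 by (intro powr_less_one) (auto simp: divide_less_0_iff)
    define V0 where "V0 = 1 / (1 - \<rho>)"
    have V0: "V0 > 0" using \<rho>1 by (simp add: V0_def)
    have V0': "(\<Sum>i<Suc I. \<rho> ^ i) \<le> V0" for I
      unfolding V0_def sum_gp_strict using \<rho>1 \<rho>0 by (simp add: divide_right_mono)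
    define c where "c = \<eta> * \<delta> / 4 / V0 powr (r - 1)"
    have c: "c > 0" using \<eta> \<delta> V0 by (simp add: c_def)
    show ?thesis
    proof (rule suff[OF c, of "\<lambda>_ _. V0"])
      show "\<forall>\<^sub>F m in at_top. \<forall>J. \<eta> * m / 2 \<le> real J \<longrightarrow> real J \<le> \<eta> * m \<longrightarrow> \<eta> * m \<le> real J + 1 \<longrightarrow>
        (\<forall>j\<in>{1..J}. 0 < V0 \<and> (\<forall>I. 2 ^ I \<le> j + 1 \<longrightarrow> (\<Sum>i<Suc I. \<rho> ^ i) \<le> V0)) \<and>
        c * cost_rate d r m \<le> m / 2 * (\<Sum>j=1..J. \<delta> * (m / V0) powr (r - 1))"
        using eventually_gt_at_top[of 1]
      proof (eventually_elim, intro allI impI conjI)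
        fix m :: real and J assume m: "1 < m" and J: "\<eta> * m / 2 \<le> real J"
        have "cost_rate d r m = m * m * m powr (r - 1)"
          using m 1 by (simp add: cost_rate_def powr_add powr_diff)
        then have "c * cost_rate d r m = m / 2 * (\<eta> * m / 2 * (\<delta> * (m / V0) powr (r - 1)))"
          using m V0 by (simp add: c_def powr_divide)
        also have "\<dots> \<le> m / 2 * (real J * (\<delta> * (m / V0) powr (r - 1)))"
          by (intro mult_left_mono mult_right_mono J) (use m \<delta> in auto)
        finally show "c * cost_rate d r m \<le> m / 2 * (\<Sum>j=1..J. \<delta> * (m / V0) powr (r - 1))" by simp
      qed (use V0 V0' in auto)
    qed
  next
    case 2
    have \<rho>1: "\<rho> = 1" unfolding \<rho>_def \<kappa>_def using 2 by simp
    define c where "c = \<eta> * \<delta> / 4 / 4 powr (r - 1)"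
    have c: "c > 0" using \<eta> \<delta> by (simp add: c_def)
    have "\<forall>\<^sub>F m in at_top. ln (\<eta> * m + 1) / ln 2 + 1 \<le> 4 * ln m"
    proof -
      have "(1::real) < 2 * ln 2" using ln2_ge_two_thirds by simp
      then have l2: "1 / ln 2 < (2::real)" by (simp add: field_simps)
      have "\<forall>\<^sub>F m in at_top. 2 * ln (\<eta> * m + 1) + 1 \<le> 4 * ln m" using \<eta> by real_asymp
      then show ?thesis using eventually_gt_at_top[of 1]
      proof eventually_elim
        case (elim m)
        have "ln (\<eta> * m + 1) * (1 / ln 2) \<le> ln (\<eta> * m + 1) * 2"
          by (intro mult_left_mono) (use l2 elim \<eta> in auto)
        then show ?case using elim(1) by simp
      qed
    qed
    then have ev: "\<forall>\<^sub>F m in at_top. ln (\<eta> * m + 1) / ln 2 + 1 \<le> 4 * ln m \<and> m > 1"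
      using eventually_gt_at_top[of 1] by (rule eventually_conj)
    show ?thesis
    proof (rule suff[OF c, of "\<lambda>m _. 4 * ln m"])
      show "\<forall>\<^sub>F m in at_top. \<forall>J. \<eta> * m / 2 \<le> real J \<longrightarrow> real J \<le> \<eta> * m \<longrightarrow> \<eta> * m \<le> real J + 1 \<longrightarrow>
        (\<forall>j\<in>{1..J}. 0 < 4 * ln m \<and> (\<forall>I. 2 ^ I \<le> j + 1 \<longrightarrow> (\<Sum>i<Suc I. \<rho> ^ i) \<le> 4 * ln m)) \<and>
        c * cost_rate d r m \<le> m / 2 * (\<Sum>j=1..J. \<delta> * (m / (4 * ln m)) powr (r - 1))"
        using ev
      proof (eventually_elim, intro allI impI conjI ballI)
        fix m :: real and J j I assume m: "ln (\<eta> * m + 1) / ln 2 + 1 \<le> 4 * ln m \<and> 1 < m"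
          and J: "real J \<le> \<eta> * m" and j: "j \<in> {1..J}" and I: "(2::nat) ^ I \<le> j + 1"
        have "real (2 ^ I) \<le> real (j + 1)" using I by (simp only: of_nat_le_iff)
        also have "\<dots> \<le> \<eta> * m + 1" using j J by (simp add: order_trans[OF of_nat_mono])
        finally have le2: "(2::real) ^ I \<le> \<eta> * m + 1" by simp
        have "(0::real) < 2 ^ I" by simp
        from this less_le_trans[OF this le2] have "ln (2 ^ I) \<le> ln (\<eta> * m + 1)"
          using le2 by (simp only: ln_le_cancel_iff)
        then have "real I * ln 2 \<le> ln (\<eta> * m + 1)" by (simp add: ln_realpow)
        then have "real I \<le> ln (\<eta> * m + 1) / ln 2" by (simp add: pos_le_divide_eq)
        then show "(\<Sum>i<Suc I. \<rho> ^ i) \<le> 4 * ln m" using m unfolding \<rho>1 by simp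
      next
        fix m :: real and J assume m: "ln (\<eta> * m + 1) / ln 2 + 1 \<le> 4 * ln m \<and> 1 < m" and J: "\<eta> * m / 2 \<le> real J"
        have "cost_rate d r m = m * m * m powr (r - 1) / ln m powr (r - 1)"
        proof -
          have "real d = 2 + (r - 1)" "- (real d - 2) = - (r - 1)" using 2 by simp_all
          then have "cost_rate d r m = m powr (2 + (r - 1)) * ln m powr (- (r - 1))"
            using 2 by (simp add: cost_rate_def)
          also have "\<dots> = m * m * m powr (r - 1) / ln m powr (r - 1)"
            using m by (simp only: powr_add powr_minus divide_inverse) (simp add: powr_numeral power2_eq_square)
          finally show ?thesis .
        qed
        then have "c * cost_rate d r m = m / 2 * (\<eta> * m / 2 * (\<delta> * (m / (4 * ln m)) powr (r - 1)))"
          using m by (simp add: c_def powr_divide powr_mult mult_ac)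
        also have "\<dots> \<le> m / 2 * (real J * (\<delta> * (m / (4 * ln m)) powr (r - 1)))"
          by (intro mult_left_mono mult_right_mono J) (use m \<delta> in auto)
        finally show "c * cost_rate d r m \<le> m / 2 * (\<Sum>j=1..J. \<delta> * (m / (4 * ln m)) powr (r - 1))" by simp
      qed auto
    qed
  next
    case 3
    have \<kappa>0: "\<kappa> > 0" unfolding \<kappa>_def using 3 r1 by simp
    have \<rho>1: "\<rho> > 1" unfolding \<rho>_def using \<kappa>0 by simp
    define C2 where "C2 = \<rho> / (\<rho> - 1) * 2 powr \<kappa>"
    have C2: "C2 > 0" using \<rho>1 by (simp add: C2_def)
    define V where "V j = C2 * real j powr \<kappa>" for j :: nat
    have Vp: "0 < V j" if "j \<ge> 1" for j using that C2 by (simp add: V_def)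
    have Vb: "(\<Sum>i<Suc I. \<rho> ^ i) \<le> V j" if j: "j \<ge> 1" and I: "(2::nat) ^ I \<le> j + 1" for I j
    proof -
      have "(\<Sum>i<Suc I. \<rho> ^ i) = (\<rho> ^ Suc I - 1) / (\<rho> - 1)" using \<rho>1 by (subst sum_gp_strict) (auto simp: field_simps)
      also have "\<dots> \<le> \<rho> ^ Suc I / (\<rho> - 1)" using \<rho>1 by (intro divide_right_mono) auto
      also have "\<dots> = \<rho> / (\<rho> - 1) * \<rho> ^ I" by simp
      also have "\<dots> \<le> \<rho> / (\<rho> - 1) * (2 powr \<kappa> * real j powr \<kappa>)"
      proof (rule mult_left_mono)
        have "\<rho> ^ I = (2 ^ I) powr \<kappa>"
          unfolding \<rho>_def by (simp add: powr_realpow[symmetric] powr_powr mult.commute)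
        also have "\<dots> \<le> (2 * real j) powr \<kappa>"
        proof (rule powr_mono2)
          have "real (2 ^ I) \<le> real (j + 1)" using I by (simp only: of_nat_le_iff)
          then show "2 ^ I \<le> 2 * real j" using j by simp
        qed (use \<kappa>0 in auto)
        also have "\<dots> = 2 powr \<kappa> * real j powr \<kappa>" by (simp add: powr_mult)
        finally show "\<rho> ^ I \<le> 2 powr \<kappa> * real j powr \<kappa>" .
      qed (use \<rho>1 in auto)
      finally show ?thesis by (simp only: V_def C2_def mult.assoc)
    qed
    have \<kappa>r: "\<kappa> * (r - 1) = r - real d + 1" unfolding \<kappa>_def using r1 by simp
    have summand: "\<delta> * (m / V j) powr (r - 1) = \<delta> / C2 powr (r - 1) * m powr (r - 1) * real j powr (- (r - real d + 1))"
      if "m > 1" "j \<ge> 1" for m j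
    proof -
      have "(m / V j) powr (r - 1) = m powr (r - 1) / (C2 powr (r - 1) * real j powr (\<kappa> * (r - 1)))"
        unfolding V_def using that C2 by (simp add: powr_divide powr_mult powr_powr)
      then show ?thesis unfolding \<kappa>r powr_minus by (simp add: divide_inverse mult_ac)
    qed
    show ?thesis
    proof (cases "r < real d")
      case True
      define c where "c = \<delta> / C2 powr (r - 1) / 2 * (\<eta> / 2) powr (real d - r)"
      have c: "c > 0" using \<eta> \<delta> C2 by (simp add: c_def)
      show ?thesis
      proof (rule suff[OF c, of "\<lambda>_. V"])
        show "\<forall>\<^sub>F m in at_top. \<forall>J. \<eta> * m / 2 \<le> real J \<longrightarrow> real J \<le> \<eta> * m \<longrightarrow> \<eta> * m \<le> real J + 1 \<longrightarrow>
          (\<forall>j\<in>{1..J}. 0 < V j \<and> (\<forall>I. 2 ^ I \<le> j + 1 \<longrightarrow> (\<Sum>i<Suc I. \<rho> ^ i) \<le> V j)) \<and>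
          c * cost_rate d r m \<le> m / 2 * (\<Sum>j=1..J. \<delta> * (m / V j) powr (r - 1))"
          using eventually_gt_at_top[of 1]
        proof (eventually_elim, intro allI impI conjI)
          fix m :: real and J assume m: "1 < m" and J: "\<eta> * m / 2 \<le> real J"
          have Jpos: "real J > 0" using less_le_trans[OF _ J, of 0] m \<eta> by simp
          have "c * cost_rate d r m = \<delta> / C2 powr (r - 1) / 2 * (m powr (1 + (r - 1)) * (\<eta> * m / 2) powr (real d - r))"
          proof -
            have "(\<eta> * m / 2) powr (real d - r) = (\<eta> / 2) powr (real d - r) * m powr (real d - r)"
              using m \<eta> by (simp add: powr_mult[symmetric])
            moreover have "m powr (1 + (r - 1)) * m powr (real d - r) = m powr real d" by (simp add: powr_add[symmetric])
            moreover have "cost_rate d r m = m powr real d" using 3 True by (simp add: cost_rate_def)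
            ultimately show ?thesis by (simp add: c_def mult_ac)
          qed
          also have "\<dots> \<le> \<delta> / C2 powr (r - 1) / 2 * (m powr (1 + (r - 1)) * real J powr (real d - r))"
            by (intro mult_left_mono powr_mono2 J) (use m \<delta> \<eta> C2 True in auto)
          also have "m powr (1 + (r - 1)) = m * m powr (r - 1)" using m by (simp only: powr_add powr_one)
          also have "real J powr (real d - r) = real J * real J powr (- (r - real d + 1))"
          proof -
            have "real d - r = 1 + - (r - real d + 1)" by simp
            then have "real J powr (real d - r) = real J powr 1 * real J powr (- (r - real d + 1))" by (simp only: powr_add)
            then show ?thesis using Jpos by simp
          qed
          also have "\<dots> = (\<Sum>j=1..J. real J powr (- (r - real d + 1)))" by simp
          also have "\<delta> / C2 powr (r - 1) / 2 * (m * m powr (r - 1) * \<dots>) \<le> \<delta> / C2 powr (r - 1) / 2 * (m * m powr (r - 1) * (\<Sum>j=1..J. real j powr (- (r - real d + 1))))"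
            by (intro mult_left_mono sum_mono powr_mono2') (use m \<delta> 3 in auto)
          also have "\<dots> = m / 2 * (\<Sum>j=1..J. \<delta> / C2 powr (r - 1) * m powr (r - 1) * real j powr (- (r - real d + 1)))"
            by (simp add: sum_distrib_left mult_ac)
          also have "\<dots> = m / 2 * (\<Sum>j=1..J. \<delta> * (m / V j) powr (r - 1))"
            by (intro arg_cong2[where f = "(*)"] refl sum.cong summand[symmetric]) (use m in auto)
          finally show "c * cost_rate d r m \<le> m / 2 * (\<Sum>j=1..J. \<delta> * (m / V j) powr (r - 1))" .
        qed (use Vp Vb in auto)
      qed
    next
      case False
      then have rd: "r = real d" using r by simp
      define c where "c = \<delta> / C2 powr (r - 1) / 4"
      have c: "c > 0" using \<delta> C2 by (simp add: c_def)
      have "\<forall>\<^sub>F m in at_top. ln m / 2 \<le> ln (\<eta> * m)" using \<eta> by real_asymp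
      then have ev: "\<forall>\<^sub>F m in at_top. ln m / 2 \<le> ln (\<eta> * m) \<and> m > 1"
        using eventually_gt_at_top[of 1] by (rule eventually_conj)
      show ?thesis
      proof (rule suff[OF c, of "\<lambda>_. V"])
        show "\<forall>\<^sub>F m in at_top. \<forall>J. \<eta> * m / 2 \<le> real J \<longrightarrow> real J \<le> \<eta> * m \<longrightarrow> \<eta> * m \<le> real J + 1 \<longrightarrow>
          (\<forall>j\<in>{1..J}. 0 < V j \<and> (\<forall>I. 2 ^ I \<le> j + 1 \<longrightarrow> (\<Sum>i<Suc I. \<rho> ^ i) \<le> V j)) \<and>
          c * cost_rate d r m \<le> m / 2 * (\<Sum>j=1..J. \<delta> * (m / V j) powr (r - 1))"
          using ev
        proof (eventually_elim, intro allI impI conjI)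
          fix m :: real and J assume m: "ln m / 2 \<le> ln (\<eta> * m) \<and> 1 < m" and J: "\<eta> * m \<le> real J + 1"
          have "ln (\<eta> * m) \<le> ln (real J + 1)" using m \<eta> J by simp
          also have "\<dots> \<le> harm J" by (rule ln_le_harm)
          finally have h: "ln m / 2 \<le> harm J" using m by simp
          have "cost_rate d r m = m * m powr (r - 1) * ln m" using m 3 False rd by (simp add: cost_rate_def powr_diff)
          then have "c * cost_rate d r m = \<delta> / C2 powr (r - 1) / 2 * (m * m powr (r - 1) * (ln m / 2))"
            by (simp add: c_def)
          also have "\<dots> \<le> \<delta> / C2 powr (r - 1) / 2 * (m * m powr (r - 1) * harm J)"
            by (intro mult_left_mono h) (use m \<delta> in auto)
          also have "\<dots> = m / 2 * (\<Sum>j=1..J. \<delta> / C2 powr (r - 1) * m powr (r - 1) * real j powr (- (r - real d + 1)))"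
            unfolding rd harm_def by (simp add: sum_distrib_left powr_minus mult_ac)
          also have "\<dots> = m / 2 * (\<Sum>j=1..J. \<delta> * (m / V j) powr (r - 1))"
            by (intro arg_cong2[where f = "(*)"] refl sum.cong summand[symmetric]) (use m in auto)
          finally show "c * cost_rate d r m \<le> m / 2 * (\<Sum>j=1..J. \<delta> * (m / V j) powr (r - 1))" .
        qed (use Vp Vb in auto)
      qed
    qed
  qed
qed

lemma bad_vertex_decay:
  assumes r: "r \<le> real d"
  shows "\<exists>\<eta>>0. \<exists>c>0. \<forall>\<^sub>F m in at_top. \<forall>x. covered_by (bad_vertex m (nat \<lfloor>\<eta> * m\<rfloor>) x) (exp (- (c * cost_rate d r m)))"
proof -
  obtain \<eta> c where \<eta>: "\<eta> > 0" and c: "c > 0" and ev: "\<forall>\<^sub>F m in at_top. \<forall>x. covered_by (bad_vertex m (nat \<lfloor>\<eta> * m\<rfloor>) x) (real ((2 * nat \<lfloor>\<eta> * m\<rfloor> + 1) ^ (2 * d * nat \<lfloor>\<eta> * m\<rfloor>)) * exp (- (c * cost_rate d r m)))"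
    using bad_vertex_decay_with_entropy[OF r] by (elim exE conjE)
  have "\<forall>\<^sub>F m in at_top. real (2 * d) * (\<eta> * m) * ln (2 * (\<eta> * m) + 1) \<le> c / 2 * cost_rate d r m"
  proof -
    define D where "D = (if r < real d - 1 then 1 + r else real d)"
    define s where "s = (if r < real d - 1 then 0 else if r = real d - 1 then - (real d - 2) else if r < real d then 0 else 1)"
    have D: "D > 1" using r_pos d2 by (simp add: D_def)
    have "\<forall>\<^sub>F m in at_top. real (2 * d) * (\<eta> * m) * ln (2 * (\<eta> * m) + 1) \<le> c / 2 * (m powr D * ln m powr s)"
      by (rule entropy_negligible[OF D]) (use c \<eta> d2 in auto)
    then show ?thesis using eventually_gt_at_top[of 1]
    proof eventually_elim
      case (elim m)
      have "cost_rate d r m = m powr D * ln m powr s"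
        using elim(2) by (simp add: cost_rate_def D_def s_def)
      then show ?case using elim(1) by simp
    qed
  qed
  then have "\<forall>\<^sub>F m in at_top. \<forall>x. covered_by (bad_vertex m (nat \<lfloor>\<eta> * m\<rfloor>) x) (exp (- (c / 2 * cost_rate d r m)))"
    using ev eventually_gt_at_top[of 0]
  proof eventually_elim
    case (elim m)
    define J where "J = nat \<lfloor>\<eta> * m\<rfloor>"
    have m0: "0 \<le> \<eta> * m" using elim(3) \<eta> by simp
    have J: "real J \<le> \<eta> * m" unfolding J_def using m0 by linarith
    have "real ((2 * J + 1) ^ (2 * d * J)) = exp (real (2 * d * J) * ln (2 * real J + 1))"
      by (simp add: exp_of_nat_mult[symmetric] flip: powr_realpow) (simp add: powr_def)
    also have "\<dots> \<le> exp (real (2 * d) * (\<eta> * m) * ln (2 * (\<eta> * m) + 1))"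
      unfolding of_nat_mult[of "2 * d" J] by (intro iffD2[OF exp_le_cancel_iff] mult_mono) (use J m0 in auto)
    also have "\<dots> \<le> exp (c / 2 * cost_rate d r m)" using elim(1) by simp
    finally have le: "real ((2 * J + 1) ^ (2 * d * J)) \<le> exp (c / 2 * cost_rate d r m)" .
    show ?case unfolding J_def[symmetric]
    proof
      fix x
      obtain B where B: "B \<in> events" "bad_vertex m J x \<subseteq> B"
        "prob B \<le> real ((2 * J + 1) ^ (2 * d * J)) * exp (- (c * cost_rate d r m))"
        using elim(2) unfolding J_def by blast
      note B(3)
      also have "real ((2 * J + 1) ^ (2 * d * J)) * exp (- (c * cost_rate d r m)) \<le> exp (c / 2 * cost_rate d r m) * exp (- (c * cost_rate d r m))"
        by (rule mult_right_mono[OF le]) simp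
      also have "\<dots> = exp (- (c / 2 * cost_rate d r m))" by (simp add: exp_add[symmetric])
      finally show "covered_by (bad_vertex m J x) (exp (- (c / 2 * cost_rate d r m)))"
        using B by blast
    qed
  qed
  then show ?thesis using \<eta> c by (intro exI[of _ \<eta>] conjI exI[of _ "c / 2"]) auto
qed

end

section \<open>Optimal paths through heavy edges\<close>

lemma path_meets_sphere:
  assumes "xs \<noteq> []" "successively (adjacent d) xs" "hd xs \<in> lbox d x j" "last xs \<notin> lbox d x (j - 1)" "j \<ge> 1"
  shows "\<exists>z\<in>set xs. z \<in> sphere_at d x j"
  using assms
proof (induction xs rule: induct_list012)
  case (3 h h' zs)
  show ?case
  proof (cases "h \<in> lbox d x (j - 1)")
    case True
    have "h' \<in> lbox d x (Suc (j - 1))" using adjacent_lbox_Suc[OF _ True] 3(4) by auto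
    then have "\<exists>z\<in>set (h' # zs). z \<in> sphere_at d x j" using 3 by (intro 3(2)) auto
    then show ?thesis by auto
  next
    case False
    then show ?thesis using 3(5) by (auto simp: sphere_at_def)
  qed
qed (auto simp: sphere_at_def)

lemma path_edge_split:
  "e \<in> set (path_edges xs) \<Longrightarrow> \<exists>ys x y zs. xs = ys @ x # y # zs \<and> e = {x, y}"
proof (induction xs rule: induct_list012)
  case (3 h h' zs)
  show ?case
  proof (cases "e = {h, h'}")
    case True
    then show ?thesis by (intro exI[of _ "[]"]) auto
  next
    case False
    then obtain ys x y ws where "h' # zs = ys @ x # y # ws" "e = {x, y}" using 3 by auto
    then show ?thesis by (intro exI[of _ "h # ys"]) auto
  qed
qed auto

lemma optimal_paths_iff:
  assumes t: "\<And>e. e \<in> edges d \<Longrightarrow> 0 \<le> t e"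
  shows "\<gamma> \<in> optimal_paths d t v w \<longleftrightarrow> \<gamma> \<in> paths d v w \<and> (\<forall>xs\<in>paths d v w. path_time t \<gamma> \<le> path_time t xs)"
proof
  assume "\<gamma> \<in> optimal_paths d t v w"
  then show "\<gamma> \<in> paths d v w \<and> (\<forall>xs\<in>paths d v w. path_time t \<gamma> \<le> path_time t xs)"
    using optimal_path_le[OF t] by (auto simp: optimal_paths_def)
next
  assume g: "\<gamma> \<in> paths d v w \<and> (\<forall>xs\<in>paths d v w. path_time t \<gamma> \<le> path_time t xs)"
  have "passage_time d t v w \<le> path_time t \<gamma>" unfolding passage_time_def
    by (rule cINF_lower) (use g path_time_nonneg[OF _ t] in \<open>auto intro!: bdd_belowI[of _ 0]\<close>)
  moreover have "path_time t \<gamma> \<le> passage_time d t v w" unfolding passage_time_def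
    by (rule cINF_greatest) (use g in auto)
  ultimately show "\<gamma> \<in> optimal_paths d t v w" using g by (simp add: optimal_paths_def)
qed

text \<open>Replacing the stretch of an optimal path between a vertex before and a vertex after a heavy
  edge by any other path cannot save time, so these two vertices are far apart.\<close>

lemma heavy_edge_on_optimal_path:
  assumes t: "\<And>e. e \<in> edges d \<Longrightarrow> 0 \<le> t e"
    and g: "\<gamma> \<in> optimal_paths d t v0 w0" and dec: "\<gamma> = ys @ x # y # zs"
    and heavy: "m \<le> t {x, y}" and far: "v0 \<notin> lbox d x J" "w0 \<notin> lbox d x J" and j: "j \<in> {1..J}"
  shows "\<exists>u\<in>sphere_at d x j. \<exists>v\<in>sphere_at d x j. \<forall>xs\<in>paths d u v. m \<le> path_time t xs"
proof -
  have gp: "\<gamma> \<in> paths d v0 w0" using g by (simp add: optimal_paths_def)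
  have p1: "ys @ [x] \<in> paths d v0 x" and p2: "[x] @ y # zs \<in> paths d x w0"
    using gp paths_split[of ys x "y # zs" d v0 w0] dec by auto
  have p3: "[x] @ [y] \<in> paths d x y" and p4: "y # zs \<in> paths d y w0"
    using p2 paths_split[of "[x]" y zs d x w0] by auto
  have adj: "adjacent d x y" and xl: "x \<in> lattice d" using p3 by (auto simp: paths_def)
  have out: "v0 \<notin> lbox d x (j - 1)" "w0 \<notin> lbox d x (j - 1)"
  proof -
    have "j - 1 \<le> J" using j by (cases j) auto
    then show "v0 \<notin> lbox d x (j - 1)" "w0 \<notin> lbox d x (j - 1)"
      using far lbox_mono[of "j - 1" J d x] by auto
  qed
  have "\<exists>u\<in>set (rev (ys @ [x])). u \<in> sphere_at d x j"
  proof (rule path_meets_sphere)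
    have "successively (adjacent d) (ys @ [x])" using p1 by (simp add: paths_def)
    moreover have "(\<lambda>v w. adjacent d w v) = adjacent d" using adjacent_sym by blast
    ultimately show "successively (adjacent d) (rev (ys @ [x]))" by (simp only: successively_rev)
    show "hd (rev (ys @ [x])) \<in> lbox d x j" using lbox_self[OF xl] by simp
    have "last (rev (ys @ [x])) = hd (ys @ [x])" by (rule last_rev)
    also have "\<dots> = v0" using p1 by (simp add: paths_def)
    finally show "last (rev (ys @ [x])) \<notin> lbox d x (j - 1)" using out by simp
  qed (use j in auto)
  then obtain u where u: "u \<in> set (ys @ [x])" "u \<in> sphere_at d x j" by auto
  have "\<exists>v\<in>set (y # zs). v \<in> sphere_at d x j"
  proof (rule path_meets_sphere)
    show "hd (y # zs) \<in> lbox d x j" using adjacent_lbox[OF adj] lbox_mono[of 1 j d x] j by auto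
  qed (use p4 out j in \<open>auto simp: paths_def\<close>)
  then obtain v where v: "v \<in> set (y # zs)" "v \<in> sphere_at d x j" by auto
  obtain as bs where ab: "ys @ [x] = as @ u # bs" using u(1) by (meson split_list)
  obtain cs ds where cd: "y # zs = cs @ v # ds" using v(1) by (meson split_list)
  have q1: "as @ [u] \<in> paths d v0 u" and q2: "u # bs \<in> paths d u x"
    using p1 paths_split[of as u bs d v0 x] unfolding ab by auto
  have q3: "cs @ [v] \<in> paths d y v" and q4: "v # ds \<in> paths d v w0"
    using p4 paths_split[of cs v ds d y w0] unfolding cd by auto
  have time: "path_time t \<gamma> = path_time t (as @ [u]) + path_time t (u # bs) + t {x, y}
      + path_time t (cs @ [v]) + path_time t (v # ds)"
  proof -
    have "path_time t \<gamma> = path_time t (ys @ [x]) + path_time t (x # y # zs)"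
      unfolding dec by (rule path_time_append)
    moreover have "path_time t (ys @ [x]) = path_time t (as @ [u]) + path_time t (u # bs)"
      unfolding ab by (rule path_time_append)
    moreover have "path_time t (y # zs) = path_time t (cs @ [v]) + path_time t (v # ds)"
      unfolding cd by (rule path_time_append)
    ultimately show ?thesis by simp
  qed
  have "m \<le> path_time t xs" if xs: "xs \<in> paths d u v" for xs
  proof -
    note j1 = paths_join[OF q1 xs]
    note j2 = paths_join[OF j1(1) q4]
    have "path_time t \<gamma> \<le> path_time t (as @ [u]) + path_time t xs + path_time t (v # ds)"
      using optimal_path_le[OF t g j2(1)] j2(2)[of t] j1(2)[of t] by simp
    moreover have "0 \<le> path_time t (u # bs)" "0 \<le> path_time t (cs @ [v])"
      using path_time_nonneg[OF q2 t] path_time_nonneg[OF q3 t] by auto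
    ultimately show ?thesis using time heavy by simp
  qed
  then show ?thesis using u(2) v(2) by blast
qed

lemma countable_lattice: "countable (lattice d)"
proof -
  have "lattice d \<subseteq> (\<Union>n. lbox d origin n)"
  proof
    fix x assume "x \<in> lattice d"
    then show "x \<in> (\<Union>n. lbox d origin n)" using finite_subset_lbox[of "{x}" d origin] by auto
  qed
  then show ?thesis by (rule countable_subset) (auto intro: countable_finite)
qed

lemma countable_paths: "countable (paths d v w)"
  by (rule countable_subset[OF _ countable_lists[OF countable_lattice[of d]]]) (auto simp: paths_def)

section \<open>Asymptotics of the rate function\<close>

lemma log_powers_at_top:
  fixes C p s :: real
  assumes "C > 0" "p > 0"
  shows "filterlim (\<lambda>L::real. C * (L powr p * ln L powr s)) at_top at_top"
  using assms by real_asymp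

lemma log_powers_upper:
  fixes C p s :: real
  assumes "C > 0" "0 < p" "p < 1"
  shows "\<forall>\<^sub>F L::real in at_top. C * (L powr p * ln L powr s) \<le> L"
  using assms by real_asymp

lemma log_powers_lower:
  fixes C p s :: real
  assumes "C > 0" "0 < p"
  shows "\<forall>\<^sub>F L::real in at_top. L powr (p / 2) \<le> C * (L powr p * ln L powr s)"
  using assms by real_asymp

lemma ln_real_at_top: "filterlim (\<lambda>N::nat. ln (real N)) at_top sequentially"
  by real_asymp

text \<open>The rate is \<open>L powr p * ln L powr s\<close> with \<open>L = ln N\<close> in all five cases.\<close>

definition rate_exponents :: "nat \<Rightarrow> real \<Rightarrow> real \<times> real" where
  "rate_exponents d r =
    (if r < real d - 1 then (1 / (1 + r), 0)
     else if r = real d - 1 then (1 / real d, (real d - 2) / real d)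
     else if r < real d then (1 / real d, 0)
     else if r = real d then (1 / real d, - 1 / real d)
     else (1 / r, 0))"

lemma f_rate_eq:
  assumes "r > 0" "rate_exponents d r = (p, s)" "ln (real N) > 1"
  shows "f_rate d r N = ln (real N) powr p * ln (ln (real N)) powr s"
proof -
  have "ln (ln (real N)) > 0" using assms(3) by simp
  then show ?thesis using assms by (auto simp: f_rate_def rate_exponents_def Let_def split: if_splits)
qed

lemma rate_exponents_pos: "r > 0 \<Longrightarrow> d \<ge> 2 \<Longrightarrow> rate_exponents d r = (p, s) \<Longrightarrow> p > 0"
  by (auto simp: rate_exponents_def split: if_splits)

lemma eventually_ln_gt_1: "\<forall>\<^sub>F N::nat in sequentially. ln (real N) > 1"
  using ln_real_at_top by (auto simp: filterlim_at_top_dense)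

lemma f_rate_at_top:
  assumes "r > 0" "d \<ge> 2" "C > 0"
  shows "filterlim (\<lambda>N. C * f_rate d r N) at_top sequentially"
proof -
  obtain p s where ps: "rate_exponents d r = (p, s)" by (cases "rate_exponents d r")
  have p: "p > 0" by (rule rate_exponents_pos[OF assms(1,2) ps])
  have "filterlim (\<lambda>N. C * (ln (real N) powr p * ln (ln (real N)) powr s)) at_top sequentially"
    by (rule filterlim_compose[OF log_powers_at_top[OF assms(3) p] ln_real_at_top])
  moreover have "\<forall>\<^sub>F N in sequentially. C * (ln (real N) powr p * ln (ln (real N)) powr s) = C * f_rate d r N"
    using eventually_ln_gt_1 by eventually_elim (simp add: f_rate_eq[OF assms(1) ps])
  ultimately show ?thesis by (rule filterlim_mono_eventually[OF _ order_refl order_refl])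
qed

text \<open>The rate inverts the cost: up to constants, \<open>cost_rate\<close> at \<open>C * f_rate\<close> is \<open>ln N\<close>. In the two
  logarithmic cases this uses that \<open>ln (f_rate d r N)\<close> is of the order of \<open>ln (ln N)\<close>. The factor
  \<open>C\<close> on the left makes the probability of a bad vertex smaller than any prescribed power of \<open>N\<close>.\<close>

lemma cost_rate_of_f_rate:
  assumes r: "0 < r" "r \<le> real d" and d: "d \<ge> 2" and C: "C \<ge> 1"
  shows "\<forall>\<^sub>F N in sequentially. C * ln (real N) / (2 * real d) \<le> cost_rate d r (C * f_rate d r N)"
proof -
  have C0: "C > 0" using C by simp
  have Cp: "C \<le> C powr e" if "e \<ge> 1" for e
    using powr_mono[OF that C] C by simp
  have half: "C * L / (2 * real d) \<le> C powr e * L" if "e \<ge> 1" "L > 0" for e L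
  proof -
    have "0 \<le> C * L" using that C by simp
    then have "C * L / (2 * real d) \<le> C * L" using d by (simp add: divide_le_eq mult_le_cancel_left1)
    also have "\<dots> \<le> C powr e * L" using Cp[OF that(1)] that(2) by (simp add: mult_right_mono)
    finally show ?thesis .
  qed
  have d1: "real d \<ge> 1" using d by simp
  consider "r < real d - 1" | "r = real d - 1" | "real d - 1 < r" "r < real d" | "r = real d" using r by linarith
  then show ?thesis
  proof cases
    case 1
    show ?thesis using eventually_ln_gt_1
    proof eventually_elim
      case (elim N)
      have "cost_rate d r (C * f_rate d r N) = C powr (1 + r) * ln (real N)"
        using 1 r elim C0 by (simp add: cost_rate_def f_rate_def Let_def powr_mult powr_powr)
      then show ?case using half[of "1 + r" "ln (real N)"] r elim by simp
    qed
  next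
    case 2
    have ps: "rate_exponents d r = (1 / real d, (real d - 2) / real d)" using 2 by (simp add: rate_exponents_def)
    have "\<forall>\<^sub>F N in sequentially. C * (ln (real N) powr (1 / real d) * ln (ln (real N)) powr ((real d - 2) / real d)) \<le> ln (real N)"
      by (rule eventually_compose_filterlim[OF log_powers_upper ln_real_at_top]) (use C0 d in auto)
    moreover have "\<forall>\<^sub>F N in sequentially. C * f_rate d r N > 1"
      using f_rate_at_top[OF r(1) d C0] by (auto simp: filterlim_at_top_dense)
    ultimately show ?thesis using eventually_ln_gt_1
    proof eventually_elim
      case (elim N)
      let ?L = "ln (real N)" and ?m = "C * f_rate d r N"
      have LL: "ln ?L > 0" using elim(3) by simp
      have m: "?m = C * (?L powr (1 / real d) * ln ?L powr ((real d - 2) / real d))"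
        using f_rate_eq[OF r(1) ps elim(3)] by simp
      have "?m \<le> ?L" using elim(1) by (simp only: m)
      then have "ln ?m \<le> ln ?L" using elim(2,3) by (subst ln_le_cancel_iff) linarith+
      moreover have "0 < ln ?m" using elim(2) by simp
      ultimately have le: "ln ?L powr (- (real d - 2)) \<le> ln ?m powr (- (real d - 2))"
        by (intro powr_mono2') (use d in auto)
      have md: "?m powr real d = C powr real d * (?L * ln ?L powr (real d - 2))"
        unfolding m using C0 elim(3) LL d by (simp add: powr_mult powr_powr)
      have one: "ln ?L powr (real d - 2) * ln ?L powr (- (real d - 2)) = 1"
        using LL by (simp add: powr_add[symmetric])
      have "C * ?L / (2 * real d) \<le> C powr real d * ?L" by (rule half) (use d elim(3) in auto)
      also have "\<dots> = ?m powr real d * ln ?L powr (- (real d - 2))"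
        unfolding md using one by (simp add: mult.assoc)
      also have "\<dots> \<le> ?m powr real d * ln ?m powr (- (real d - 2))" by (rule mult_left_mono[OF le]) simp
      also have "\<dots> = cost_rate d r ?m" using 2 by (simp add: cost_rate_def)
      finally show ?case .
    qed
  next
    case 3
    show ?thesis using eventually_ln_gt_1
    proof eventually_elim
      case (elim N)
      have "cost_rate d r (C * f_rate d r N) = C powr real d * ln (real N)"
        using 3 r elim C0 d by (simp add: cost_rate_def f_rate_def Let_def powr_mult powr_powr)
      then show ?case using half[OF d1] elim by simp
    qed
  next
    case 4
    have ps: "rate_exponents d r = (1 / real d, - 1 / real d)" using 4 by (simp add: rate_exponents_def)
    have "\<forall>\<^sub>F N in sequentially. ln (real N) powr (1 / real d / 2) \<le> C * (ln (real N) powr (1 / real d) * ln (ln (real N)) powr (- 1 / real d))"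
      by (rule eventually_compose_filterlim[OF log_powers_lower ln_real_at_top]) (use C0 d in auto)
    then show ?thesis using eventually_ln_gt_1
    proof eventually_elim
      case (elim N)
      let ?L = "ln (real N)" and ?m = "C * f_rate d r N"
      have LL: "ln ?L > 0" using elim(2) by simp
      have L0: "?L > 0" using elim(2) by simp
      have m: "?m = C * (?L powr (1 / real d) * ln ?L powr (- 1 / real d))"
        using f_rate_eq[OF r(1) ps elim(2)] by simp
      have "0 < ?L powr (1 / real d / 2)" using L0 by simp
      moreover have le: "?L powr (1 / real d / 2) \<le> ?m" using elim(1) by (simp only: m)
      ultimately have "0 < ?m" by (rule less_le_trans)
      with \<open>0 < ?L powr (1 / real d / 2)\<close> le have "ln (?L powr (1 / real d / 2)) \<le> ln ?m"
        by (simp only: ln_le_cancel_iff)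
      then have lm: "ln ?L / (2 * real d) \<le> ln ?m" using L0 by (simp add: ln_powr mult.commute)
      have md: "?m powr real d = C powr real d * ?L / ln ?L"
      proof -
        have "(ln ?L powr (- 1 / real d)) powr real d = inverse (ln ?L)"
          using d LL by (simp only: powr_powr) (simp add: powr_minus)
        moreover have "(?L powr (1 / real d)) powr real d = ?L" using d L0 by (simp add: powr_powr)
        ultimately show ?thesis unfolding m using C0 L0 LL by (simp add: powr_mult divide_inverse)
      qed
      have "C * ?L / (2 * real d) \<le> C powr real d * ?L / (2 * real d)"
        using Cp[OF d1] L0 d by (intro divide_right_mono mult_right_mono) auto
      also have "\<dots> = C powr real d * ?L / ln ?L * (ln ?L / (2 * real d))" using LL by simp
      also have "\<dots> \<le> C powr real d * ?L / ln ?L * ln ?m"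
        by (rule mult_left_mono[OF lm]) (use L0 LL in auto)
      also have "\<dots> = cost_rate d r ?m" using 4 md by (simp add: cost_rate_def)
      finally show ?case .
    qed
  qed
qed

lemma polynomial_box_vs_power:
  fixes K :: real and c d :: nat
  shows "(\<lambda>N. K * (real ((2 * (c * N ^ 3) + 1) ^ d) * exp (- ((3 * real d + 1) * ln (real N))))) \<longlonglongrightarrow> 0"
proof -
  have "(\<lambda>N. \<bar>K\<bar> * (2 * real c + 1) ^ d * inverse (real N)) \<longlonglongrightarrow> 0"
    by (intro tendsto_mult_right_zero lim_inverse_n)
  moreover have "\<forall>\<^sub>F N in sequentially. norm (K * (real ((2 * (c * N ^ 3) + 1) ^ d) * exp (- ((3 * real d + 1) * ln (real N)))))
      \<le> \<bar>K\<bar> * (2 * real c + 1) ^ d * inverse (real N)"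
    using eventually_gt_at_top[of 0]
  proof eventually_elim
    case (elim N)
    have N: "real N \<ge> 1" using elim by simp
    have "exp (- ((3 * real d + 1) * ln (real N))) = real N powr (- real (3 * d + 1))"
      using N by (simp add: powr_def algebra_simps)
    also have "\<dots> = inverse (real N ^ (3 * d + 1))" using N by (simp only: powr_minus powr_realpow)
    finally have e: "exp (- ((3 * real d + 1) * ln (real N))) = inverse (real N ^ (3 * d + 1))" .
    have "real ((2 * (c * N ^ 3) + 1) ^ d) \<le> ((2 * real c + 1) * real N ^ 3) ^ d"
    proof -
      have "2 * (real c * real N ^ 3) + 1 \<le> (2 * real c + 1) * real N ^ 3"
        using one_le_power[OF N, of 3] by (simp add: algebra_simps)
      then show ?thesis by (simp add: power_mono)
    qed
    then have "real ((2 * (c * N ^ 3) + 1) ^ d) * inverse (real N ^ (3 * d + 1))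
       \<le> ((2 * real c + 1) * real N ^ 3) ^ d * inverse (real N ^ (3 * d + 1))"
      by (rule mult_right_mono) (use N in auto)
    also have "\<dots> = (2 * real c + 1) ^ d * inverse (real N)"
      using N by (simp add: power_mult_distrib power_mult[symmetric] power_add)
    finally have "real ((2 * (c * N ^ 3) + 1) ^ d) * inverse (real N ^ (3 * d + 1)) \<le> (2 * real c + 1) ^ d * inverse (real N)" .
    then have "\<bar>K\<bar> * (real ((2 * (c * N ^ 3) + 1) ^ d) * inverse (real N ^ (3 * d + 1))) \<le> \<bar>K\<bar> * ((2 * real c + 1) ^ d * inverse (real N))"
      by (rule mult_left_mono) simp
    then show ?case unfolding e by (simp add: abs_mult mult.assoc)
  qed
  ultimately show ?thesis by (rule Lim_null_comparison[rotated])
qed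

section \<open>The maximal weight on an optimal path\<close>

context passage_percolation
begin

text \<open>A path is optimal if and only if it is at least as fast as each of the countably many paths with
  the same endpoints, so the infimum need not be considered.\<close>

lemma optimal_weight_event:
  "{\<omega> \<in> space M. (SUP \<gamma>\<in>optimal_paths d (\<lambda>e. \<tau> e \<omega>) v w. max_weight (\<lambda>e. \<tau> e \<omega>) \<gamma>) \<le> ereal c} \<in> events"
proof -
  have pt [measurable]: "(\<lambda>\<omega>. path_time (\<lambda>e. \<tau> e \<omega>) xs) \<in> borel_measurable M" if "xs \<in> paths d v w" for xs
  proof -
    have "set es \<subseteq> edges d \<Longrightarrow> (\<lambda>\<omega>. sum_list (map (\<lambda>e. \<tau> e \<omega>) es)) \<in> borel_measurable M" for es
    proof (induction es)
      case (Cons e es)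
      then have [measurable]: "\<tau> e \<in> borel_measurable M" "(\<lambda>\<omega>. sum_list (map (\<lambda>e. \<tau> e \<omega>) es)) \<in> borel_measurable M"
        using rv by auto
      show ?case by simp
    qed simp
    then show ?thesis unfolding path_time_def using paths_edges_subset[OF that] by blast
  qed
  have eq: "{\<omega> \<in> space M. (SUP \<gamma>\<in>optimal_paths d (\<lambda>e. \<tau> e \<omega>) v w. max_weight (\<lambda>e. \<tau> e \<omega>) \<gamma>) \<le> ereal c}
    = {\<omega> \<in> space M. \<forall>\<gamma>\<in>paths d v w. (\<forall>xs\<in>paths d v w. path_time (\<lambda>e. \<tau> e \<omega>) \<gamma> \<le> path_time (\<lambda>e. \<tau> e \<omega>) xs) \<longrightarrow>
        (\<forall>e\<in>set (path_edges \<gamma>). \<tau> e \<omega> \<le> c)}"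
  proof (rule Collect_cong, rule conj_cong[OF refl])
    fix \<omega> assume w: "\<omega> \<in> space M"
    have opt: "\<gamma> \<in> optimal_paths d (\<lambda>e. \<tau> e \<omega>) v w \<longleftrightarrow> \<gamma> \<in> paths d v w \<and> (\<forall>xs\<in>paths d v w. path_time (\<lambda>e. \<tau> e \<omega>) \<gamma> \<le> path_time (\<lambda>e. \<tau> e \<omega>) xs)" for \<gamma>
      by (rule optimal_paths_iff) (rule nonneg[OF _ w])
    show "((SUP \<gamma>\<in>optimal_paths d (\<lambda>e. \<tau> e \<omega>) v w. max_weight (\<lambda>e. \<tau> e \<omega>) \<gamma>) \<le> ereal c) =
      (\<forall>\<gamma>\<in>paths d v w. (\<forall>xs\<in>paths d v w. path_time (\<lambda>e. \<tau> e \<omega>) \<gamma> \<le> path_time (\<lambda>e. \<tau> e \<omega>) xs) \<longrightarrow>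
        (\<forall>e\<in>set (path_edges \<gamma>). \<tau> e \<omega> \<le> c))"
      unfolding SUP_le_iff max_weight_def ereal_less_eq Ball_def opt by blast
  qed
  show ?thesis unfolding eq
  proof (intro sets.sets_Collect_countable_All' sets.sets_Collect_imp countable_paths)
    fix \<gamma> xs assume g: "\<gamma> \<in> paths d v w" and "xs \<in> paths d v w"
    then show "{\<omega> \<in> space M. path_time (\<lambda>e. \<tau> e \<omega>) \<gamma> \<le> path_time (\<lambda>e. \<tau> e \<omega>) xs} \<in> events"
      using pt by measurable
  next
    fix \<gamma> e assume g: "\<gamma> \<in> paths d v w" and e: "e \<in> set (path_edges \<gamma>)"
    have [measurable]: "\<tau> e \<in> borel_measurable M" using rv paths_edges_subset[OF g] e by blast
    show "{\<omega> \<in> space M. \<tau> e \<omega> \<le> c} \<in> events" by measurable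
  qed (auto intro: countable_finite)
qed

lemma heavy_edge_event:
  assumes S: "finite S" and m: "m \<ge> 0"
  shows "{\<omega> \<in> space M. \<exists>e\<in>touching d S. m \<le> \<tau> e \<omega>} \<in> events" (is "?B \<in> _")
    and "prob {\<omega> \<in> space M. \<exists>e\<in>touching d S. m \<le> \<tau> e \<omega>} \<le> real (card S * 3 ^ d) * (a * exp (- b * m powr r))"
proof -
  have fin: "finite (touching d S)" using S by simp
  have e: "e \<in> edges d" if "e \<in> touching d S" for e using that by (simp add: touching_def)
  have ev: "{\<omega> \<in> space M. m \<le> \<tau> e \<omega>} \<in> events" if "e \<in> touching d S" for e
    using rv[OF e[OF that]] by measurable
  have eq: "?B = (\<Union>e\<in>touching d S. {\<omega> \<in> space M. m \<le> \<tau> e \<omega>})" by auto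
  show "?B \<in> events" unfolding eq by (intro sets.finite_UN fin ev)
  have "prob ?B \<le> (\<Sum>e\<in>touching d S. prob {\<omega> \<in> space M. m \<le> \<tau> e \<omega>})"
    unfolding eq by (rule finite_measure_subadditive_finite[OF fin]) (use ev in auto)
  also have "\<dots> \<le> (\<Sum>e\<in>touching d S. a * exp (- b * m powr r))" by (intro sum_mono tail e m)
  also have "\<dots> = real (card (touching d S)) * (a * exp (- b * m powr r))" by simp
  also have "\<dots> \<le> real (card S * 3 ^ d) * (a * exp (- b * m powr r))"
    by (intro mult_right_mono of_nat_mono card_touching S) (use a_pos in auto)
  finally show "prob ?B \<le> real (card S * 3 ^ d) * (a * exp (- b * m powr r))" .
qed

text \<open>A union bound over polynomially many edges. For \<open>r > d\<close>, when the rate is \<open>ln N powr (1 / r)\<close>, this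
  replaces the analysis of bad vertices.\<close>

lemma no_heavy_edge_in_box:
  "\<exists>C>0. (\<lambda>N. prob {\<omega> \<in> space M. \<exists>e\<in>touching d (lbox d origin (c * N ^ 3)). C * ln (real N) powr (1 / r) \<le> \<tau> e \<omega>}) \<longlonglongrightarrow> 0"
proof -
  define C where "C = ((3 * real d + 1) / b) powr (1 / r)"
  have C: "C > 0" using b_pos by (simp add: C_def add_nonneg_pos)
  have Cr: "C powr r = (3 * real d + 1) / b" using r_pos b_pos by (simp add: C_def powr_powr add_nonneg_nonneg)
  have "(\<lambda>N. prob {\<omega> \<in> space M. \<exists>e\<in>touching d (lbox d origin (c * N ^ 3)). C * ln (real N) powr (1 / r) \<le> \<tau> e \<omega>}) \<longlonglongrightarrow> 0"
  proof (rule Lim_null_comparison[OF _ polynomial_box_vs_power[of "3 ^ d * a" c d]])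
    show "\<forall>\<^sub>F N in sequentially. norm (prob {\<omega> \<in> space M. \<exists>e\<in>touching d (lbox d origin (c * N ^ 3)). C * ln (real N) powr (1 / r) \<le> \<tau> e \<omega>})
      \<le> 3 ^ d * a * (real ((2 * (c * N ^ 3) + 1) ^ d) * exp (- ((3 * real d + 1) * ln (real N))))"
      using eventually_ln_gt_1
    proof eventually_elim
      case (elim N)
      have "b * (C * ln (real N) powr (1 / r)) powr r = (3 * real d + 1) * ln (real N)"
        using C elim r_pos b_pos by (simp add: powr_mult powr_powr Cr)
      then show ?case
        using heavy_edge_event(2)[of "lbox d origin (c * N ^ 3)" "C * ln (real N) powr (1 / r)"] C
        by (simp add: card_lbox mult_ac)
    qed
  qed
  then show ?thesis using C by blast
qed

text \<open>Near the endpoints the spheres need not be crossed twice, but there are so few edges that none of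
  them is heavy.\<close>

lemma heavy_edges_near_endpoints:
  assumes \<eta>: "\<eta> > 0" and m: "filterlim m at_top sequentially"
  shows "(\<lambda>N. prob {\<omega> \<in> space M. \<exists>e\<in>touching d (lbox d origin (nat \<lfloor>\<eta> * m N\<rfloor>) \<union> lbox d (axis_point N) (nat \<lfloor>\<eta> * m N\<rfloor>)).
    m N \<le> \<tau> e \<omega>}) \<longlonglongrightarrow> 0"
proof -
  define g where "g x = 2 * (2 * (\<eta> * x) + 1) ^ d * 3 ^ d * (a * exp (- b * x powr r))" for x :: real
  have "(g \<longlongrightarrow> 0) at_top" unfolding g_def using \<eta> a_pos b_pos r_pos by real_asymp
  then have lim: "(\<lambda>N. g (m N)) \<longlonglongrightarrow> 0" by (rule filterlim_compose[OF _ m])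
  have "\<forall>\<^sub>F N in sequentially. m N > 0" using m by (auto simp: filterlim_at_top_dense)
  then have "\<forall>\<^sub>F N in sequentially. norm (prob {\<omega> \<in> space M. \<exists>e\<in>touching d (lbox d origin (nat \<lfloor>\<eta> * m N\<rfloor>) \<union> lbox d (axis_point N) (nat \<lfloor>\<eta> * m N\<rfloor>)).
    m N \<le> \<tau> e \<omega>}) \<le> g (m N)"
  proof eventually_elim
    case (elim N)
    define J where "J = nat \<lfloor>\<eta> * m N\<rfloor>"
    have m0: "0 \<le> \<eta> * m N" using elim \<eta> by simp
    have J: "real J \<le> \<eta> * m N" unfolding J_def using m0 by linarith
    let ?S = "lbox d origin J \<union> lbox d (axis_point N) J"
    have "card ?S \<le> card (lbox d origin J) + card (lbox d (axis_point N) J)" by (rule card_Un_le)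
    then have cS: "card ?S \<le> 2 * (2 * J + 1) ^ d" by (simp add: card_lbox)
    have "real (card ?S) \<le> real (2 * (2 * J + 1) ^ d)" by (rule of_nat_mono[OF cS])
    also have "\<dots> = 2 * (2 * real J + 1) ^ d" by (simp add: add.commute)
    also have "\<dots> \<le> 2 * (2 * (\<eta> * m N) + 1) ^ d" by (intro mult_left_mono power_mono) (use J in auto)
    finally have c2: "real (card ?S) \<le> 2 * (2 * (\<eta> * m N) + 1) ^ d" .
    have "prob {\<omega> \<in> space M. \<exists>e\<in>touching d ?S. m N \<le> \<tau> e \<omega>} \<le> real (card ?S * 3 ^ d) * (a * exp (- b * m N powr r))"
      by (rule heavy_edge_event(2)) (use elim in auto)
    also have "\<dots> = real (card ?S) * (3 ^ d * (a * exp (- b * m N powr r)))" by simp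
    also have "\<dots> \<le> 2 * (2 * (\<eta> * m N) + 1) ^ d * (3 ^ d * (a * exp (- b * m N powr r)))"
      by (rule mult_right_mono[OF c2]) (use a_pos in auto)
    finally show ?case unfolding J_def[symmetric] by (simp add: g_def mult.assoc)
  qed
  then show ?thesis using lim by (rule Lim_null_comparison)
qed

text \<open>The box of radius \<open>c * N ^ 3\<close> has of order \<open>N ^ (3 * d)\<close> vertices, and \<open>C\<close> is chosen such that each of them is
  bad with probability at most \<open>N powr (- (3 * d + 1))\<close>.\<close>

lemma no_bad_vertex_in_box:
  assumes r: "r \<le> real d"
  shows "\<exists>\<eta>>0. \<exists>C>0. \<exists>B. (\<forall>N. B N \<in> events) \<and> (\<lambda>N. prob (B N)) \<longlonglongrightarrow> 0 \<and>
    (\<forall>\<^sub>F N in sequentially. \<forall>x\<in>lbox d origin (c * N ^ 3).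
       bad_vertex (C * f_rate d r N) (nat \<lfloor>\<eta> * (C * f_rate d r N)\<rfloor>) x \<subseteq> B N)"
proof -
  obtain \<eta> c' where \<eta>: "\<eta> > 0" and c': "c' > 0" and ev: "\<forall>\<^sub>F m in at_top. \<forall>x. covered_by (bad_vertex m (nat \<lfloor>\<eta> * m\<rfloor>) x) (exp (- (c' * cost_rate d r m)))"
    using bad_vertex_decay[OF r] by (elim exE conjE)
  \<comment> \<open>large enough for the exponent \<open>3 * d + 1\<close>\<close>
  define C where "C = max 1 ((3 * real d + 1) * (2 * real d) / c')"
  have C1: "C \<ge> 1" by (simp add: C_def)
  have Cc: "(3 * real d + 1) \<le> c' * (C / (2 * real d))"
  proof -
    have "(3 * real d + 1) * (2 * real d) / c' \<le> C" by (simp add: C_def)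
    then show ?thesis using c' d2 by (simp add: field_simps)
  qed
  define m where "m N = C * f_rate d r N" for N
  have mlim: "filterlim m at_top sequentially" unfolding m_def
    by (rule f_rate_at_top) (use r_pos d2 C1 in auto)
  have ev1: "\<forall>\<^sub>F N in sequentially. \<forall>x. covered_by (bad_vertex (m N) (nat \<lfloor>\<eta> * m N\<rfloor>) x) (exp (- (c' * cost_rate d r (m N))))"
    by (rule eventually_compose_filterlim[OF ev mlim])
  have ev2: "\<forall>\<^sub>F N in sequentially. \<forall>x. covered_by (bad_vertex (m N) (nat \<lfloor>\<eta> * m N\<rfloor>) x) (exp (- ((3 * real d + 1) * ln (real N))))"
    using ev1 cost_rate_of_f_rate[OF r_pos r d2 C1] eventually_ln_gt_1
  proof eventually_elim
    case (elim N)
    have "(3 * real d + 1) * ln (real N) \<le> c' * (C / (2 * real d)) * ln (real N)"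
      by (rule mult_right_mono[OF Cc]) (use elim(3) in simp)
    also have "\<dots> = c' * (C * ln (real N) / (2 * real d))" by simp
    also have "\<dots> \<le> c' * cost_rate d r (m N)" unfolding m_def by (rule mult_left_mono[OF elim(2)]) (use c' in simp)
    finally have le: "exp (- (c' * cost_rate d r (m N))) \<le> exp (- ((3 * real d + 1) * ln (real N)))" by simp
    show ?case
    proof
      fix x
      obtain B where "B \<in> events" "bad_vertex (m N) (nat \<lfloor>\<eta> * m N\<rfloor>) x \<subseteq> B" "prob B \<le> exp (- (c' * cost_rate d r (m N)))"
        using elim(1) by blast
      then show "covered_by (bad_vertex (m N) (nat \<lfloor>\<eta> * m N\<rfloor>) x) (exp (- ((3 * real d + 1) * ln (real N))))"
        using order_trans[OF _ le] by blast
    qed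
  qed
  \<comment> \<open>covering events exist for large \<open>N\<close> only; for small \<open>N\<close> the empty set serves as a default\<close>
  define P where "P N x B \<longleftrightarrow> B \<in> events \<and> bad_vertex (m N) (nat \<lfloor>\<eta> * m N\<rfloor>) x \<subseteq> B \<and>
    prob B \<le> exp (- ((3 * real d + 1) * ln (real N)))" for N x B
  define D where "D N x = (if \<exists>B. P N x B then SOME B. P N x B else {})" for N x
  have DP: "P N x (D N x)" if "\<exists>B. P N x B" for N x
    unfolding D_def using that by (simp add: someI_ex)
  have D: "D N x \<in> events" for N x
  proof (cases "\<exists>B. P N x B")
    case True
    then show ?thesis using DP[OF True] by (simp add: P_def)
  next
    case False
    then have "D N x = {}" by (simp add: D_def)
    then show ?thesis by simp
  qed
  have ev3: "\<forall>\<^sub>F N in sequentially. \<forall>x. P N x (D N x)"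
    using ev2 by eventually_elim (intro allI DP, unfold P_def, blast)
  define B where "B N = (\<Union>x\<in>lbox d origin (c * N ^ 3). D N x)" for N
  have "B N \<in> events" for N unfolding B_def by (intro sets.finite_UN D) auto
  moreover have "(\<lambda>N. prob (B N)) \<longlonglongrightarrow> 0"
  proof (rule Lim_null_comparison[OF _ polynomial_box_vs_power[of 1 c d]])
    show "\<forall>\<^sub>F N in sequentially. norm (prob (B N)) \<le> 1 * (real ((2 * (c * N ^ 3) + 1) ^ d) * exp (- ((3 * real d + 1) * ln (real N))))"
      using ev3
    proof eventually_elim
      case (elim N)
      have "prob (B N) \<le> (\<Sum>x\<in>lbox d origin (c * N ^ 3). prob (D N x))"
        unfolding B_def by (rule finite_measure_subadditive_finite) (use D in auto)
      also have "\<dots> \<le> (\<Sum>x\<in>lbox d origin (c * N ^ 3). exp (- ((3 * real d + 1) * ln (real N))))"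
        by (intro sum_mono) (use elim in \<open>simp add: P_def\<close>)
      finally show ?case by (simp add: card_lbox)
    qed
  qed
  moreover have "\<forall>\<^sub>F N in sequentially. \<forall>x\<in>lbox d origin (c * N ^ 3). bad_vertex (m N) (nat \<lfloor>\<eta> * m N\<rfloor>) x \<subseteq> B N"
    using ev3
  proof eventually_elim
    case (elim N)
    then show ?case unfolding B_def P_def by blast
  qed
  ultimately show ?thesis
    using \<eta> C1 unfolding m_def by (intro exI[of _ \<eta>] conjI exI[of _ C] exI[of _ B]) auto
qed

lemma prob_tendsto_1:
  assumes A: "\<And>N. A N \<in> events" and B: "\<And>N. B N \<in> events" and lim: "(\<lambda>N. prob (B N)) \<longlonglongrightarrow> 0"
    and sub: "\<forall>\<^sub>F N in sequentially. space M - B N \<subseteq> A N"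
  shows "(\<lambda>N. prob (A N)) \<longlonglongrightarrow> 1"
proof (rule tendsto_sandwich[OF _ _ _ tendsto_const])
  have "(\<lambda>N. 1 - prob (B N)) \<longlonglongrightarrow> 1 - 0" by (intro tendsto_diff tendsto_const lim)
  then show "(\<lambda>N. 1 - prob (B N)) \<longlonglongrightarrow> 1" by simp
  show "\<forall>\<^sub>F N in sequentially. 1 - prob (B N) \<le> prob (A N)"
    using sub
  proof eventually_elim
    case (elim N)
    have "1 - prob (B N) = prob (space M - B N)" by (rule prob_compl[OF B, symmetric])
    also have "\<dots> \<le> prob (A N)" by (rule finite_measure_mono[OF elim A])
    finally show ?case .
  qed
qed simp

lemma prob_Un_tendsto_0:
  assumes "\<And>N. A N \<in> events" "\<And>N. B N \<in> events" "(\<lambda>N. prob (A N)) \<longlonglongrightarrow> 0" "(\<lambda>N. prob (B N)) \<longlonglongrightarrow> 0"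
  shows "(\<lambda>N. prob (A N \<union> B N)) \<longlonglongrightarrow> 0"
  by (rule squeeze_to_zero[OF measure_nonneg measure_Un_le[OF assms(1,2)]]) (use tendsto_add[OF assms(3,4)] in simp)

lemma optimal_weights_le:
  assumes "\<And>\<gamma> e. \<gamma> \<in> optimal_paths d t v w \<Longrightarrow> e \<in> set (path_edges \<gamma>) \<Longrightarrow> t e \<le> c"
  shows "(SUP \<gamma>\<in>optimal_paths d t v w. max_weight t \<gamma>) \<le> ereal c"
  unfolding max_weight_def by (intro SUP_least) (use assms in auto)

theorem maximal_weight_on_optimal_paths:
  "\<exists>C>0. (\<lambda>N. prob {\<omega> \<in> space M.
     (SUP \<gamma>\<in>optimal_paths d (\<lambda>e. \<tau> e \<omega>) origin (axis_point N). max_weight (\<lambda>e. \<tau> e \<omega>) \<gamma>)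
       \<le> ereal (C * f_rate d r N)}) \<longlonglongrightarrow> 1"
proof -
  obtain c B0 where B0: "\<And>N. B0 N \<in> events" "(\<lambda>N. prob (B0 N)) \<longlonglongrightarrow> 0"
    and conf: "\<And>N \<omega> \<gamma>. N \<ge> 1 \<Longrightarrow> \<omega> \<in> space M - B0 N \<Longrightarrow>
      \<gamma> \<in> optimal_paths d (\<lambda>e. \<tau> e \<omega>) origin (axis_point N) \<Longrightarrow> set \<gamma> \<subseteq> lbox d origin (c * N ^ 3)"
    using optimal_paths_confined by blast
  have edge_vertex: "\<exists>ys x y zs. \<gamma> = ys @ x # y # zs \<and> e = {x, y} \<and> x \<in> lbox d origin (c * N ^ 3) \<and> e \<in> edges d"
    if N: "N \<ge> 1" and w: "\<omega> \<in> space M - B0 N"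
      and g: "\<gamma> \<in> optimal_paths d (\<lambda>e. \<tau> e \<omega>) origin (axis_point N)" and e: "e \<in> set (path_edges \<gamma>)"
    for N \<omega> \<gamma> e
  proof -
    obtain ys x y zs where 1: "\<gamma> = ys @ x # y # zs" "e = {x, y}" using path_edge_split[OF e] by blast
    have "\<gamma> \<in> paths d origin (axis_point N)" using g by (simp add: optimal_paths_def)
    from subsetD[OF paths_edges_subset[OF this] e] have "e \<in> edges d" .
    moreover have "x \<in> lbox d origin (c * N ^ 3)" using conf[OF N w g] 1 by auto
    ultimately show ?thesis using 1 by blast
  qed
  show ?thesis
  proof (cases "r \<le> real d")
    case True
    obtain \<eta> C B1 where \<eta>: "\<eta> > 0" and C: "C > 0" and B1: "\<forall>N. B1 N \<in> events" "(\<lambda>N. prob (B1 N)) \<longlonglongrightarrow> 0"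
      and bad: "\<forall>\<^sub>F N in sequentially. \<forall>x\<in>lbox d origin (c * N ^ 3).
         bad_vertex (C * f_rate d r N) (nat \<lfloor>\<eta> * (C * f_rate d r N)\<rfloor>) x \<subseteq> B1 N"
      using no_bad_vertex_in_box[OF True, of c] by (elim exE conjE)
    define m where "m N = C * f_rate d r N" for N
    define J where "J N = nat \<lfloor>\<eta> * m N\<rfloor>" for N
    \<comment> \<open>for small \<open>N\<close> the rate may be negative, where the tail bound says nothing\<close>
    define B2 where "B2 N = (if 0 \<le> m N then {\<omega> \<in> space M. \<exists>e\<in>touching d (lbox d origin (J N) \<union> lbox d (axis_point N) (J N)). m N \<le> \<tau> e \<omega>} else {})" for N
    have mlim: "filterlim m at_top sequentially" unfolding m_def
      by (rule f_rate_at_top[OF r_pos d2 C])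
    have mpos: "\<forall>\<^sub>F N in sequentially. 0 \<le> m N" using mlim by (auto simp: filterlim_at_top)
    have B2: "B2 N \<in> events" for N unfolding B2_def by (auto intro!: heavy_edge_event(1))
    have B2lim: "(\<lambda>N. prob (B2 N)) \<longlonglongrightarrow> 0"
    proof (rule Lim_transform_eventually[OF heavy_edges_near_endpoints[OF \<eta> mlim]])
      show "\<forall>\<^sub>F N in sequentially. prob {\<omega> \<in> space M. \<exists>e\<in>touching d (lbox d origin (nat \<lfloor>\<eta> * m N\<rfloor>) \<union> lbox d (axis_point N) (nat \<lfloor>\<eta> * m N\<rfloor>)).
         m N \<le> \<tau> e \<omega>} = prob (B2 N)"
        using mpos by eventually_elim (simp add: B2_def J_def)
    qed
    have lim: "(\<lambda>N. prob (B0 N \<union> B1 N \<union> B2 N)) \<longlonglongrightarrow> 0"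
      by (intro prob_Un_tendsto_0 sets.Un B0 B1(2) B2 B2lim B1(1)[rule_format])
    have good: "\<forall>\<^sub>F N in sequentially. space M - (B0 N \<union> B1 N \<union> B2 N) \<subseteq>
       {\<omega> \<in> space M. (SUP \<gamma>\<in>optimal_paths d (\<lambda>e. \<tau> e \<omega>) origin (axis_point N). max_weight (\<lambda>e. \<tau> e \<omega>) \<gamma>) \<le> ereal (m N)}"
      using bad mpos eventually_ge_at_top[of 1]
    proof eventually_elim
      case (elim N)
      show ?case
      proof (intro subsetI CollectI conjI optimal_weights_le)
        fix \<omega> assume w: "\<omega> \<in> space M - (B0 N \<union> B1 N \<union> B2 N)"
        then show sp: "\<omega> \<in> space M" by simp
        fix \<gamma> e assume g: "\<gamma> \<in> optimal_paths d (\<lambda>e. \<tau> e \<omega>) origin (axis_point N)" and e: "e \<in> set (path_edges \<gamma>)"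
        obtain ys x y zs where dec: "\<gamma> = ys @ x # y # zs" and exy: "e = {x, y}"
          and x: "x \<in> lbox d origin (c * N ^ 3)" and ed: "e \<in> edges d"
          using edge_vertex[OF elim(3) _ g e] w by blast
        have xl: "x \<in> lattice d" using x by (simp add: lbox_def)
        show "\<tau> e \<omega> \<le> m N"
        proof (rule ccontr)
          assume "\<not> \<tau> e \<omega> \<le> m N"
          then have heavy: "m N \<le> \<tau> {x, y} \<omega>" by (simp add: exy)
          have "x \<notin> lbox d origin (J N) \<union> lbox d (axis_point N) (J N)"
          proof
            assume "x \<in> lbox d origin (J N) \<union> lbox d (axis_point N) (J N)"
            then have "e \<in> touching d (lbox d origin (J N) \<union> lbox d (axis_point N) (J N))"
              using ed exy by (auto simp: touching_def)
            then have "\<omega> \<in> B2 N" using elim(2) heavy exy sp by (auto simp: B2_def)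
            then show False using w by simp
          qed
          then have far: "origin \<notin> lbox d x (J N)" "axis_point N \<notin> lbox d x (J N)"
            using lbox_sym[of origin d x] lbox_sym[of "axis_point N" d x] lbox_sym[OF xl] by auto
          have "\<omega> \<in> bad_vertex (m N) (J N) x"
            unfolding bad_vertex_def
            using heavy_edge_on_optimal_path[OF _ g dec heavy far] nonneg[OF _ sp] sp by auto
          moreover have "bad_vertex (m N) (J N) x \<subseteq> B1 N" using elim(1) x unfolding m_def J_def by blast
          ultimately show False using w by blast
        qed
      qed
    qed
    have "(\<lambda>N. prob {\<omega> \<in> space M. (SUP \<gamma>\<in>optimal_paths d (\<lambda>e. \<tau> e \<omega>) origin (axis_point N). max_weight (\<lambda>e. \<tau> e \<omega>) \<gamma>) \<le> ereal (m N)}) \<longlonglongrightarrow> 1"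
      by (rule prob_tendsto_1[OF optimal_weight_event _ lim good]) (use B0 B1 B2 in auto)
    then show ?thesis using C unfolding m_def by blast
  next
    case False
    obtain C where C: "C > 0" and lim1: "(\<lambda>N. prob {\<omega> \<in> space M. \<exists>e\<in>touching d (lbox d origin (c * N ^ 3)). C * ln (real N) powr (1 / r) \<le> \<tau> e \<omega>}) \<longlonglongrightarrow> 0"
      using no_heavy_edge_in_box[of c] by (elim exE conjE)
    define B1 where "B1 N = {\<omega> \<in> space M. \<exists>e\<in>touching d (lbox d origin (c * N ^ 3)). C * ln (real N) powr (1 / r) \<le> \<tau> e \<omega>}" for N
    have B1: "B1 N \<in> events" for N unfolding B1_def by (rule heavy_edge_event(1)) (use C in auto)
    have f: "f_rate d r N = ln (real N) powr (1 / r)" for N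
      using False r_pos by (simp add: f_rate_def Let_def)
    have lim: "(\<lambda>N. prob (B0 N \<union> B1 N)) \<longlonglongrightarrow> 0"
      by (intro prob_Un_tendsto_0 B0 B1) (use lim1 in \<open>simp add: B1_def\<close>)
    have good: "\<forall>\<^sub>F N in sequentially. space M - (B0 N \<union> B1 N) \<subseteq>
       {\<omega> \<in> space M. (SUP \<gamma>\<in>optimal_paths d (\<lambda>e. \<tau> e \<omega>) origin (axis_point N). max_weight (\<lambda>e. \<tau> e \<omega>) \<gamma>) \<le> ereal (C * f_rate d r N)}"
      using eventually_ge_at_top[of 1]
    proof eventually_elim
      case (elim N)
      show ?case
      proof (intro subsetI CollectI conjI optimal_weights_le)
        fix \<omega> assume w: "\<omega> \<in> space M - (B0 N \<union> B1 N)"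
        then show sp: "\<omega> \<in> space M" by simp
        fix \<gamma> e assume g: "\<gamma> \<in> optimal_paths d (\<lambda>e. \<tau> e \<omega>) origin (axis_point N)" and e: "e \<in> set (path_edges \<gamma>)"
        obtain ys x y zs where exy: "e = {x, y}" and x: "x \<in> lbox d origin (c * N ^ 3)" and ed: "e \<in> edges d"
          using edge_vertex[OF elim _ g e] w by blast
        have "e \<in> touching d (lbox d origin (c * N ^ 3))" using ed exy x by (auto simp: touching_def)
        then show "\<tau> e \<omega> \<le> C * f_rate d r N" using w sp by (force simp: B1_def f)
      qed
    qed
    show ?thesis
      by (rule exI[of _ C], rule conjI[OF C], rule prob_tendsto_1[OF optimal_weight_event _ lim good]) (use B0 B1 in auto)
  qed
qed

end

theorem theorem1p1:
  fixes d :: nat and M :: "'a measure" and \<tau> :: "edge \<Rightarrow> 'a \<Rightarrow> real" and r a b :: real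
  assumes "d \<ge> 2"
    and "prob_space M"
    and "prob_space.indep_vars M (\<lambda>_. borel) \<tau> (edges d)"
    and "\<And>e e'. e \<in> edges d \<Longrightarrow> e' \<in> edges d \<Longrightarrow> distr M borel (\<tau> e) = distr M borel (\<tau> e')"
    and "\<And>e \<omega>. e \<in> edges d \<Longrightarrow> \<omega> \<in> space M \<Longrightarrow> \<tau> e \<omega> \<ge> 0"
    and "r > 0" and "a > 0" and "b > 0"
    and "\<And>e t. e \<in> edges d \<Longrightarrow> t \<ge> 0 \<Longrightarrow>
           measure M {\<omega> \<in> space M. \<tau> e \<omega> \<ge> t} \<le> a * exp (- b * t powr r)"
    and "\<And>e. e \<in> edges d \<Longrightarrow>
           measure M {\<omega> \<in> space M. \<tau> e \<omega> = 0} < critical_probability d"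
  shows "\<exists>C>0. (\<lambda>N::nat. measure M {\<omega> \<in> space M.
           (SUP \<gamma>\<in>optimal_paths d (\<lambda>e. \<tau> e \<omega>) origin (\<lambda>i. int N * e1 i).
              max_weight (\<lambda>e. \<tau> e \<omega>) \<gamma>) \<le> ereal (C * f_rate d r N)}) \<longlonglongrightarrow> 1"
proof -
  interpret prob_space M by fact
  interpret passage_percolation M d \<tau> r a b
    by unfold_locales (rule assms; assumption)+
  show ?thesis using maximal_weight_on_optimal_paths unfolding axis_point_def .
qed

end
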